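(* Let $n\ge1$ and let $\alpha,\beta\in\mathbb C^n$ satisfy $\Re\alpha_j+\Re\beta_j>-1$ and $\alpha_j,\beta_j\notin\{-1,-2,\ldots\}$ for all $1\le j\le n$. Let $\mu$ be a complex Borel measure on $\mathbb T^n$ and $u=P_{\alpha,\beta}[d\mu]$. Then $$RNT\text{-}\lim_{z\to\zeta}u(z)=f(\zeta)\quad\text{for almost every }\zeta\in\mathbb T^n,$$ where $d\mu=f\,dm_n+d\sigma$ is the Lebesgue–Radon–Nikodym decomposition of $\mu$ into its absolutely continuous part $f\,dm_n$ and its singular part $d\sigma$ (with respect to $m_n$).
   Context: $\mathbb D$ is the open unit disc and $\mathbb T$ the unit circle; $m_n$ is the normalized Haar measure on $\mathbb T^n$. The $(\alpha,\beta)$-Poisson kernel is, for $z\in\mathbb D^n$, $\zeta\in\mathbb T^n$ (principal branches of powers), $$P_{\alpha,\beta}(z,\zeta)=\prod_{j=1}^n c_{\alpha_j,\beta_j}\frac{(1-|z_j|^2)^{\alpha_j+\beta_j+1}}{(1-z_j\overline{\zeta_j})^{\alpha_j+1}(1-\overline{z_j}\zeta_j)^{\beta_j+1}},\qquad c_{a,b}=\frac{\Gamma(a+1)\Gamma(b+1)}{\Gamma(a+b+1)},$$ and $P_{\alpha,\beta}[d\mu](z)=\int_{\mathbb T^n}P_{\alpha,\beta}(z,\zeta)\,d\mu(\zeta)$, $z\in\mathbb D^n$. The Stolz region at $e^{i\varphi}\in\mathbb T$ is $S_A(e^{i\varphi})=\{re^{i(\varphi-\theta)}:0\le r<1,\ |\theta|\le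 A(1-r)\}$. For $\eta\in\mathbb T^n$, $0<A<\infty$, $1\le B<\infty$, $S_A(\eta)=\prod_{j=1}^nS_A(\eta_j)$ and $$S_{A,B}(\eta)=\Big\{(z_1,\ldots,z_n)\in S_A(\eta):\max_{j,k}\frac{1-|z_j|}{1-|z_k|}\le B\Big\}.$$ $RNT$-$\lim_{z\to\eta}u(z)=l$ (restricted non-tangential limit) means: for every $0<A<\infty$ and $1\le B<\infty$ and every $\varepsilon>0$ there is $\delta>0$ such that $|u(z)-l|<\varepsilon$ whenever $|z-\eta|<\delta$ and $z\in S_{A,B}(\eta)$. *)

theory Defs
  imports "HOL-Probability.Probability"
begin

definition torus :: "(complex ^ 'n) set" where
  "torus = {\<zeta>. \<forall>j. cmod (\<zeta> $ j) = 1}"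

definition torus_borel :: "(complex ^ 'n) measure" where
  "torus_borel = restrict_space borel torus"

text \<open>Normalized Haar measure on the torus, as the image of the uniform distribution on
  \<open>[0, 2\<pi>]\<^sup>n\<close> under \<open>t \<mapsto> (exp (i t\<^sub>1), \<dots>, exp (i t\<^sub>n))\<close>.\<close>

definition torus_haar :: "(complex ^ 'n) measure" where
  "torus_haar =
     distr (uniform_measure lborel (cbox 0 (\<chi> j. 2 * pi) :: (real ^ 'n) set)) torus_borel
       (\<lambda>t. \<chi> j. cis (t $ j))"

lemma measurable_torus_param:
  "(\<lambda>t::real ^ 'n. \<chi> j. cis (t $ j)) \<in> borel \<rightarrow>\<^sub>M torus_borel"
proof -
  have "continuous_on UNIV (\<lambda>t::real ^ 'n. \<chi> j. cis (t $ j))"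
    by (intro continuous_on_vec_lambda) (auto intro!: continuous_intros simp: cis_conv_exp)
  then show ?thesis
    unfolding torus_borel_def
    by (intro measurable_restrict_space2 borel_measurable_continuous_onI) (auto simp: torus_def)
qed

lemma prob_space_torus_haar: "prob_space (torus_haar :: (complex ^ 'n) measure)"
proof -
  let ?C = "cbox 0 (\<chi> j. 2 * pi) :: (real ^ 'n) set"
  have pos: "(\<chi> j. 2 * pi :: real ^ 'n) \<bullet> b > 0" if "b \<in> Basis" for b
    using that by (auto simp: Basis_vec_def inner_axis)
  then have "emeasure lborel ?C = ennreal (\<Prod>b\<in>Basis. (\<chi> j. 2 * pi :: real ^ 'n) \<bullet> b)"
    by (auto simp: emeasure_lborel_cbox_eq less_imp_le)
  moreover have "(\<Prod>b\<in>Basis. (\<chi> j. 2 * pi :: real ^ 'n) \<bullet> b) > 0"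
    using pos by (rule prod_pos)
  ultimately have "emeasure lborel ?C \<noteq> 0" "emeasure lborel ?C \<noteq> \<infinity>"
    by (simp_all add: ennreal_eq_0_iff not_le)
  then have "prob_space (uniform_measure lborel ?C)"
    by (rule prob_space_uniform_measure)
  moreover have "(\<lambda>t::real ^ 'n. \<chi> j. cis (t $ j)) \<in> uniform_measure lborel ?C \<rightarrow>\<^sub>M torus_borel"
    using measurable_torus_param by (simp cong: measurable_cong_sets)
  ultimately show ?thesis
    unfolding torus_haar_def by (rule prob_space.prob_space_distr)
qed

text \<open>A complex measure is a countably additive complex function on the \<open>\<sigma>\<close>-algebra of \<open>M\<close>; the
  measure carried by \<open>M\<close> itself plays no role.  The convergence of the series is part of the
  requirement, and \<open>\<mu> {} = 0\<close> follows.\<close>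

definition complex_measure :: "'a measure \<Rightarrow> ('a set \<Rightarrow> complex) \<Rightarrow> bool" where
  "complex_measure M \<mu> \<longleftrightarrow>
     (\<forall>A. range A \<subseteq> sets M \<longrightarrow> disjoint_family A \<longrightarrow>
        (\<lambda>i::nat. \<mu> (A i)) sums \<mu> (\<Union>i. A i))"

text \<open>Jordan decomposition: the positive part of a finite signed measure \<open>\<nu>\<close> on the
  \<open>\<sigma>\<close>-algebra of \<open>M\<close> is \<open>\<nu>\<^sup>+(A) = sup {\<nu>(B) | B \<subseteq> A}\<close>, and its negative part is the
  positive part of \<open>-\<nu>\<close>.  As \<open>B = {}\<close> is allowed, truncating \<open>\<nu>(B)\<close> at \<open>0\<close> by \<^const>\<open>ennreal\<close> does not
  change the supremum.\<close>

definition pos_part_measure :: "'a measure \<Rightarrow> ('a set \<Rightarrow> real) \<Rightarrow> 'a measure" where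
  "pos_part_measure M \<nu> =
     measure_of (space M) (sets M) (\<lambda>A. SUP B\<in>{B \<in> sets M. B \<subseteq> A}. ennreal (\<nu> B))"

definition signed_integral :: "'a measure \<Rightarrow> ('a set \<Rightarrow> real) \<Rightarrow> ('a \<Rightarrow> complex) \<Rightarrow> complex" where
  "signed_integral M \<nu> f =
     integral\<^sup>L (pos_part_measure M \<nu>) f - integral\<^sup>L (pos_part_measure M (\<lambda>A. - \<nu> A)) f"

definition complex_measure_integral ::
    "'a measure \<Rightarrow> ('a set \<Rightarrow> complex) \<Rightarrow> ('a \<Rightarrow> complex) \<Rightarrow> complex" where
  "complex_measure_integral M \<mu> f =
     signed_integral M (\<lambda>A. Re (\<mu> A)) f + \<i> * signed_integral M (\<lambda>A. Im (\<mu> A)) f"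

definition singular_wrt :: "('a set \<Rightarrow> complex) \<Rightarrow> 'a measure \<Rightarrow> bool" where
  "singular_wrt \<sigma> M \<longleftrightarrow> (\<exists>N\<in>null_sets M. \<forall>A\<in>sets M. A \<inter> N = {} \<longrightarrow> \<sigma> A = 0)"

definition lebesgue_decomposition ::
    "'a measure \<Rightarrow> ('a set \<Rightarrow> complex) \<Rightarrow> ('a \<Rightarrow> complex) \<Rightarrow> ('a set \<Rightarrow> complex) \<Rightarrow> bool" where
  "lebesgue_decomposition M \<mu> f \<sigma> \<longleftrightarrow>
     integrable M f \<and> complex_measure M \<sigma> \<and> singular_wrt \<sigma> M \<and>
     (\<forall>A\<in>sets M. \<mu> A = (LINT x:A|M. f x) + \<sigma> A)"

definition poisson_const :: "complex \<Rightarrow> complex \<Rightarrow> complex" where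
  "poisson_const a b = Gamma (a + 1) * Gamma (b + 1) / Gamma (a + b + 1)"

definition poisson_kernel ::
    "complex ^ 'n \<Rightarrow> complex ^ 'n \<Rightarrow> complex ^ 'n \<Rightarrow> complex ^ 'n \<Rightarrow> complex" where
  "poisson_kernel \<alpha> \<beta> z \<zeta> =
     (\<Prod>j\<in>UNIV. poisson_const (\<alpha> $ j) (\<beta> $ j) *
        (complex_of_real (1 - (cmod (z $ j))\<^sup>2) powr (\<alpha> $ j + \<beta> $ j + 1) /
         ((1 - z $ j * cnj (\<zeta> $ j)) powr (\<alpha> $ j + 1) *
          (1 - cnj (z $ j) * \<zeta> $ j) powr (\<beta> $ j + 1))))"

definition poisson_integral ::
    "complex ^ 'n \<Rightarrow> complex ^ 'n \<Rightarrow> ((complex ^ 'n) set \<Rightarrow> complex) \<Rightarrow> complex ^ 'n \<Rightarrow> complex" where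
  "poisson_integral \<alpha> \<beta> \<mu> z =
     complex_measure_integral torus_borel \<mu> (\<lambda>\<zeta>. poisson_kernel \<alpha> \<beta> z \<zeta>)"

definition stolz :: "real \<Rightarrow> complex \<Rightarrow> complex set" where
  "stolz A \<eta> = {of_real r * cis (\<phi> - \<theta>) | r \<theta> \<phi>.
     \<eta> = cis \<phi> \<and> 0 \<le> r \<and> r < 1 \<and> \<bar>\<theta>\<bar> \<le> A * (1 - r)}"

definition restricted_stolz :: "real \<Rightarrow> real \<Rightarrow> complex ^ 'n \<Rightarrow> (complex ^ 'n) set" where
  "restricted_stolz A B \<eta> = {z. (\<forall>j. z $ j \<in> stolz A (\<eta> $ j)) \<and>
     (MAX (j, k)\<in>UNIV. (1 - cmod (z $ j)) / (1 - cmod (z $ k))) \<le> B}"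

text \<open>Since \<open>\<eta> \<notin> restricted_stolz A B \<eta>\<close>, the punctured filter \<open>at \<eta> within _\<close> excludes
  no point of the region.\<close>

definition RNT_lim :: "(complex ^ 'n \<Rightarrow> complex) \<Rightarrow> complex ^ 'n \<Rightarrow> complex \<Rightarrow> bool" where
  "RNT_lim u \<eta> l \<longleftrightarrow>
     (\<forall>A>0. \<forall>B\<ge>1. (u \<longlongrightarrow> l) (at \<eta> within restricted_stolz A B \<eta>))"

end

theory Submission imports Defs begin

text \<open>
  The kernel behaves like an approximate identity on the torus, but it need not be positive and its
  mass is only asymptotically \<open>1\<close>.  The mass is a product of radial functions of one variable
  (\<open>poisson_kernel_haar_integral\<close>).  By expanding both denominators into binomial series, each of them becomes
  \<open>(1 - x) powr w\<close> times a power series in \<open>x = |z|\<^sup>2\<close>, whose coefficients are asymptotic to those of a multiple of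
  \<open>(1 - x) powr (- w)\<close>, by Euler's formula for the Gamma function.  An Abelian argument (\<open>abel_limit\<close>) gives the
  limit, and the constant of the kernel normalizes it to \<open>1\<close> (\<open>kernel_mass_limit\<close>).

  It remains to show that \<open>\<integral> |P (z, \<zeta>)| d\<tau> (\<zeta>)\<close> tends to \<open>0\<close>, where \<open>\<tau>\<close> is the variation of \<open>\<mu> - f \<eta> dm\<close>, that is
  \<open>|f - f \<eta>| dm\<close> plus a singular measure.  For \<open>z\<close> in the restricted region at \<open>\<eta>\<close>, at distance about \<open>h\<close> from
  the circle in every coordinate, the modulus of the kernel is dominated by a sum over \<open>k\<close>, a vector of natural
  numbers, of \<open>2 powr (- t |k|)\<close> times the normalized indicator of the box around \<open>\<eta>\<close> with sides \<open>2 ^ k j * h\<close>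
  (\<open>poisson_kernel_dyadic_bound\<close>).  For fixed \<open>k\<close> these boxes are dilates of one shape and shrink
  to \<open>\<eta>\<close> as \<open>h\<close> tends to \<open>0\<close>.  So the one-parameter differentiation theory applies: the maximal function is of
  weak type (1,1) by Vitali's covering lemma (\<open>weak_type_bound\<close>), and for almost every \<open>\<eta>\<close> the mean values of \<open>\<tau>\<close>
  tend to \<open>0\<close> (\<open>density_zero_off_support\<close>, \<open>lebesgue_point_density\<close>).  The constants of the
  weak type bounds do not depend on the shape, hence almost every \<open>\<eta>\<close> has a bound for all maximal functions at
  once that grows slower than \<open>2 powr (t |k|)\<close> (\<open>maximal_bound_all_shapes\<close>).  The sum over \<open>k\<close> is therefore dominated,
  and it tends to \<open>0\<close> termwise (\<open>kernel_integral_tendsto_0\<close>).  The restriction of the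
  region is essential for this: without it the boxes would form an \<open>n\<close>-parameter family, for which
  differentiation fails for general measures.

  Finally, integration against a complex measure is defined through Jordan decompositions.  A Hahn
  decomposition makes these explicit, and the integral is linear in the measure
  (\<open>complex_measure_integral_lebesgue_decomposition\<close>).
\<close>

section \<open>Signed measures and integration against complex measures\<close>

lemma sets_pos_part_measure [simp]: "sets (pos_part_measure M \<nu>) = sets M"
  by (simp add: pos_part_measure_def)

lemma space_pos_part_measure [simp]: "space (pos_part_measure M \<nu>) = space M"
  by (simp add: pos_part_measure_def space_measure_of_conv)

locale finite_signed_measure =
  fixes M :: "'a measure" and \<nu> :: "'a set \<Rightarrow> real"
  assumes countable_additive:
    "\<And>A. range A \<subseteq> sets M \<Longrightarrow> disjoint_family A \<Longrightarrow> (\<lambda>i::nat. \<nu> (A i)) sums \<nu> (\<Union>i. A i)"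
begin

lemma signed_empty [simp]: "\<nu> {} = 0"
proof -
  have "(\<lambda>i::nat. \<nu> {}) sums \<nu> (\<Union>i::nat. {})"
    by (rule countable_additive) (auto simp: disjoint_family_on_def)
  then show ?thesis
    using sums_summable summable_const_iff by blast
qed

lemma signed_Un:
  assumes "A \<in> sets M" "B \<in> sets M" "A \<inter> B = {}"
  shows "\<nu> (A \<union> B) = \<nu> A + \<nu> B"
proof -
  have "(\<lambda>i. \<nu> (binaryset A B i)) sums \<nu> (\<Union>i. binaryset A B i)"
    using assms
    by (intro countable_additive) (auto simp: range_binaryset_eq disjoint_family_on_def binaryset_def)
  moreover have "(\<lambda>i. \<nu> (binaryset A B i)) sums (\<nu> A + \<nu> B)"
    by (rule binaryset_sums) simp
  ultimately show ?thesis
    by (simp add: UN_binaryset_eq sums_unique2)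
qed

lemma signed_split:
  assumes "A \<in> sets M" "P \<in> sets M"
  shows "\<nu> A = \<nu> (A \<inter> P) + \<nu> (A - P)"
  using signed_Un[of "A \<inter> P" "A - P"] assms by (simp add: Int_Diff_Un Int_Diff_disjoint)

definition positive_set :: "'a set \<Rightarrow> bool" where
  "positive_set P \<longleftrightarrow> P \<in> sets M \<and> (\<forall>B\<in>sets M. B \<subseteq> P \<longrightarrow> 0 \<le> \<nu> B)"

lemma positive_set_mono:
  assumes "positive_set P" "B \<in> sets M" "B \<subseteq> P"
  shows "\<nu> B \<le> \<nu> P"
proof -
  have "\<nu> P = \<nu> (P \<inter> B) + \<nu> (P - B)"
    using assms by (intro signed_split) (auto simp: positive_set_def)
  moreover have "P \<inter> B = B" "0 \<le> \<nu> (P - B)"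
    using assms by (auto simp: positive_set_def)
  ultimately show ?thesis by simp
qed

lemma positive_set_UN:
  assumes P: "\<And>i::nat. positive_set (P i)"
  shows "positive_set (\<Union>i. P i)"
  unfolding positive_set_def
proof (intro conjI ballI impI)
  have m: "range P \<subseteq> sets M" using P by (auto simp: positive_set_def)
  then show "(\<Union>i. P i) \<in> sets M" by auto
  fix B assume B: "B \<in> sets M" "B \<subseteq> (\<Union>i. P i)"
  let ?D = "\<lambda>i. B \<inter> disjointed P i"
  have D: "range (disjointed P) \<subseteq> sets M" using m by (rule sets.range_disjointed_sets)
  have "(\<lambda>i. \<nu> (?D i)) sums \<nu> (\<Union>i. ?D i)"
  proof (rule countable_additive)
    show "disjoint_family ?D"
      using disjoint_family_disjointed[of P] unfolding disjoint_family_on_def by blast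
  qed (use D B in auto)
  moreover have "(\<Union>i. ?D i) = B"
    using B UN_disjointed_eq[of P] by auto
  moreover have "0 \<le> \<nu> (?D i)" for i
  proof -
    have "?D i \<in> sets M" "?D i \<subseteq> P i" using D B disjointed_subset[of P i] by auto
    then show ?thesis using P[of i] unfolding positive_set_def by blast
  qed
  ultimately show "0 \<le> \<nu> B"
    using sums_le[OF _ sums_zero, of "\<lambda>i. \<nu> (?D i)"] by simp
qed

text \<open>Repeatedly removing a subset whose measure is at least half as negative as possible leaves a
  positive set: the removed sets are disjoint, so their measures are summable and tend to \<open>0\<close>.
  The alternative \<open>\<nu> B \<le> -1\<close> covers the case where the measures of subsets are not known to be
  bounded below; it can occur only finitely often.\<close>

lemma positive_subset_exists:
  assumes A: "A \<in> sets M"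
  shows "\<exists>P. positive_set P \<and> P \<subseteq> A \<and> \<nu> A \<le> \<nu> P"
proof -
  have "\<exists>B\<in>sets M. B \<subseteq> X \<and> \<nu> B \<le> 0 \<and>
          (\<nu> B \<le> -1 \<or> (\<forall>C\<in>sets M. C \<subseteq> X \<longrightarrow> 2 * \<nu> B \<le> \<nu> C))"
    if X: "X \<in> sets M" for X
  proof (cases "\<exists>C\<in>sets M. C \<subseteq> X \<and> \<nu> C \<le> -1")
    case True
    then obtain C where "C \<in> sets M" "C \<subseteq> X" "\<nu> C \<le> -1" by blast
    then show ?thesis by (intro bexI[of _ C]) auto
  next
    case False
    define S where "S = \<nu> ` {C \<in> sets M. C \<subseteq> X}"
    have bdd: "bdd_below S"
      using False by (intro bdd_belowI[of _ "-1"]) (force simp: S_def)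
    have "\<nu> {} \<in> S" unfolding S_def by (rule imageI) auto
    then have S0: "0 \<in> S" by simp
    have Inf_le: "Inf S \<le> \<nu> C" if "C \<in> sets M" "C \<subseteq> X" for C
      using that bdd by (intro cInf_lower) (auto simp: S_def)
    show ?thesis
    proof (cases "Inf S < 0")
      case True
      then have "Inf S < Inf S / 2" by simp
      then obtain s where "s \<in> S" "s < Inf S / 2"
        using S0 cInf_lessD[of S "Inf S / 2"] by blast
      then obtain B where B: "B \<in> sets M" "B \<subseteq> X" "\<nu> B < Inf S / 2"
        by (auto simp: S_def)
      show ?thesis
        using B True by (intro bexI[of _ B] conjI disjI2 ballI impI order_trans[OF _ Inf_le]) auto
    next
      case False
      then show ?thesis
        by (intro bexI[of _ "{}"] conjI disjI2 ballI impI order_trans[OF _ Inf_le]) auto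
    qed
  qed
  then obtain b where b: "\<And>X. X \<in> sets M \<Longrightarrow> b X \<in> sets M" "\<And>X. X \<in> sets M \<Longrightarrow> b X \<subseteq> X"
    "\<And>X. X \<in> sets M \<Longrightarrow> \<nu> (b X) \<le> 0"
    "\<And>X C. X \<in> sets M \<Longrightarrow> \<nu> (b X) > -1 \<Longrightarrow> C \<in> sets M \<Longrightarrow> C \<subseteq> X \<Longrightarrow> 2 * \<nu> (b X) \<le> \<nu> C"
    by (metis linorder_not_less)
  define X where "X = rec_nat A (\<lambda>_ Y. Y - b Y)"
  have X0: "X 0 = A" and XS: "X (Suc n) = X n - b (X n)" for n by (simp_all add: X_def)
  have Xm: "X n \<in> sets M" for n by (induction n) (auto simp: X0 XS A b)
  have dec: "X n \<subseteq> X m" if "m \<le> n" for m n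
    using that by (induction n rule: dec_induct) (auto simp: XS)
  have disj: "b (X m) \<inter> b (X n) = {}" if "m < n" for m n
    using dec[of "Suc m" n] that b(2)[OF Xm, of n] by (auto simp: XS)
  have sm: "(\<lambda>n. \<nu> (b (X n))) sums \<nu> (\<Union>n. b (X n))"
  proof (rule countable_additive)
    show "disjoint_family (\<lambda>n. b (X n))"
      unfolding disjoint_family_on_def
    proof (intro ballI impI)
      fix m n :: nat assume "m \<noteq> n"
      then consider "m < n" | "n < m" by linarith
      then show "b (X m) \<inter> b (X n) = {}"
        using disj[of m n] disj[of n m] by cases blast+
    qed
  qed (use b Xm in auto)
  define P where "P = A - (\<Union>n. b (X n))"
  have PX: "P \<subseteq> X n" for n by (induction n) (auto simp: X0 XS P_def)
  have UM: "(\<Union>n. b (X n)) \<in> sets M" using b(1) Xm by blast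
  then have PM: "P \<in> sets M" using A by (simp add: P_def)
  have "(\<Union>n. b (X n)) \<subseteq> A" using b(2)[OF Xm] dec[of 0] X0 by fastforce
  then have "\<nu> A = \<nu> (\<Union>n. b (X n)) + \<nu> P"
    using signed_split[OF A UM] by (simp add: P_def Int_absorb1)
  moreover have "\<nu> (\<Union>n. b (X n)) \<le> 0"
    using sums_le[OF _ sm sums_zero] b(3) Xm by auto
  moreover have "0 \<le> \<nu> C" if C: "C \<in> sets M" "C \<subseteq> P" for C
  proof -
    have lim: "(\<lambda>n. \<nu> (b (X n))) \<longlonglongrightarrow> 0"
      using sm by (intro summable_LIMSEQ_zero) (rule sums_summable)
    then have "eventually (\<lambda>n. \<nu> (b (X n)) > -1) sequentially"
      by (rule order_tendstoD) simp
    then have "eventually (\<lambda>n. 2 * \<nu> (b (X n)) \<le> \<nu> C) sequentially"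
      by eventually_elim (use b(4) Xm C PX in blast)
    moreover have "(\<lambda>n. 2 * \<nu> (b (X n))) \<longlonglongrightarrow> 2 * 0"
      by (intro tendsto_intros lim)
    ultimately show ?thesis
      by (metis mult_zero_right tendsto_upperbound trivial_limit_sequentially)
  qed
  ultimately show ?thesis
    using PM by (intro exI[of _ P]) (auto simp: positive_set_def P_def)
qed

definition hahn_set :: "'a set \<Rightarrow> bool" where
  "hahn_set P \<longleftrightarrow> positive_set P \<and> (\<forall>B\<in>sets M. B \<inter> P = {} \<longrightarrow> \<nu> B \<le> 0)"

text \<open>A positive set of maximal measure is a Hahn set: a set of positive measure outside it would
  contain a positive set that could be added.  The supremum is attained by a countable union, which
  also shows that it is finite.\<close>

lemma hahn_set_exists: "\<exists>P. hahn_set P"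
proof -
  define S where "S = \<nu> ` Collect positive_set"
  have "positive_set {}" by (auto simp: positive_set_def)
  then have ne: "S \<noteq> {}" by (auto simp: S_def)
  have bdd: "bdd_above S"
  proof (rule ccontr)
    assume "\<not> bdd_above S"
    then have "\<exists>P. positive_set P \<and> real n < \<nu> P" for n
      unfolding S_def bdd_above_def by (force simp: not_le)
    then obtain P where P: "\<And>n. positive_set (P n)" "\<And>n. real n < \<nu> (P n)" by metis
    have "\<nu> (P n) \<le> \<nu> (\<Union>i. P i)" for n
      using P(1)[of n] positive_set_mono[OF positive_set_UN, of P] P(1) by (auto simp: positive_set_def)
    then have "real n < \<nu> (\<Union>i. P i)" for n
      using P(2)[of n] by (meson less_le_trans)
    then show False
      by (meson less_asym reals_Archimedean2)
  qed
  have "\<exists>P. positive_set P \<and> Sup S - 1 / real (Suc n) < \<nu> P" for n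
  proof -
    have "Sup S - 1 / real (Suc n) < Sup S" by simp
    then show ?thesis
      using less_cSup_iff[OF ne bdd] unfolding S_def by (metis (no_types, lifting) image_iff mem_Collect_eq)
  qed
  then obtain P where P: "\<And>n. positive_set (P n)"
    "\<And>n. Sup S - 1 / real (Suc n) < \<nu> (P n)" by metis
  define Q where "Q = (\<Union>i. P i)"
  have Q: "positive_set Q" unfolding Q_def by (rule positive_set_UN) (rule P)
  have "\<nu> (P n) \<le> \<nu> Q" for n
    using P(1)[of n] by (intro positive_set_mono[OF Q]) (auto simp: Q_def positive_set_def)
  then have gt: "Sup S - 1 / real (Suc n) \<le> \<nu> Q" for n
    using P(2)[of n] by (meson less_imp_le order_trans)
  have "Sup S \<le> \<nu> Q"
  proof (rule field_le_epsilon)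
    fix e :: real assume "0 < e"
    then obtain n where "1 / real (Suc n) < e"
      using reals_Archimedean[of e] by (auto simp: inverse_eq_divide)
    then show "Sup S \<le> \<nu> Q + e" using gt[of n] by simp
  qed
  moreover have "\<nu> R \<le> Sup S" if "positive_set R" for R
    using that bdd by (intro cSup_upper) (auto simp: S_def)
  ultimately have max: "\<nu> R \<le> \<nu> Q" if "positive_set R" for R
    using that by (meson order_trans)
  have "\<nu> B \<le> 0" if B: "B \<in> sets M" "B \<inter> Q = {}" for B
  proof -
    obtain R where R: "positive_set R" "R \<subseteq> B" "\<nu> B \<le> \<nu> R"
      using positive_subset_exists[OF B(1)] by blast
    have "positive_set (\<Union>n. (if n = (0::nat) then Q else R))"
      using Q R(1) by (intro positive_set_UN) auto
    moreover have "(\<Union>n. (if n = (0::nat) then Q else R)) = Q \<union> R" by (auto split: if_splits)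
    ultimately have "\<nu> (Q \<union> R) \<le> \<nu> Q" using max by metis
    moreover have "\<nu> (Q \<union> R) = \<nu> Q + \<nu> R"
      using Q R B by (intro signed_Un) (auto simp: positive_set_def)
    ultimately show ?thesis using R(3) by simp
  qed
  then show ?thesis using Q by (auto simp: hahn_set_def)
qed

text \<open>This makes the supremum in the definition of the positive part explicit, and with it countable
  additivity and finiteness become evident.\<close>

lemma emeasure_pos_part_hahn:
  assumes P: "hahn_set P"
  shows "A \<in> sets M \<Longrightarrow> emeasure (pos_part_measure M \<nu>) A = ennreal (\<nu> (A \<inter> P))"
proof -
  have PM: "P \<in> sets M" and pos: "\<And>B. B \<in> sets M \<Longrightarrow> B \<subseteq> P \<Longrightarrow> 0 \<le> \<nu> B"
    and neg: "\<And>B. B \<in> sets M \<Longrightarrow> B \<inter> P = {} \<Longrightarrow> \<nu> B \<le> 0"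
    using P by (auto simp: hahn_set_def positive_set_def)
  have sup: "(SUP B\<in>{B \<in> sets M. B \<subseteq> A}. ennreal (\<nu> B)) = ennreal (\<nu> (A \<inter> P))"
    if A: "A \<in> sets M" for A
  proof (rule antisym)
    show "(SUP B\<in>{B \<in> sets M. B \<subseteq> A}. ennreal (\<nu> B)) \<le> ennreal (\<nu> (A \<inter> P))"
    proof (intro SUP_least ennreal_leI)
      fix B assume B: "B \<in> {B \<in> sets M. B \<subseteq> A}"
      have "\<nu> B = \<nu> (B \<inter> P) + \<nu> (B - P)" using B PM by (intro signed_split) auto
      moreover have "\<nu> (B - P) \<le> 0" using B PM by (intro neg) auto
      moreover have "\<nu> (A \<inter> P) = \<nu> (A \<inter> P \<inter> B) + \<nu> (A \<inter> P - B)"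
        using A B PM by (intro signed_split) auto
      moreover have "0 \<le> \<nu> (A \<inter> P - B)" using A B PM by (intro pos) auto
      moreover have "A \<inter> P \<inter> B = B \<inter> P" using B by auto
      ultimately show "\<nu> B \<le> \<nu> (A \<inter> P)" by simp
    qed
    show "ennreal (\<nu> (A \<inter> P)) \<le> (SUP B\<in>{B \<in> sets M. B \<subseteq> A}. ennreal (\<nu> B))"
      using A PM by (intro SUP_upper) auto
  qed
  have eq: "pos_part_measure M \<nu> = measure_of (space M) (sets M) (\<lambda>A. ennreal (\<nu> (A \<inter> P)))"
    unfolding pos_part_measure_def
    by (rule measure_of_eq[OF sets.space_closed]) (simp add: sup sets.sigma_sets_eq)
  show "emeasure (pos_part_measure M \<nu>) A = ennreal (\<nu> (A \<inter> P))" if "A \<in> sets M"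
  proof (rule emeasure_measure_of[OF eq sets.space_closed])
    show "A \<in> sets (pos_part_measure M \<nu>)"
      using that by simp
    show "positive (sets (pos_part_measure M \<nu>)) (\<lambda>A. ennreal (\<nu> (A \<inter> P)))"
      by (simp add: positive_def)
    show "countably_additive (sets (pos_part_measure M \<nu>)) (\<lambda>A. ennreal (\<nu> (A \<inter> P)))"
    proof (rule countably_additiveI)
      fix F :: "nat \<Rightarrow> 'a set"
      assume "range F \<subseteq> sets (pos_part_measure M \<nu>)" and d: "disjoint_family F"
      then have F: "range F \<subseteq> sets M" by simp
      have s: "(\<lambda>i. \<nu> (F i \<inter> P)) sums \<nu> (\<Union>i. F i \<inter> P)"
        using F d PM by (intro countable_additive) (auto simp: disjoint_family_on_def)
      have nn: "0 \<le> \<nu> (F i \<inter> P)" for i using F PM by (intro pos) auto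
      show "(\<Sum>i. ennreal (\<nu> (F i \<inter> P))) = ennreal (\<nu> (\<Union> (range F) \<inter> P))"
        using suminf_ennreal2[OF nn sums_summable[OF s]] sums_unique[OF s] by simp
    qed
  qed
qed

lemma finite_measure_pos_part: "finite_measure (pos_part_measure M \<nu>)"
proof -
  obtain P where "hahn_set P" using hahn_set_exists by blast
  from emeasure_pos_part_hahn[OF this sets.top] show ?thesis
    by (intro finite_measureI) simp
qed

lemma uminus_signed: "finite_signed_measure M (\<lambda>A. - \<nu> A)"
  by unfold_locales (intro sums_minus countable_additive)

lemma jordan_decomposition:
  assumes A: "A \<in> sets M"
  shows "\<nu> A = measure (pos_part_measure M \<nu>) A - measure (pos_part_measure M (\<lambda>A. - \<nu> A)) A"
proof -
  interpret m: finite_signed_measure M "\<lambda>A. - \<nu> A" by (rule uminus_signed)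
  obtain P where P: "hahn_set P" using hahn_set_exists by blast
  then have PM: "P \<in> sets M" and pos: "\<And>B. B \<in> sets M \<Longrightarrow> B \<subseteq> P \<Longrightarrow> 0 \<le> \<nu> B"
    and neg: "\<And>B. B \<in> sets M \<Longrightarrow> B \<inter> P = {} \<Longrightarrow> \<nu> B \<le> 0"
    by (auto simp: hahn_set_def positive_set_def)
  have "m.hahn_set (space M - P)"
    unfolding m.hahn_set_def m.positive_set_def
  proof (intro conjI ballI impI)
    fix B assume "B \<in> sets M" "B \<inter> (space M - P) = {}"
    then show "- \<nu> B \<le> 0" using pos[of B] sets.sets_into_space[of B M] by auto
  next
    fix B assume "B \<in> sets M" "B \<subseteq> space M - P"
    then show "0 \<le> - \<nu> B" using neg[of B] by auto
  qed (use PM in auto)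
  from m.emeasure_pos_part_hahn[OF this A]
  have "emeasure (pos_part_measure M (\<lambda>A. - \<nu> A)) A = ennreal (- \<nu> (A \<inter> (space M - P)))" .
  moreover have "A \<inter> (space M - P) = A - P" using sets.sets_into_space[OF A] by auto
  moreover have "\<nu> A = \<nu> (A \<inter> P) + \<nu> (A - P)" using A PM by (rule signed_split)
  moreover have "0 \<le> \<nu> (A \<inter> P)" "\<nu> (A - P) \<le> 0" using A PM by (auto intro!: pos neg)
  ultimately show ?thesis
    using emeasure_pos_part_hahn[OF P A] by (simp add: measure_def)
qed

lemma pos_part_measure_null:
  assumes "\<And>B. B \<in> sets M \<Longrightarrow> B \<subseteq> A \<Longrightarrow> \<nu> B = 0" "A \<in> sets M"
  shows "emeasure (pos_part_measure M \<nu>) A = 0"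
proof -
  obtain P where P: "hahn_set P" using hahn_set_exists by blast
  then show ?thesis
    using emeasure_pos_part_hahn[OF P assms(2)] assms
    by (auto simp: hahn_set_def positive_set_def)
qed

end

text \<open>Numbering the positive and negative parts of the real and the imaginary part turns the integral
  against a complex measure into one finite sum.\<close>

definition jordan_part :: "'a measure \<Rightarrow> ('a set \<Rightarrow> complex) \<Rightarrow> nat \<Rightarrow> 'a measure" where
  "jordan_part M \<mu> i = pos_part_measure M
     (if i = 0 then (\<lambda>A. Re (\<mu> A)) else if i = 1 then (\<lambda>A. - Re (\<mu> A))
      else if i = 2 then (\<lambda>A. Im (\<mu> A)) else (\<lambda>A. - Im (\<mu> A)))"

definition jordan_coeff :: "nat \<Rightarrow> complex" where
  "jordan_coeff i = (if i = 0 then 1 else if i = 1 then -1 else if i = 2 then \<i> else -\<i>)"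

lemma sets_jordan_part [simp]: "sets (jordan_part M \<mu> i) = sets M"
  by (simp add: jordan_part_def)

lemma space_jordan_part [simp]: "space (jordan_part M \<mu> i) = space M"
  by (simp add: jordan_part_def)

lemma signed_jordan_part:
  assumes "complex_measure M \<mu>"
  shows "finite_signed_measure M
     (if i = (0::nat) then (\<lambda>A. Re (\<mu> A)) else if i = 1 then (\<lambda>A. - Re (\<mu> A))
      else if i = 2 then (\<lambda>A. Im (\<mu> A)) else (\<lambda>A. - Im (\<mu> A)))"
proof -
  have "finite_signed_measure M (\<lambda>A. Re (\<mu> A))" "finite_signed_measure M (\<lambda>A. Im (\<mu> A))"
    using assms by (unfold_locales; auto simp: complex_measure_def intro!: sums_Re sums_Im)+
  then show ?thesis
    using finite_signed_measure.uminus_signed by auto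
qed

lemma finite_measure_jordan_part:
  "complex_measure M \<mu> \<Longrightarrow> finite_measure (jordan_part M \<mu> i)"
  unfolding jordan_part_def
  by (rule finite_signed_measure.finite_measure_pos_part) (rule signed_jordan_part)

lemma sum_lessThan_4: "(\<Sum>i<4. g i) = g 0 + g 1 + g 2 + g (3::nat)" for g :: "nat \<Rightarrow> complex"
  by (simp add: eval_nat_numeral)

lemma complex_measure_jordan:
  assumes "complex_measure M \<mu>" "A \<in> sets M"
  shows "\<mu> A = (\<Sum>i<4. jordan_coeff i * of_real (measure (jordan_part M \<mu> i) A))"
  using finite_signed_measure.jordan_decomposition[OF signed_jordan_part[OF assms(1), of 0] assms(2)]
    finite_signed_measure.jordan_decomposition[OF signed_jordan_part[OF assms(1), of 2] assms(2)]
  by (auto simp: sum_lessThan_4 jordan_coeff_def jordan_part_def complex_eq_iff)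

lemma complex_measure_integral_jordan:
  "complex_measure_integral M \<mu> g = (\<Sum>i<4. jordan_coeff i * integral\<^sup>L (jordan_part M \<mu> i) g)"
  by (simp add: complex_measure_integral_def signed_integral_def sum_lessThan_4 jordan_coeff_def
      jordan_part_def algebra_simps)

lemma jordan_part_null:
  assumes "complex_measure M \<mu>" "A \<in> sets M" "\<And>B. B \<in> sets M \<Longrightarrow> B \<subseteq> A \<Longrightarrow> \<mu> B = 0"
  shows "emeasure (jordan_part M \<mu> i) A = 0"
  unfolding jordan_part_def
  by (rule finite_signed_measure.pos_part_measure_null[OF signed_jordan_part[OF assms(1)]])
    (auto simp: assms)

text \<open>A linear combination of finite measures and a density that vanishes on all sets vanishes on
  all bounded measurable functions.  This makes the integral against a complex measure linear in the
  measure, although it is defined through the nonlinear Jordan decomposition.\<close>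

lemma measure_combination_integral_real:
  fixes N :: "'i \<Rightarrow> 'a measure" and c :: "'i \<Rightarrow> complex" and f :: "'a \<Rightarrow> complex"
  assumes fin: "\<And>i. i \<in> I \<Longrightarrow> finite_measure (N i)" and sets: "\<And>i. i \<in> I \<Longrightarrow> sets (N i) = sets M"
    and f: "integrable M f"
    and eq: "\<And>A. A \<in> sets M \<Longrightarrow> (\<Sum>i\<in>I. c i * of_real (measure (N i) A)) = (LINT x:A|M. f x)"
    and u: "u \<in> borel_measurable M" "\<And>x. 0 \<le> u x" "\<And>x. x \<in> space M \<Longrightarrow> u x \<le> (B::real)"
  shows "(\<Sum>i\<in>I. c i * of_real (integral\<^sup>L (N i) u)) = (LINT x|M. of_real (u x) * f x)"
proof -
  note fm [measurable] = borel_measurable_integrable[OF f]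
  have sp: "i \<in> I \<Longrightarrow> space (N i) = space M" for i using sets sets_eq_imp_space_eq by blast
  have meas: "v \<in> borel_measurable (N i)" if "i \<in> I" "v \<in> borel_measurable M" for i and v :: "'a \<Rightarrow> real"
    using that sets measurable_cong_sets[of "N i" M borel borel] by blast
  have int: "integrable (N i) v" if "i \<in> I" "v \<in> borel_measurable M" "\<And>x. 0 \<le> v x"
    "\<And>x. x \<in> space M \<Longrightarrow> v x \<le> B" for v :: "'a \<Rightarrow> real" and i B
    using that fin sp by (intro finite_measure.integrable_const_bound[where B=B] meas) auto
  have bd: "norm (of_real (v x) * f x) \<le> B * norm (f x)"
    if "x \<in> space M" "0 \<le> v x" "v x \<le> B" for v :: "'a \<Rightarrow> real" and x B
    using that by (auto simp: norm_mult intro!: mult_right_mono)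
  have intM: "integrable M (\<lambda>x. of_real (v x) * f x)" if "v \<in> borel_measurable M" "\<And>x. 0 \<le> v x"
    "\<And>x. x \<in> space M \<Longrightarrow> v x \<le> B" for v :: "'a \<Rightarrow> real" and B
  proof (rule Bochner_Integration.integrable_bound[OF integrable_mult_right[OF integrable_norm[OF f], of B]])
    show "AE x in M. norm (of_real (v x) * f x) \<le> norm (B * norm (f x))"
      using that bd[of _ v B] by (intro AE_I2) (auto intro: order_trans[OF _ abs_ge_self])
  qed (use that in measurable)
  have "\<forall>B. (\<forall>x\<in>space M. u x \<le> B) \<longrightarrow>
    (\<Sum>i\<in>I. c i * of_real (integral\<^sup>L (N i) u)) = (LINT x|M. of_real (u x) * f x)"
    using u(1,2)
  proof (induction u rule: borel_measurable_induct_real)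
    case (set A)
    have "integral\<^sup>L (N i) (indicator A) = measure (N i) A" if "i \<in> I" for i
      using set sets[OF that] sp[OF that] sets.sets_into_space[OF set] by (simp add: Int_absorb2)
    then have "(\<Sum>i\<in>I. c i * of_real (integral\<^sup>L (N i) (indicator A)))
        = (\<Sum>i\<in>I. c i * of_real (measure (N i) A))" by simp
    also have "\<dots> = (LINT x:A|M. f x)" by (rule eq[OF set])
    also have "\<dots> = (LINT x|M. of_real (indicator A x) * f x)"
      by (simp add: set_lebesgue_integral_def scaleR_conv_of_real)
    finally show ?case by simp
  next
    case (mult u c')
    show ?case
    proof (intro allI impI)
      fix B assume b: "\<forall>x\<in>space M. c' * u x \<le> B"
      show "(\<Sum>i\<in>I. c i * of_real (\<integral>x. c' * u x \<partial>N i)) = (LINT x|M. of_real (c' * u x) * f x)"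
      proof (cases "c' = 0")
        case False
        then have "\<forall>x\<in>space M. u x \<le> B / c'"
          using b mult(1) by (auto simp: field_simps)
        then have "(\<Sum>i\<in>I. c i * of_real (integral\<^sup>L (N i) u)) = (LINT x|M. of_real (u x) * f x)"
          using mult by blast
        then have "of_real c' * (\<Sum>i\<in>I. c i * of_real (integral\<^sup>L (N i) u))
            = of_real c' * (LINT x|M. of_real (u x) * f x)" by simp
        then show ?thesis by (simp add: sum_distrib_left ac_simps)
      qed simp
    qed
  next
    case (add u v)
    show ?case
    proof (intro allI impI)
      fix B assume b: "\<forall>x\<in>space M. v x + u x \<le> B"
      have u0: "0 \<le> u x" and v0: "0 \<le> v x" for x using add by blast+
      have u: "\<forall>x\<in>space M. u x \<le> B" and v: "\<forall>x\<in>space M. v x \<le> B"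
        using b u0 v0 by (meson add_increasing add_increasing2 order_refl order_trans)+
      have i: "integral\<^sup>L (N i) (\<lambda>x. v x + u x) = integral\<^sup>L (N i) v + integral\<^sup>L (N i) u" if "i \<in> I" for i
        using that u v add by (intro Bochner_Integration.integral_add int[where B=B]) auto
      have "(LINT x|M. of_real (v x + u x) * f x)
          = (LINT x|M. of_real (v x) * f x) + (LINT x|M. of_real (u x) * f x)"
        unfolding of_real_add distrib_right
        using u v add by (intro Bochner_Integration.integral_add intM[where B=B]) auto
      moreover have "(\<Sum>i\<in>I. c i * of_real (integral\<^sup>L (N i) u)) = (LINT x|M. of_real (u x) * f x)"
        "(\<Sum>i\<in>I. c i * of_real (integral\<^sup>L (N i) v)) = (LINT x|M. of_real (v x) * f x)"
        using add u v by blast+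
      ultimately show "(\<Sum>i\<in>I. c i * of_real (\<integral>x. v x + u x \<partial>N i)) = (LINT x|M. of_real (v x + u x) * f x)"
        using i by (simp add: distrib_left sum.distrib)
    qed
  next
    case (seq U)
    have Um: "\<And>n. U n \<in> borel_measurable M" and U0: "\<And>n x. 0 \<le> U n x"
      and inc: "incseq U" and lim: "\<And>x. x \<in> space M \<Longrightarrow> (\<lambda>n. U n x) \<longlonglongrightarrow> u x"
      by (fact seq.hyps)+
    show ?case
    proof (intro allI impI)
      fix B assume b: "\<forall>x\<in>space M. u x \<le> B"
      have Ub: "U n x \<le> B" if "x \<in> space M" for n x
      proof -
        have "U n x \<le> u x"
          using inc by (intro incseq_le[OF _ lim[OF that]]) (auto simp: incseq_def le_fun_def)
        then show ?thesis using b that by (meson order_trans)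
      qed
      have lim1: "(\<lambda>n. \<Sum>i\<in>I. c i * of_real (integral\<^sup>L (N i) (U n)))
          \<longlonglongrightarrow> (\<Sum>i\<in>I. c i * of_real (integral\<^sup>L (N i) u))"
      proof (intro tendsto_intros)
        fix i assume i: "i \<in> I"
        interpret finite_measure "N i" by (rule fin[OF i])
        show "(\<lambda>n. integral\<^sup>L (N i) (U n)) \<longlonglongrightarrow> integral\<^sup>L (N i) u"
          using i Um U0 lim u(1) Ub sp[OF i]
          by (intro integral_dominated_convergence[where w="\<lambda>_. B"] meas) auto
      qed
      have lim2: "(\<lambda>n. LINT x|M. of_real (U n x) * f x) \<longlonglongrightarrow> (LINT x|M. of_real (u x) * f x)"
      proof (rule integral_dominated_convergence[where w="\<lambda>x. B * norm (f x)"])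
        show "integrable M (\<lambda>x. B * norm (f x))" using f by simp
        show "AE x in M. (\<lambda>n. of_real (U n x) * f x) \<longlonglongrightarrow> of_real (u x) * f x"
          using lim by (intro AE_I2 tendsto_intros) auto
        show "AE x in M. norm (of_real (U n x) * f x) \<le> B * norm (f x)" for n
          using U0 Ub by (intro AE_I2 bd) auto
      qed (use Um u(1) in measurable)
      have "(\<Sum>i\<in>I. c i * of_real (integral\<^sup>L (N i) (U n))) = (LINT x|M. of_real (U n x) * f x)" for n
        using seq.IH[of n] Ub by blast
      then show "(\<Sum>i\<in>I. c i * of_real (integral\<^sup>L (N i) u)) = (LINT x|M. of_real (u x) * f x)"
        using LIMSEQ_unique[OF lim1] lim2 by simp
    qed
  qed
  then show ?thesis using u(3) by auto
qed

lemma measure_combination_integral: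
  fixes N :: "'i \<Rightarrow> 'a measure" and c :: "'i \<Rightarrow> complex" and f g :: "'a \<Rightarrow> complex"
  assumes fin: "\<And>i. i \<in> I \<Longrightarrow> finite_measure (N i)" and sets: "\<And>i. i \<in> I \<Longrightarrow> sets (N i) = sets M"
    and f: "integrable M f"
    and eq: "\<And>A. A \<in> sets M \<Longrightarrow> (\<Sum>i\<in>I. c i * of_real (measure (N i) A)) = (LINT x:A|M. f x)"
    and g: "g \<in> borel_measurable M" "\<And>x. x \<in> space M \<Longrightarrow> cmod (g x) \<le> B"
  shows "(\<Sum>i\<in>I. c i * integral\<^sup>L (N i) g) = (LINT x|M. g x * f x)"
proof -
  note [measurable] = borel_measurable_integrable[OF f] g(1)
  have sp: "i \<in> I \<Longrightarrow> space (N i) = space M" for i using sets sets_eq_imp_space_eq by blast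
  have meas: "v \<in> borel_measurable (N i)" if "i \<in> I" "v \<in> borel_measurable M" for i and v :: "'a \<Rightarrow> real"
    using that sets measurable_cong_sets[of "N i" M borel borel] by blast
  define h :: "nat \<Rightarrow> 'a \<Rightarrow> real" where "h k x =
    (if k = 0 then max 0 (Re (g x)) else if k = 1 then max 0 (- Re (g x))
     else if k = 2 then max 0 (Im (g x)) else max 0 (- Im (g x)))" for k x
  have gh: "g x = (\<Sum>k<4. jordan_coeff k * of_real (h k x))" for x
    by (auto simp: sum_lessThan_4 jordan_coeff_def h_def complex_eq_iff max_def)
  have hm [measurable]: "h k \<in> borel_measurable M" for k
    unfolding h_def by measurable
  have h0: "0 \<le> h k x" for k x by (simp add: h_def)
  have hB: "h k x \<le> B" if "x \<in> space M" for k x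
    using g(2)[OF that] abs_Re_le_cmod[of "g x"] abs_Im_le_cmod[of "g x"] by (auto simp: h_def)
  have h_int: "(\<Sum>i\<in>I. c i * of_real (integral\<^sup>L (N i) (h k))) = (LINT x|M. of_real (h k x) * f x)" for k
    by (rule measure_combination_integral_real[OF fin sets f eq hm h0 hB])
  have i1: "integrable (N i) (h k)" if "i \<in> I" for i k
    using that fin hB h0 sp hm by (intro finite_measure.integrable_const_bound[where B=B] meas) auto
  have i2: "integrable M (\<lambda>x. of_real (h k x) * f x)" for k
  proof (rule Bochner_Integration.integrable_bound[OF integrable_mult_right[OF integrable_norm[OF f], of B]])
    show "AE x in M. norm (of_real (h k x) * f x) \<le> norm (B * norm (f x))"
      using h0 hB by (intro AE_I2)
        (auto simp: norm_mult intro!: mult_right_mono order_trans[OF _ abs_ge_self])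
  qed measurable
  have "integral\<^sup>L (N i) g = (\<Sum>k<4. jordan_coeff k * of_real (integral\<^sup>L (N i) (h k)))" if "i \<in> I" for i
    unfolding gh[abs_def] using i1[OF that] by (simp add: Bochner_Integration.integral_sum)
  then have "(\<Sum>i\<in>I. c i * integral\<^sup>L (N i) g)
      = (\<Sum>i\<in>I. \<Sum>k<4. jordan_coeff k * (c i * of_real (integral\<^sup>L (N i) (h k))))"
    by (simp add: sum_distrib_left ac_simps)
  also have "\<dots> = (\<Sum>k<4. jordan_coeff k * (\<Sum>i\<in>I. c i * of_real (integral\<^sup>L (N i) (h k))))"
    by (subst sum.swap) (simp add: sum_distrib_left)
  also have "\<dots> = (\<Sum>k<4. LINT x|M. jordan_coeff k * (of_real (h k x) * f x))"
    by (simp add: h_int)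
  also have "\<dots> = (LINT x|M. (\<Sum>k<4. jordan_coeff k * (of_real (h k x) * f x)))"
    using i2 by (subst Bochner_Integration.integral_sum) auto
  also have "\<dots> = (LINT x|M. g x * f x)"
    by (intro Bochner_Integration.integral_cong refl) (simp add: gh sum_distrib_right mult.assoc)
  finally show ?thesis .
qed

text \<open>The Jordan parts of \<open>\<mu>\<close> and of \<open>\<sigma>\<close> are unrelated, so the decomposition of \<open>\<mu>\<close> cannot be used part
  by part.  Its eight parts and the density form one combination that vanishes on all sets.\<close>

lemma complex_measure_integral_lebesgue_decomposition:
  assumes \<mu>: "complex_measure N \<mu>" and sets: "sets N = sets M"
    and ld: "lebesgue_decomposition M \<mu> f \<sigma>"
    and g: "g \<in> borel_measurable M" "\<And>x. x \<in> space M \<Longrightarrow> cmod (g x) \<le> B"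
  shows "complex_measure_integral N \<mu> g
    = (LINT x|M. g x * f x) + (\<Sum>i<4. jordan_coeff i * integral\<^sup>L (jordan_part M \<sigma> i) g)"
proof -
  have f: "integrable M f" and \<sigma>: "complex_measure M \<sigma>"
    and dec: "\<And>A. A \<in> sets M \<Longrightarrow> \<mu> A = (LINT x:A|M. f x) + \<sigma> A"
    using ld by (auto simp: lebesgue_decomposition_def)
  define c where "c = case_sum jordan_coeff (\<lambda>i. - jordan_coeff i)"
  define L where "L = case_sum (jordan_part N \<mu>) (jordan_part M \<sigma>)"
  let ?I = "{..<4::nat} <+> {..<4::nat}"
  have sum_I: "(\<Sum>i\<in>?I. c i * k i) = (\<Sum>i<4. jordan_coeff i * k (Inl i)) - (\<Sum>i<4. jordan_coeff i * k (Inr i))"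
    for k by (simp add: sum.Plus c_def sum_negf)
  have "(\<Sum>i\<in>?I. c i * integral\<^sup>L (L i) g) = (LINT x|M. g x * f x)"
  proof (rule measure_combination_integral[OF _ _ f _ g])
    show "finite_measure (L i)" for i
      using \<mu> \<sigma> by (cases i) (auto simp: L_def intro: finite_measure_jordan_part)
    show "sets (L i) = sets M" for i
      using sets by (cases i) (auto simp: L_def)
    fix A assume A: "A \<in> sets M"
    show "(\<Sum>i\<in>?I. c i * of_real (measure (L i) A)) = (LINT x:A|M. f x)"
      unfolding sum_I using complex_measure_jordan[OF \<mu>, of A] complex_measure_jordan[OF \<sigma> A] A sets dec[OF A]
      by (simp add: L_def) (metis add_diff_cancel_right')
  qed
  then show ?thesis
    by (simp add: sum_I L_def complex_measure_integral_jordan algebra_simps)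
qed

section \<open>Differentiation of measures along the images of balls\<close>

lemma emeasure_UN_le_count_space:
  assumes "countable I" "\<And>i. i \<in> I \<Longrightarrow> X i \<in> sets M"
  shows "emeasure M (\<Union>i\<in>I. X i) \<le> (\<integral>\<^sup>+i. emeasure M (X i) \<partial>count_space I)"
proof -
  have "emeasure M (\<Union>i\<in>I. X i) = (\<integral>\<^sup>+x. indicator (\<Union>i\<in>I. X i) x \<partial>M)"
    using assms by (intro nn_integral_indicator[symmetric] sets.countable_UN') auto
  also have "\<dots> \<le> (\<integral>\<^sup>+x. \<integral>\<^sup>+i. indicator (X i) x \<partial>count_space I \<partial>M)"
  proof (intro nn_integral_mono)
    fix x
    show "indicator (\<Union>i\<in>I. X i) x \<le> (\<integral>\<^sup>+i. indicator (X i) x \<partial>count_space I :: ennreal)"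
    proof (cases "x \<in> (\<Union>i\<in>I. X i)")
      case True
      then obtain i where "i \<in> I" "x \<in> X i" by blast
      then show ?thesis
        using nn_integral_ge_point[of i I "\<lambda>i. indicator (X i) x"] True by simp
    qed simp
  qed
  also have "\<dots> = (\<integral>\<^sup>+i. \<integral>\<^sup>+x. indicator (X i) x \<partial>M \<partial>count_space I)"
    using assms by (intro nn_integral_count_space_nn_integral) auto
  also have "\<dots> = (\<integral>\<^sup>+i. emeasure M (X i) \<partial>count_space I)"
    using assms by (intro nn_integral_cong) auto
  finally show ?thesis .
qed

definition phi_ball :: "('a \<Rightarrow> 'b::metric_space) \<Rightarrow> 'a \<Rightarrow> real \<Rightarrow> 'a set" where
  "phi_ball \<phi> x h = \<phi> -` cball (\<phi> x) h"

lemma phi_ball_mono: "h \<le> h' \<Longrightarrow> phi_ball \<phi> x h \<subseteq> phi_ball \<phi> x h'"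
  by (auto simp: phi_ball_def)

lemma sets_phi_ball [measurable]:
  fixes \<phi> :: "'a::topological_space \<Rightarrow> 'b::metric_space"
  assumes "continuous_on UNIV \<phi>"
  shows "phi_ball \<phi> x h \<in> sets borel"
  unfolding phi_ball_def
  by (intro borel_closed closed_vimage assms closed_cball)

text \<open>The set where the maximal function \<open>sup\<^sub>h \<nu> (B (x, h)) / V h\<close> exceeds \<open>\<kappa>\<close>; written without the supremum
  it is visibly open and infinite values cause no trouble.\<close>

definition maximal_exceeds ::
    "('a::topological_space \<Rightarrow> 'b::metric_space) \<Rightarrow> (real \<Rightarrow> real) \<Rightarrow> 'a measure \<Rightarrow> real \<Rightarrow> 'a set" where
  "maximal_exceeds \<phi> V \<nu> \<kappa> = {x. \<exists>h>0. measure \<nu> (phi_ball \<phi> x h) > \<kappa> * V h}"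

text \<open>The map \<open>\<phi>\<close> distorts the balls, \<open>m\<close> is the reference measure, and \<open>V h\<close> plays the volume of the distorted
  ball of radius \<open>h\<close>.  The constant \<open>C\<close> is kept explicit because it must not depend on the shape of the
  balls when many shapes are treated at once.  The factor \<open>5\<close> is that of Vitali's covering lemma.\<close>

locale ball_differentiation =
  fixes \<phi> :: "'a::{second_countable_topology, complete_space} \<Rightarrow> 'b::euclidean_space"
    and V :: "real \<Rightarrow> real" and m :: "'a measure" and C :: real
  assumes continuous_phi: "continuous_on UNIV \<phi>" and inj_phi: "inj \<phi>"
    and finite_m: "finite_measure m" and sets_m [simp]: "sets m = sets borel"
    and V_pos: "\<And>h. h > 0 \<Longrightarrow> V h > 0" and V_cont: "continuous_on {0<..} V"
    and V_top: "filterlim V at_top at_top"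
    and C_pos: "0 < C"
    and volume_bound: "\<And>x h. h > 0 \<Longrightarrow> measure m (phi_ball \<phi> x (5 * h)) \<le> C * V h"
begin

interpretation m: finite_measure m by (rule finite_m)

lemma sets_phi_ball' [simp]: "phi_ball \<phi> x h \<in> sets borel"
  by (rule sets_phi_ball[OF continuous_phi])

lemma space_m [simp]: "space m = UNIV"
  using sets_eq_imp_space_eq[OF sets_m] by simp

text \<open>A point of the set keeps its ball after a slight move and a slight enlargement of the radius.\<close>

lemma open_maximal_exceeds:
  assumes "finite_measure \<nu>" "sets \<nu> = sets borel"
  shows "open (maximal_exceeds \<phi> V \<nu> \<kappa>)"
proof (subst open_subopen, intro ballI)
  interpret finite_measure \<nu> by fact
  fix x assume "x \<in> maximal_exceeds \<phi> V \<nu> \<kappa>"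
  then obtain h where h: "h > 0" "measure \<nu> (phi_ball \<phi> x h) > \<kappa> * V h"
    by (auto simp: maximal_exceeds_def)
  have "((\<lambda>t. \<kappa> * V t) \<longlongrightarrow> \<kappa> * V h) (at h)"
    using V_cont h(1) by (intro tendsto_intros) (auto simp: continuous_on_eq_continuous_at isCont_def)
  then have "eventually (\<lambda>t. \<kappa> * V t < measure \<nu> (phi_ball \<phi> x h)) (at h)"
    using h(2) by (rule order_tendstoD)
  then have "eventually (\<lambda>t. \<kappa> * V t < measure \<nu> (phi_ball \<phi> x h)) (at_right h)"
    by (auto simp: eventually_at_split)
  then obtain b where b: "b > h" "\<And>t. h < t \<Longrightarrow> t < b \<Longrightarrow> \<kappa> * V t < measure \<nu> (phi_ball \<phi> x h)"
    by (auto simp: eventually_at_right_field)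
  define t where "t = (h + b) / 2"
  have t: "h < t" "t < b" using b(1) by (auto simp: t_def)
  let ?T = "\<phi> -` ball (\<phi> x) (t - h)"
  have "open ?T" using continuous_phi by (intro open_vimage) auto
  moreover have "x \<in> ?T" using t by simp
  moreover have "?T \<subseteq> maximal_exceeds \<phi> V \<nu> \<kappa>"
  proof
    fix y assume y: "y \<in> ?T"
    have "phi_ball \<phi> x h \<subseteq> phi_ball \<phi> y t"
    proof
      fix w assume "w \<in> phi_ball \<phi> x h"
      then have "dist (\<phi> x) (\<phi> w) \<le> h" "dist (\<phi> x) (\<phi> y) < t - h"
        using y by (auto simp: phi_ball_def)
      then show "w \<in> phi_ball \<phi> y t"
        using dist_triangle[of "\<phi> y" "\<phi> w" "\<phi> x"] by (auto simp: phi_ball_def dist_commute)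
    qed
    then have "measure \<nu> (phi_ball \<phi> x h) \<le> measure \<nu> (phi_ball \<phi> y t)"
      using assms by (intro finite_measure_mono) auto
    then show "y \<in> maximal_exceeds \<phi> V \<nu> \<kappa>"
      using b(2)[OF t] t(1) h(1) by (auto simp: maximal_exceeds_def intro!: exI[of _ t])
  qed
  ultimately show "\<exists>T. open T \<and> x \<in> T \<and> T \<subseteq> maximal_exceeds \<phi> V \<nu> \<kappa>" by blast
qed

text \<open>The maximal function is of weak type (1,1): a Vitali subfamily of the balls on which
  \<open>\<nu>\<close> is large is disjoint, and its fivefold enlargements still cover.\<close>

lemma weak_type_bound:
  assumes \<nu>: "finite_measure \<nu>" "sets \<nu> = sets borel" and lam: "\<kappa> > 0"
  shows "emeasure m (maximal_exceeds \<phi> V \<nu> \<kappa>) \<le> ennreal (C * measure \<nu> UNIV / \<kappa>)"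
proof -
  interpret n: finite_measure \<nu> by fact
  have spn: "space \<nu> = UNIV" using sets_eq_imp_space_eq[OF \<nu>(2)] by simp
  let ?K = "maximal_exceeds \<phi> V \<nu> \<kappa>"
  have "\<forall>x\<in>?K. \<exists>h. h > 0 \<and> measure \<nu> (phi_ball \<phi> x h) > \<kappa> * V h"
    by (auto simp: maximal_exceeds_def)
  from bchoice[OF this] obtain r where r: "\<And>x. x \<in> ?K \<Longrightarrow> r x > 0"
    "\<And>x. x \<in> ?K \<Longrightarrow> measure \<nu> (phi_ball \<phi> x (r x)) > \<kappa> * V (r x)"
    by blast
  have "eventually (\<lambda>h. V h > measure \<nu> UNIV / \<kappa>) at_top"
    using V_top by (auto simp: filterlim_at_top_dense)
  then obtain B where B: "\<And>h. h \<ge> B \<Longrightarrow> V h > measure \<nu> UNIV / \<kappa>"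
    by (auto simp: eventually_at_top_linorder)
  \<comment> \<open>Large balls have a volume beyond \<open>\<nu> UNIV / \<kappa>\<close>, so the radii are bounded, as Vitali's lemma demands.\<close>
  have rB: "r x \<le> B" if "x \<in> ?K" for x
  proof (rule ccontr)
    assume "\<not> r x \<le> B"
    then have "measure \<nu> UNIV / \<kappa> < V (r x)" by (intro B) simp
    then have "measure \<nu> UNIV < \<kappa> * V (r x)" using lam by (simp add: field_simps)
    also have "\<dots> < measure \<nu> (phi_ball \<phi> x (r x))" by (rule r(2)[OF that])
    also have "\<dots> \<le> measure \<nu> UNIV" using n.bounded_measure spn by metis
    finally show False by simp
  qed
  have cov: "\<phi> ` ?K \<subseteq> (\<Union>i\<in>?K. cball (\<phi> i) (r i))"
    using r(1) by (force intro: less_imp_le)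
  obtain D where D: "countable D" "D \<subseteq> ?K"
     "pairwise (\<lambda>i j. disjnt (cball (\<phi> i) (r i)) (cball (\<phi> j) (r j))) D"
     "\<phi> ` ?K \<subseteq> (\<Union>i\<in>D. cball (\<phi> i) (5 * r i))"
    by (rule Vitali_covering_lemma_cballs[OF cov, of B]) (use r(1) rB in blast)+
  have disj: "disjoint_family_on (\<lambda>i. phi_ball \<phi> i (r i)) D"
    using D(3) by (fastforce simp: disjoint_family_on_def pairwise_def disjnt_def phi_ball_def)
  have sub: "?K \<subseteq> (\<Union>i\<in>D. phi_ball \<phi> i (5 * r i))"
  proof
    fix x assume "x \<in> ?K"
    then have "\<phi> x \<in> (\<Union>i\<in>D. cball (\<phi> i) (5 * r i))" using D(4) by blast
    then show "x \<in> (\<Union>i\<in>D. phi_ball \<phi> i (5 * r i))" by (auto simp: phi_ball_def)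
  qed
  have "emeasure m ?K \<le> emeasure m (\<Union>i\<in>D. phi_ball \<phi> i (5 * r i))"
    by (intro emeasure_mono sub sets.countable_UN' D(1)) auto
  also have "\<dots> \<le> (\<integral>\<^sup>+i. emeasure m (phi_ball \<phi> i (5 * r i)) \<partial>count_space D)"
    by (intro emeasure_UN_le_count_space D(1)) auto
  also have "\<dots> \<le> (\<integral>\<^sup>+i. ennreal (C / \<kappa>) * emeasure \<nu> (phi_ball \<phi> i (r i)) \<partial>count_space D)"
  proof (intro nn_integral_mono)
    fix i assume "i \<in> space (count_space D)"
    then have i: "i \<in> ?K" using D(2) by auto
    have "measure m (phi_ball \<phi> i (5 * r i)) \<le> C * V (r i)" by (rule volume_bound[OF r(1)[OF i]])
    also have "\<dots> \<le> C * (measure \<nu> (phi_ball \<phi> i (r i)) / \<kappa>)"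
      using r(2)[OF i] lam C_pos by (intro mult_left_mono) (auto simp: field_simps)
    finally show "emeasure m (phi_ball \<phi> i (5 * r i)) \<le> ennreal (C / \<kappa>) * emeasure \<nu> (phi_ball \<phi> i (r i))"
      using C_pos lam by (simp add: m.emeasure_eq_measure n.emeasure_eq_measure ennreal_mult[symmetric])
  qed
  also have "\<dots> = ennreal (C / \<kappa>) * (\<integral>\<^sup>+i. emeasure \<nu> (phi_ball \<phi> i (r i)) \<partial>count_space D)"
    by (rule nn_integral_cmult) simp
  also have "(\<integral>\<^sup>+i. emeasure \<nu> (phi_ball \<phi> i (r i)) \<partial>count_space D)
      = emeasure \<nu> (\<Union>i\<in>D. phi_ball \<phi> i (r i))"
    using \<nu> by (intro emeasure_UN_countable[symmetric] D(1) disj) auto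
  also have "\<dots> \<le> emeasure \<nu> UNIV"
    using emeasure_space[of \<nu>] spn by simp
  finally have "emeasure m ?K \<le> ennreal (C / \<kappa>) * emeasure \<nu> UNIV"
    by (meson dual_order.trans mult_left_mono zero_le)
  then show ?thesis
    using C_pos lam by (simp add: n.emeasure_eq_measure ennreal_mult[symmetric])
qed

text \<open>A measure that does not charge \<open>E\<close> is, up to a small rest, carried by a compact set \<open>K\<close> away
  from \<open>E\<close>; small balls around points of \<open>E\<close> miss \<open>K\<close>, and the maximal function of the rest is large
  only on a small set.\<close>

lemma density_zero_off_support:
  assumes \<nu>: "finite_measure \<nu>" "sets \<nu> = sets borel" and E: "E \<in> sets borel" "emeasure \<nu> E = 0"
  shows "AE x in m. x \<in> E \<longrightarrow> ((\<lambda>h. measure \<nu> (phi_ball \<phi> x h) / V h) \<longlongrightarrow> 0) (at_right 0)"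
proof -
  interpret n: finite_measure \<nu> by fact
  have spn: "space \<nu> = UNIV" using sets_eq_imp_space_eq[OF \<nu>(2)] by simp
  have "\<exists>K. compact K \<and> K \<subseteq> - E \<and> measure \<nu> (- K) < e" if "e > 0" for e
  proof -
    have Em: "measure \<nu> (- E) = measure \<nu> UNIV"
      using n.finite_measure_compl[of E] E \<nu> spn by (simp add: Compl_eq_Diff_UNIV measure_def)
    have inn: "emeasure \<nu> (- E) = (SUP K \<in> {K. K \<subseteq> - E \<and> compact K}. emeasure \<nu> K)"
      by (rule inner_regular) (use \<nu> E n.emeasure_finite in auto)
    show ?thesis
    proof (cases "measure \<nu> UNIV < e")
      case True
      then show ?thesis by (intro exI[of _ "{}"]) auto
    next
      case False
      have "ennreal (measure \<nu> UNIV - e) < emeasure \<nu> (- E)"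
        using that False Em by (simp add: n.emeasure_eq_measure ennreal_less_iff)
      then obtain K where K: "K \<subseteq> - E" "compact K" "ennreal (measure \<nu> UNIV - e) < emeasure \<nu> K"
        unfolding inn less_SUP_iff by blast
      then have "measure \<nu> UNIV - e < measure \<nu> K"
        using False by (simp add: n.emeasure_eq_measure ennreal_less_iff)
      moreover have "K \<in> sets \<nu>" using K(2) \<nu>(2) by (simp add: compact_imp_closed borel_closed)
      ultimately show ?thesis
        using K n.finite_measure_compl[of K] spn by (intro exI[of _ K]) (auto simp: Compl_eq_Diff_UNIV)
    qed
  qed
  then have "\<exists>K. compact K \<and> K \<subseteq> - E \<and> measure \<nu> (- K) < 1 / real (Suc j)" for j by simp
  then obtain K where K: "\<And>j. compact (K j)" "\<And>j. K j \<subseteq> - E" "\<And>j. measure \<nu> (- K j) < 1 / real (Suc j)"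
    by metis
  define \<rho> where "\<rho> j = density \<nu> (indicator (- K j))" for j
  have Ks: "- K j \<in> sets \<nu>" for j
    using K(1)[of j] \<nu>(2) by (simp add: compact_imp_closed borel_closed Compl_eq_Diff_UNIV sets.compl_sets)
  have emr: "emeasure (\<rho> j) A = emeasure \<nu> (A - K j)" if "A \<in> sets \<nu>" for j A
    unfolding \<rho>_def using emeasure_restricted[OF Ks that] by (simp add: Diff_eq Int_commute)
  have rs: "sets (\<rho> j) = sets borel" for j by (simp add: \<rho>_def \<nu>)
  have rf: "finite_measure (\<rho> j)" for j
    by (intro finite_measureI) (use emr[of UNIV j] \<nu> spn n.emeasure_finite in \<open>auto simp: \<rho>_def\<close>)
  have rm: "measure (\<rho> j) A = measure \<nu> (A - K j)" if "A \<in> sets \<nu>" for j A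
    using emr[OF that] by (simp add: measure_def)
  have bad: "emeasure m (maximal_exceeds \<phi> V (\<rho> j) \<kappa>) \<le> ennreal (C / \<kappa> * (1 / real (Suc j)))" if "\<kappa> > 0" for j \<kappa>
  proof -
    have "C * measure (\<rho> j) UNIV / \<kappa> \<le> C / \<kappa> * (1 / real (Suc j))"
      using rm[of UNIV j] K(3)[of j] C_pos that \<nu>
      by (auto simp: Compl_eq_Diff_UNIV divide_simps mult_left_mono intro!: mult_left_mono)
    then show ?thesis
      using weak_type_bound[OF rf rs that] by (meson ennreal_leI order_trans)
  qed
  have mes: "maximal_exceeds \<phi> V (\<rho> j) \<kappa> \<in> sets borel" for j \<kappa>
    by (intro borel_open open_maximal_exceeds rf rs)
  define Z where "Z i = (\<Inter>j. maximal_exceeds \<phi> V (\<rho> j) (1 / real (Suc i)))" for i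
  have Zs: "Z i \<in> sets borel" for i
    unfolding Z_def by (intro sets.countable_INT'') (auto simp: mes)
  have "emeasure m (Z i) = 0" for i
  proof -
    have "emeasure m (Z i) \<le> ennreal (C / (1 / real (Suc i)) * (1 / real (Suc j)))" for j
    proof -
      have "emeasure m (Z i) \<le> emeasure m (maximal_exceeds \<phi> V (\<rho> j) (1 / real (Suc i)))"
        unfolding Z_def by (intro emeasure_mono) (auto simp: mes)
      also have "\<dots> \<le> ennreal (C / (1 / real (Suc i)) * (1 / real (Suc j)))"
        by (rule bad) simp
      finally show ?thesis .
    qed
    moreover have "(\<lambda>j. ennreal (C / (1 / real (Suc i)) * (1 / real (Suc j)))) \<longlonglongrightarrow> ennreal (C / (1 / real (Suc i)) * 0)"
      by (intro tendsto_ennrealI tendsto_mult tendsto_const LIMSEQ_Suc[OF lim_1_over_n])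
    ultimately have "emeasure m (Z i) \<le> ennreal (C / (1 / real (Suc i)) * 0)"
      by (intro LIMSEQ_le_const) auto
    then show ?thesis by simp
  qed
  then have "AE x in m. \<forall>i. x \<notin> Z i"
    using Zs by (subst AE_all_countable) (auto intro!: AE_not_in null_setsI)
  then show ?thesis
  proof (rule AE_mp, intro AE_I2 impI)
    fix x assume nZ: "\<forall>i. x \<notin> Z i" and xE: "x \<in> E"
    show "((\<lambda>h. measure \<nu> (phi_ball \<phi> x h) / V h) \<longlongrightarrow> 0) (at_right 0)"
    proof (rule tendstoI)
      fix e :: real assume "e > 0"
      then obtain i where i: "1 / real (Suc i) < e"
        using reals_Archimedean[of e] by (auto simp: inverse_eq_divide)
      obtain j where j: "x \<notin> maximal_exceeds \<phi> V (\<rho> j) (1 / real (Suc i))"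
        using nZ by (auto simp: Z_def)
      have "closed (\<phi> ` K j)"
        using K(1) continuous_phi by (intro compact_imp_closed compact_continuous_image) (auto intro: continuous_on_subset)
      moreover have "\<phi> x \<notin> \<phi> ` K j" using xE K(2)[of j] inj_phi by (auto simp: inj_def)
      ultimately obtain d where d: "d > 0" "cball (\<phi> x) d \<subseteq> - (\<phi> ` K j)"
        using open_contains_cball[of "- (\<phi> ` K j)"] by (metis ComplI open_Compl)
      have "dist (measure \<nu> (phi_ball \<phi> x h) / V h) 0 < e" if h: "0 < h" "h < d" for h
      proof -
        have "phi_ball \<phi> x h - K j = phi_ball \<phi> x h"
          using d(2) h(2) by (force simp: phi_ball_def)
        then have "measure \<nu> (phi_ball \<phi> x h) = measure (\<rho> j) (phi_ball \<phi> x h)"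
          using \<nu> by (simp add: rm)
        also have "\<dots> \<le> 1 / real (Suc i) * V h"
          using j h(1) unfolding maximal_exceeds_def mem_Collect_eq by (meson not_less)
        also have "\<dots> < e * V h" using i V_pos[OF h(1)] by (intro mult_strict_right_mono)
        finally show ?thesis using V_pos[OF h(1)] by (simp add: field_simps)
      qed
      then show "eventually (\<lambda>h. dist (measure \<nu> (phi_ball \<phi> x h) / V h) 0 < e) (at_right 0)"
        using d(1) by (auto simp: eventually_at_right_field)
    qed
  qed
qed

text \<open>Lebesgue points are found without approximation by continuous functions.  Near a point \<open>x\<close> of
  \<open>E = {y. |f y - q| < 1/n}\<close> the mean of \<open>|f - q|\<close> over the part of the ball inside \<open>E\<close> is small, and the part outside has
  density zero; the centre \<open>q\<close> runs through a countable dense set.\<close>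

lemma lebesgue_point_density:
  fixes f :: "'a \<Rightarrow> complex"
  assumes f: "integrable m f"
  shows "AE x in m. ((\<lambda>h. measure (density m (\<lambda>y. ennreal (cmod (f y - f x)))) (phi_ball \<phi> x h) / V h)
           \<longlongrightarrow> 0) (at_right 0)"
proof -
  note [measurable] = borel_measurable_integrable[OF f]
  have fb [measurable]: "f \<in> borel_measurable borel"
    using borel_measurable_integrable[OF f] measurable_cong_sets[OF sets_m refl] by blast
  have fin: "finite_measure (density m (\<lambda>y. ennreal (cmod (f y - q))))" for q
  proof (intro finite_measureI)
    have "integrable m (\<lambda>y. cmod (f y - q))"
      using f by (intro integrable_norm Bochner_Integration.integrable_diff) auto
    then show "emeasure (density m (\<lambda>y. ennreal (cmod (f y - q))))
        (space (density m (\<lambda>y. ennreal (cmod (f y - q))))) \<noteq> \<infinity>"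
      by (simp add: emeasure_density nn_integral_eq_integral)
  qed
  obtain Q :: "complex set" where Q: "countable Q" "\<And>X. open X \<Longrightarrow> X \<noteq> {} \<Longrightarrow> \<exists>q\<in>Q. q \<in> X"
    using countable_dense_exists by blast
  define E where "E q n = {y. cmod (f y - q) < 1 / real (Suc n)}" for q and n :: nat
  have Es [measurable]: "E q n \<in> sets borel" for q n
    unfolding E_def by measurable
  have Em [measurable]: "E q n \<in> sets m" for q n by simp
  have gm: "(\<lambda>y. ennreal (cmod (f y - q)) * indicator (- E q n) y) \<in> borel_measurable m" for q n
    by (intro borel_measurable_times_ennreal borel_measurable_indicator) auto
  define \<rho> where "\<rho> q n = density m (\<lambda>y. ennreal (cmod (f y - q)) * indicator (- E q n) y)" for q n
  have rs: "sets (\<rho> q n) = sets borel" for q n by (simp add: \<rho>_def)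
  have rf: "finite_measure (\<rho> q n)" for q n
  proof (intro finite_measureI)
    have "emeasure (\<rho> q n) (space (\<rho> q n)) \<le> emeasure (density m (\<lambda>y. ennreal (cmod (f y - q)))) UNIV"
      unfolding \<rho>_def
      by (subst (1 2) emeasure_density) (auto intro!: nn_integral_mono gm simp: indicator_def)
    then show "emeasure (\<rho> q n) (space (\<rho> q n)) \<noteq> \<infinity>"
      using finite_measure.emeasure_finite[OF fin] by (metis infinity_ennreal_def neq_top_trans)
  qed
  have "emeasure (\<rho> q n) (E q n) = 0" for q n
  proof -
    have "(\<integral>\<^sup>+y. ennreal (cmod (f y - q)) * indicator (- E q n) y * indicator (E q n) y \<partial>m) = (\<integral>\<^sup>+y. 0 \<partial>m)"
      by (intro nn_integral_cong) (auto simp: indicator_def)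
    then show ?thesis
      unfolding \<rho>_def by (subst emeasure_density) (auto intro: gm)
  qed
  then have "AE x in m. x \<in> E q n \<longrightarrow> ((\<lambda>h. measure (\<rho> q n) (phi_ball \<phi> x h) / V h) \<longlongrightarrow> 0) (at_right 0)" for q n
    by (intro density_zero_off_support rf rs Es)
  then have "AE x in m. \<forall>q\<in>Q. \<forall>n. x \<in> E q n \<longrightarrow> ((\<lambda>h. measure (\<rho> q n) (phi_ball \<phi> x h) / V h) \<longlongrightarrow> 0) (at_right 0)"
    using Q(1) by (simp add: AE_ball_countable AE_all_countable)
  then show ?thesis
  proof (rule AE_mp, intro AE_I2 impI)
    fix x
    assume x: "\<forall>q\<in>Q. \<forall>n. x \<in> E q n \<longrightarrow> ((\<lambda>h. measure (\<rho> q n) (phi_ball \<phi> x h) / V h) \<longlongrightarrow> 0) (at_right 0)"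
    let ?D = "density m (\<lambda>y. ennreal (cmod (f y - f x)))"
    show "((\<lambda>h. measure ?D (phi_ball \<phi> x h) / V h) \<longlongrightarrow> 0) (at_right 0)"
    proof (rule tendstoI)
      fix e :: real assume "e > 0"
      then obtain n where n: "1 / real (Suc n) < e / (4 * C)"
        using reals_Archimedean[of "e / (4 * C)"] C_pos by (auto simp: inverse_eq_divide)
      obtain q where q: "q \<in> Q" "q \<in> ball (f x) (1 / real (Suc n))"
        using Q(2)[of "ball (f x) (1 / real (Suc n))"] by auto
      then have qx: "cmod (f x - q) < 1 / real (Suc n)" by (simp add: dist_norm)
      then have "x \<in> E q n" by (simp add: E_def)
      then have "((\<lambda>h. measure (\<rho> q n) (phi_ball \<phi> x h) / V h) \<longlongrightarrow> 0) (at_right 0)"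
        using x q(1) by blast
      then have "eventually (\<lambda>h. measure (\<rho> q n) (phi_ball \<phi> x h) / V h < e / 2) (at_right 0)"
        by (rule order_tendstoD) (use \<open>e > 0\<close> in simp)
      then show "eventually (\<lambda>h. dist (measure ?D (phi_ball \<phi> x h) / V h) 0 < e) (at_right 0)"
        using eventually_at_right_less[of "0::real"]
      proof eventually_elim
        case (elim h)
        let ?B = "phi_ball \<phi> x h"
        interpret r: finite_measure "\<rho> q n" by (rule rf)
        interpret d: finite_measure ?D by (rule fin)
        have "emeasure ?D ?B \<le> (\<integral>\<^sup>+y. ennreal (cmod (f y - q)) * indicator (- E q n) y * indicator ?B y
            + ennreal (2 / real (Suc n)) * indicator ?B y \<partial>m)"
        proof (subst emeasure_density, simp_all, intro nn_integral_mono)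
          fix y
          have 1: "cmod (f y - f x) \<le> cmod (f y - q) + cmod (f x - q)"
            by (metis norm_minus_commute norm_triangle_sub add.commute diff_add_cancel dist_norm dist_triangle2)
          show "ennreal (cmod (f y - f x)) * indicator ?B y \<le>
            ennreal (cmod (f y - q)) * indicator (- E q n) y * indicator ?B y
            + ennreal (2 / (1 + real n)) * indicator ?B y"
          proof (cases "y \<in> E q n")
            case True
            then have "cmod (f y - f x) \<le> 2 / (1 + real n)"
              using 1 qx by (simp add: E_def)
            then show ?thesis using True by (auto simp: indicator_def intro!: ennreal_leI)
          next
            case False
            have "cmod (f y - f x) \<le> cmod (f y - q) + 2 / (1 + real n)"
            proof -
              have "1 / real (Suc n) \<le> 2 / (1 + real n)" by (simp add: divide_right_mono)
              then show ?thesis using 1 qx by linarith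
            qed
            then have "ennreal (cmod (f y - f x)) \<le> ennreal (cmod (f y - q)) + ennreal (2 / (1 + real n))"
              by (simp add: ennreal_plus[symmetric] ennreal_leI del: ennreal_plus)
            then show ?thesis using False by (auto simp: indicator_def)
          qed
        qed
        also have "\<dots> = emeasure (\<rho> q n) ?B + ennreal (2 / real (Suc n)) * emeasure m ?B"
          unfolding \<rho>_def
          by (subst nn_integral_add)
            (auto simp: emeasure_density gm nn_integral_cmult_indicator
              intro!: borel_measurable_times_ennreal borel_measurable_indicator gm)
        finally have "measure ?D ?B \<le> measure (\<rho> q n) ?B + 2 / real (Suc n) * measure m ?B"
          by (simp add: d.emeasure_eq_measure r.emeasure_eq_measure m.emeasure_eq_measure
              ennreal_mult[symmetric] ennreal_plus[symmetric] del: ennreal_plus)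
        also have "measure m ?B \<le> C * V h"
          using volume_bound[OF elim(2), of x] elim(2)
          by (intro order_trans[OF m.finite_measure_mono[OF phi_ball_mono[of h "5 * h"]]]) auto
        finally have "measure ?D ?B \<le> measure (\<rho> q n) ?B + 2 / real (Suc n) * (C * V h)"
          by (simp add: divide_right_mono mult_left_mono)
        moreover have "2 / real (Suc n) * C < e / 2"
          using n C_pos by (simp add: field_simps)
        then have "2 / real (Suc n) * (C * V h) < e / 2 * V h"
          unfolding mult.assoc[symmetric] using V_pos[OF elim(2)] by (rule mult_strict_right_mono)
        moreover have "measure (\<rho> q n) ?B < e / 2 * V h"
          using elim V_pos[OF elim(2)] by (simp add: pos_divide_less_eq)
        ultimately have "measure ?D ?B < e * V h" by linarith
        then show ?case using V_pos[OF elim(2)] by (simp add: pos_divide_less_eq abs_of_nonneg)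
      qed
    qed
  qed
qed

end

section \<open>Haar measure of products\<close>

lemma lborel_integral_prod_vec:
  fixes G :: "'n::finite \<Rightarrow> real \<Rightarrow> complex"
  assumes "\<And>j. integrable lborel (G j)"
  shows "(LINT t|lborel. (\<Prod>j\<in>UNIV. G j (t $ j))) = (\<Prod>j\<in>UNIV. LINT s|lborel. G j s)"
proof -
  interpret product_sigma_finite "\<lambda>_::real ^ 'n. lborel :: real measure" ..
  let ?F = "\<lambda>b::real ^ 'n. G (axis_index b)"
  have bas: "(Basis :: (real ^ 'n) set) = range (\<lambda>j. axis j 1)"
    by (auto simp: Basis_vec_def)
  have inj: "inj (\<lambda>j::'n. axis j (1::real))" by (auto simp: inj_def axis_eq_axis)
  have re: "(\<Prod>b\<in>Basis. H b) = (\<Prod>j\<in>UNIV. H (axis j 1))" for H :: "real ^ 'n \<Rightarrow> complex"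
    unfolding bas by (subst prod.reindex[OF inj]) simp
  have [measurable]: "G j \<in> borel_measurable borel" for j
    using borel_measurable_integrable[OF assms[of j]] by simp
  have m: "(\<lambda>t::real ^ 'n. \<Prod>j\<in>UNIV. G j (t $ j)) \<in> borel_measurable borel"
  proof (intro borel_measurable_prod)
    fix j :: 'n
    have "(\<lambda>t::real ^ 'n. t $ j) \<in> borel_measurable borel"
      by (intro borel_measurable_continuous_onI continuous_intros)
    then show "(\<lambda>t::real ^ 'n. G j (t $ j)) \<in> borel_measurable borel" by measurable
  qed
  have "(LINT t|lborel. (\<Prod>j\<in>UNIV. G j (t $ j)))
      = (LINT t|distr (\<Pi>\<^sub>M b\<in>Basis. lborel) borel (\<lambda>f. \<Sum>b\<in>(Basis::(real ^ 'n) set). f b *\<^sub>R b). (\<Prod>j\<in>UNIV. G j (t $ j)))"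
    by (subst lborel_eq) (rule refl)
  also have "\<dots> = (LINT f|(\<Pi>\<^sub>M b\<in>Basis. lborel). (\<Prod>j\<in>UNIV. G j ((\<Sum>b\<in>(Basis::(real ^ 'n) set). f b *\<^sub>R b) $ j)))"
    by (rule integral_distr) (use m in measurable)
  also have "\<dots> = (LINT f|(\<Pi>\<^sub>M b\<in>Basis. lborel). (\<Prod>b\<in>(Basis::(real ^ 'n) set). ?F b (f b)))"
  proof (intro Bochner_Integration.integral_cong refl)
    fix f :: "real ^ 'n \<Rightarrow> real"
    have "(\<Sum>b\<in>(Basis::(real ^ 'n) set). f b *\<^sub>R b) $ j = f (axis j 1)" for j
    proof -
      have "(\<Sum>b\<in>(Basis::(real ^ 'n) set). f b *\<^sub>R b) $ j = (\<Sum>b\<in>Basis. f b *\<^sub>R b) \<bullet> axis j 1"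
        by (simp add: inner_axis)
      also have "\<dots> = f (axis j 1)" by (rule inner_sum_left_Basis) (simp add: axis_in_Basis_iff)
      finally show ?thesis .
    qed
    then show "(\<Prod>j\<in>UNIV. G j ((\<Sum>b\<in>(Basis::(real ^ 'n) set). f b *\<^sub>R b) $ j)) = (\<Prod>b\<in>Basis. ?F b (f b))"
      unfolding re by simp
  qed
  also have "\<dots> = (\<Prod>b\<in>(Basis::(real ^ 'n) set). integral\<^sup>L lborel (?F b))"
    by (rule product_integral_prod) (use assms in auto)
  also have "\<dots> = (\<Prod>j\<in>UNIV. LINT s|lborel. G j s)"
    unfolding re by simp
  finally show ?thesis .
qed

lemma space_torus_borel [simp]: "space torus_borel = torus"
  by (simp add: torus_borel_def space_restrict_space)

lemma sets_torus_haar [simp]: "sets torus_haar = sets torus_borel"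
  by (simp add: torus_haar_def)

lemma space_torus_haar [simp]: "space torus_haar = torus"
  by (simp add: torus_haar_def)

lemma emeasure_angle_cube:
  "emeasure lborel (cbox 0 (\<chi> j. 2 * pi) :: (real ^ 'n) set) = ennreal ((2 * pi) ^ CARD('n))"
proof -
  have bas: "(Basis :: (real ^ 'n) set) = range (\<lambda>j. axis j 1)"
    by (auto simp: Basis_vec_def)
  have inj: "inj (\<lambda>j::'n. axis j (1::real))" by (auto simp: inj_def axis_eq_axis)
  have "(\<Prod>b\<in>Basis. (\<chi> j. 2 * pi :: real ^ 'n) \<bullet> b) = (2 * pi) ^ CARD('n)"
    unfolding bas by (subst prod.reindex[OF inj]) (simp add: inner_axis)
  moreover have "0 \<le> (\<chi> j. 2 * pi :: real ^ 'n) \<bullet> b" if "b \<in> Basis" for b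
    using that by (auto simp: bas inner_axis)
  ultimately show ?thesis by (simp add: emeasure_lborel_cbox_eq)
qed

text \<open>The angle cube is a product, so Haar measure integrates products of functions of one coordinate
  factor by factor.  This gives both the measure of boxes and the mass of the kernel.\<close>

lemma torus_haar_integral_prod:
  fixes g :: "'n::finite \<Rightarrow> complex \<Rightarrow> complex"
  assumes m: "(\<lambda>\<zeta>. \<Prod>j\<in>UNIV. g j (\<zeta> $ j)) \<in> borel_measurable (torus_borel :: (complex ^ 'n) measure)"
    and int: "\<And>j. set_integrable lborel {0..2 * pi} (\<lambda>s. g j (cis s))"
  shows "(LINT \<zeta>|torus_haar. (\<Prod>j\<in>UNIV. g j (\<zeta> $ j)))
    = (\<Prod>j\<in>UNIV. (LINT s:{0..2 * pi}|lborel. g j (cis s)) / (2 * pi))"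
proof -
  let ?C = "cbox 0 (\<chi> j. 2 * pi) :: (real ^ 'n) set"
  let ?c = "\<lambda>t::real ^ 'n. (\<chi> j. cis (t $ j))"
  let ?f = "\<lambda>t::real ^ 'n. \<Prod>j\<in>UNIV. g j (cis (t $ j))"
  let ?G = "\<lambda>j s. (indicator {0..2 * pi} s / (2 * pi)) *\<^sub>R g j (cis s)"
  have cm: "?c \<in> borel \<rightarrow>\<^sub>M torus_borel" by (rule measurable_torus_param)
  have fm: "?f \<in> borel_measurable borel"
    using measurable_compose[OF cm m] by simp
  have "(LINT \<zeta>|torus_haar. (\<Prod>j\<in>UNIV. g j (\<zeta> $ j))) = (LINT t|uniform_measure lborel ?C. ?f t)"
    unfolding torus_haar_def
    by (subst integral_distr) (use cm m in \<open>simp_all cong: measurable_cong_sets\<close>)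
  also have "uniform_measure lborel ?C = density lborel (\<lambda>t. ennreal (indicator ?C t / (2 * pi) ^ CARD('n)))"
    unfolding uniform_measure_def emeasure_angle_cube
    by (intro arg_cong[where f="density lborel"] ext)
      (auto simp: indicator_def ennreal_1[symmetric] divide_ennreal simp del: ennreal_1)
  also have "(LINT t|\<dots>. ?f t) = (LINT t|lborel. (indicator ?C t / (2 * pi) ^ CARD('n)) *\<^sub>R ?f t)"
    by (rule integral_density) (use fm in auto)
  also have "\<dots> = (LINT t|lborel. (\<Prod>j\<in>UNIV. ?G j (t $ j)))"
  proof (intro Bochner_Integration.integral_cong refl)
    fix t :: "real ^ 'n"
    have "indicator ?C t = (\<Prod>j\<in>UNIV. indicator {0..2 * pi} (t $ j) :: real)"
      by (auto simp: indicator_def mem_box_cart prod_zero_iff)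
    then have "indicator ?C t / (2 * pi) ^ CARD('n) = (\<Prod>j\<in>UNIV. indicator {0..2 * pi} (t $ j) / (2 * pi))"
      by (simp add: prod_dividef)
    then show "(indicator ?C t / (2 * pi) ^ CARD('n)) *\<^sub>R ?f t = (\<Prod>j\<in>UNIV. ?G j (t $ j))"
      by (simp only: scaleR_conv_of_real of_real_prod prod.distrib)
  qed
  also have "\<dots> = (\<Prod>j\<in>UNIV. LINT s|lborel. ?G j s)"
  proof (rule lborel_integral_prod_vec)
    show "integrable lborel (?G j)" for j
      using integrable_scaleR_right[OF int[of j, unfolded set_integrable_def], of "1 / (2 * pi)"] by simp
  qed
  also have "\<dots> = (\<Prod>j\<in>UNIV. (LINT s:{0..2 * pi}|lborel. g j (cis s)) / (2 * pi))"
  proof (intro prod.cong refl)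
    fix j :: 'n
    have "(LINT s|lborel. ?G j s) = (LINT s|lborel. (1 / (2 * pi)) *\<^sub>R (indicator {0..2 * pi} s *\<^sub>R g j (cis s)))"
      by simp
    also have "\<dots> = (LINT s:{0..2 * pi}|lborel. g j (cis s)) / (2 * pi)"
      unfolding set_lebesgue_integral_def
      by (subst integral_scaleR_right) (simp add: scaleR_conv_of_real field_simps)
    finally show "(LINT s|lborel. ?G j s) = (LINT s:{0..2 * pi}|lborel. g j (cis s)) / (2 * pi)" .
  qed
  finally show ?thesis .
qed

lemma sin_ge_third:
  fixes x :: real
  assumes "0 \<le> x" "x \<le> pi / 2"
  shows "x / 3 \<le> sin x"
proof -
  have "\<bar>sin x - (\<Sum>m<3. sin_coeff m * x ^ m)\<bar> \<le> inverse (fact 3) * \<bar>x\<bar> ^ 3"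
    by (rule Maclaurin_sin_bound)
  then have 1: "\<bar>sin x - x\<bar> \<le> x ^ 3 / 6"
    using assms(1) by (simp add: sin_coeff_def eval_nat_numeral)
  have "x * x \<le> 2 * 2"
    using assms pi_half_less_two by (intro mult_mono) auto
  then have "x * (x * x) \<le> x * 4" using assms(1) by (intro mult_left_mono) auto
  then have "x ^ 3 / 6 \<le> 2 / 3 * x" by (simp add: power3_eq_cube)
  then show ?thesis using 1 by linarith
qed

lemma dist_cis: "cmod (cis s - cis t) = 2 * \<bar>sin ((s - t) / 2)\<bar>"
proof -
  have "cis s - cis t = cis t * (cis (s - t) - 1)"
    by (simp add: algebra_simps cis_mult)
  then have "cmod (cis s - cis t) = cmod (cis (s - t) - 1)"
    by (simp add: norm_mult)
  also have "\<dots> = 2 * \<bar>sin ((s - t) / 2)\<bar>"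
    using dist_exp_i_1[of "s - t"] by (simp add: cis_conv_exp)
  finally show ?thesis .
qed

text \<open>Two points of the circle at distance at most \<open>2\<rho>\<close> have angles that differ by at most \<open>6\<rho>\<close> modulo
  \<open>2\<pi>\<close>, because \<open>sin x \<ge> x / 3\<close>.  The three intervals around \<open>t0\<close> and \<open>t0 \<plusminus> 2\<pi>\<close> take care of the cut.\<close>

lemma arc_length_le:
  fixes w :: complex
  assumes "\<rho> \<ge> 0"
  shows "measure lborel ({0..2 * pi} \<inter> {t. cmod (cis t - w) \<le> \<rho>}) \<le> 36 * \<rho>"
proof (cases "{0..2 * pi} \<inter> {t. cmod (cis t - w) \<le> \<rho>} = {}")
  case False
  let ?S = "{0..2 * pi} \<inter> {t. cmod (cis t - w) \<le> \<rho>}"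
  obtain t0 where t0: "0 \<le> t0" "t0 \<le> 2 * pi" "cmod (cis t0 - w) \<le> \<rho>" using False by auto
  let ?I = "\<lambda>c. {c - 6 * \<rho>..c + 6 * \<rho>}"
  have "?S \<subseteq> ?I t0 \<union> ?I (t0 + 2 * pi) \<union> ?I (t0 - 2 * pi)"
  proof
    fix t assume t: "t \<in> ?S"
    have "cmod (cis t - cis t0) \<le> 2 * \<rho>"
      using t t0(3) norm_triangle_ineq4[of "cis t - w" "cis t0 - w"] by simp
    then have s: "\<bar>sin ((t - t0) / 2)\<bar> \<le> \<rho>" by (simp add: dist_cis)
    define u where "u = \<bar>t - t0\<bar> / 2"
    have u: "0 \<le> u" "u \<le> pi" using t t0 by (auto simp: u_def)
    have "sin u = \<bar>sin ((t - t0) / 2)\<bar>"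
    proof -
      have "\<bar>sin u\<bar> = \<bar>sin ((t - t0) / 2)\<bar>"
        by (cases "t \<ge> t0") (auto simp: u_def minus_divide_left[symmetric] minus_diff_eq[symmetric, of t t0] simp del: minus_diff_eq)
      then show ?thesis using sin_ge_zero[OF u] by simp
    qed
    then have su: "sin u \<le> \<rho>" using s by simp
    show "t \<in> ?I t0 \<union> ?I (t0 + 2 * pi) \<union> ?I (t0 - 2 * pi)"
    proof (cases "u \<le> pi / 2")
      case True
      then have "u \<le> 3 * \<rho>" using sin_ge_third[of u] u su by simp
      then have "\<bar>t - t0\<bar> \<le> 6 * \<rho>" by (simp add: u_def)
      then have "t \<in> ?I t0" by (simp add: abs_le_iff)
      then show ?thesis by blast
    next
      case False
      then have "(pi - u) / 3 \<le> sin (pi - u)" using u by (intro sin_ge_third) auto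
      then have "pi - u \<le> 3 * \<rho>" using su by simp
      then have *: "2 * pi - \<bar>t - t0\<bar> \<le> 6 * \<rho>" "\<bar>t - t0\<bar> \<le> 2 * pi" using u by (auto simp: u_def)
      show ?thesis
      proof (cases "t0 \<le> t")
        case True
        then have "t \<in> ?I (t0 + 2 * pi)" using * assms unfolding atLeastAtMost_iff by linarith
        then show ?thesis by blast
      next
        case False
        then have "t \<in> ?I (t0 - 2 * pi)" using * assms unfolding atLeastAtMost_iff by linarith
        then show ?thesis by blast
      qed
    qed
  qed
  then have "measure lborel ?S \<le> measure lborel (?I t0 \<union> ?I (t0 + 2 * pi) \<union> ?I (t0 - 2 * pi))"
  proof (intro measure_mono_fmeasurable)
    have "{a..b::real} \<in> fmeasurable lborel" for a b
      by (auto intro!: fmeasurableI simp: emeasure_lborel_Icc_eq)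
    then show "?I t0 \<union> ?I (t0 + 2 * pi) \<union> ?I (t0 - 2 * pi) \<in> fmeasurable lborel"
      by (intro fmeasurable.Un)
    show "?S \<in> sets lborel"
      by (auto intro!: borel_closed closed_Collect_le continuous_intros sets.Int simp: cis_conv_exp)
  qed
  also have "\<dots> \<le> measure lborel (?I t0 \<union> ?I (t0 + 2 * pi)) + measure lborel (?I (t0 - 2 * pi))"
    by (intro measure_Un_le) auto
  also have "measure lborel (?I t0 \<union> ?I (t0 + 2 * pi)) \<le> measure lborel (?I t0) + measure lborel (?I (t0 + 2 * pi))"
    by (intro measure_Un_le) auto
  also have "measure lborel (?I t0) + measure lborel (?I (t0 + 2 * pi)) + measure lborel (?I (t0 - 2 * pi)) = 36 * \<rho>"
    using assms by simp
  finally show ?thesis by simp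
qed (use assms in simp)

lemma haar_box_le:
  fixes w :: "complex ^ 'n::finite" and \<rho> :: "'n \<Rightarrow> real"
  assumes "\<And>j. \<rho> j \<ge> 0"
  shows "measure torus_haar (torus \<inter> {\<zeta>. \<forall>j. cmod (\<zeta> $ j - w $ j) \<le> \<rho> j}) \<le> (\<Prod>j\<in>UNIV. 6 * \<rho> j)"
proof -
  interpret prob_space "torus_haar :: (complex ^ 'n) measure" by (rule prob_space_torus_haar)
  let ?B = "{\<zeta>::complex ^ 'n. \<forall>j. cmod (\<zeta> $ j - w $ j) \<le> \<rho> j}"
  let ?g = "\<lambda>j z. indicator {z. cmod (z - w $ j) \<le> \<rho> j} z :: complex"
  let ?A = "\<lambda>j. {0..2 * pi} \<inter> {t. cmod (cis t - w $ j) \<le> \<rho> j}"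
  have "closed ?B"
    by (intro closed_Collect_all closed_Collect_le continuous_intros)
  then have "torus \<inter> ?B \<in> sets torus_borel"
    unfolding torus_borel_def by (auto simp: sets_restrict_space intro: borel_closed)
  then have B: "torus \<inter> ?B \<in> sets torus_haar" by simp
  have ind: "(\<Prod>j\<in>UNIV. ?g j (\<zeta> $ j)) = indicator (torus \<inter> ?B) \<zeta>" if "\<zeta> \<in> torus" for \<zeta>
    using that by (auto simp: indicator_def prod_zero_iff)
  have "complex_of_real (measure torus_haar (torus \<inter> ?B)) = (LINT \<zeta>|torus_haar. complex_of_real (indicator (torus \<inter> ?B) \<zeta>))"
    using B by (subst integral_complex_of_real) (simp add: Int_absorb2)
  also have "\<dots> = (LINT \<zeta>|torus_haar. (\<Prod>j\<in>UNIV. ?g j (\<zeta> $ j)))"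
    by (intro Bochner_Integration.integral_cong refl) (simp add: ind of_real_indicator)
  also have "\<dots> = (\<Prod>j\<in>UNIV. (LINT s:{0..2 * pi}|lborel. ?g j (cis s)) / (2 * pi))"
  proof (rule torus_haar_integral_prod)
    have "(indicator (torus \<inter> ?B) :: _ \<Rightarrow> complex) \<in> borel_measurable torus_borel"
      using B by simp
    then show "(\<lambda>\<zeta>. \<Prod>j\<in>UNIV. ?g j (\<zeta> $ j)) \<in> borel_measurable torus_borel"
      by (subst measurable_cong[where g="indicator (torus \<inter> ?B)"]) (auto simp: ind)
    show "set_integrable lborel {0..2 * pi} (\<lambda>s. ?g j (cis s))" for j
    proof -
      have "?A j \<in> sets lborel"
        by (auto intro!: borel_closed closed_Collect_le continuous_intros sets.Int simp: cis_conv_exp)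
      moreover have "emeasure lborel (?A j) \<le> emeasure lborel {0..2 * pi}"
        by (intro emeasure_mono) auto
      then have "emeasure lborel (?A j) < \<infinity>" by (simp add: le_less_trans)
      ultimately have "integrable lborel (\<lambda>s. complex_of_real (indicator (?A j) s))"
        by (intro integrable_of_real integrable_real_indicator)
      moreover have "(\<lambda>s. complex_of_real (indicator (?A j) s)) = (\<lambda>s. indicator {0..2 * pi} s *\<^sub>R ?g j (cis s))"
        by (auto simp: indicator_def)
      ultimately show ?thesis by (simp add: set_integrable_def)
    qed
  qed
  also have "\<dots> = (\<Prod>j\<in>UNIV. complex_of_real (measure lborel (?A j) / (2 * pi)))"
  proof (intro prod.cong refl)
    fix j
    have "(LINT s:{0..2 * pi}|lborel. ?g j (cis s)) = (LINT s|lborel. complex_of_real (indicator (?A j) s))"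
      unfolding set_lebesgue_integral_def
      by (intro Bochner_Integration.integral_cong refl) (auto simp: indicator_def)
    also have "\<dots> = of_real (measure lborel (?A j))"
      by (subst integral_complex_of_real) simp
    finally show "(LINT s:{0..2 * pi}|lborel. ?g j (cis s)) / (2 * pi) = of_real (measure lborel (?A j) / (2 * pi))"
      by simp
  qed
  finally have "measure torus_haar (torus \<inter> ?B) = (\<Prod>j\<in>UNIV. measure lborel (?A j) / (2 * pi))"
    unfolding of_real_prod[symmetric] of_real_eq_iff .
  also have "\<dots> \<le> (\<Prod>j\<in>UNIV. 6 * \<rho> j)"
  proof (intro prod_mono conjI)
    fix j
    have "measure lborel (?A j) \<le> 36 * \<rho> j" by (rule arc_length_le[OF assms])
    also have "\<dots> \<le> 6 * \<rho> j * (2 * pi)"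
      using mult_right_mono[OF less_imp_le[OF pi_gt3] assms[of j]] by simp
    finally show "measure lborel (?A j) / (2 * pi) \<le> 6 * \<rho> j" by (simp add: divide_le_eq)
  qed simp
  finally show ?thesis .
qed

section \<open>The radial limit of the one-dimensional kernel\<close>

definition binomial_coeff :: "complex \<Rightarrow> nat \<Rightarrow> complex" where
  "binomial_coeff p k = pochhammer p k / fact k"

lemma binomial_series:
  fixes p z :: complex
  assumes "cmod z < 1"
  shows "(\<lambda>k. binomial_coeff p k * z ^ k) sums ((1 - z) powr (- p))"
proof -
  have "(\<lambda>k. (- p gchoose k) * (- z) ^ k) sums (1 + (- z)) powr (- p)"
    using assms by (intro gen_binomial_complex) simp
  moreover have "(- p gchoose k) * (- z) ^ k = binomial_coeff p k * z ^ k" for k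
  proof -
    have "(-1 :: complex) ^ k * (-1) ^ k = 1" by (simp add: power_mult_distrib[symmetric])
    then show ?thesis
      using power_minus[of z k] by (simp add: gbinomial_pochhammer binomial_coeff_def mult.assoc)
  qed
  ultimately show ?thesis by simp
qed

lemma summable_norm_binomial:
  fixes p z :: complex
  assumes "cmod z < 1"
  shows "summable (\<lambda>k. cmod (binomial_coeff p k * z ^ k))"
proof -
  obtain R where R: "cmod z < R" "R < 1" using assms dense by blast
  have "0 \<le> R" using norm_ge_zero[of z] R(1) by linarith
  then have "cmod (of_real R :: complex) < 1" using R(2) by simp
  then have "summable (\<lambda>k. binomial_coeff p k * of_real R ^ k)"
    using binomial_series sums_summable by blast
  then show ?thesis
    using R \<open>0 \<le> R\<close> by (intro powser_insidea) auto
qed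

text \<open>The asymptotics of the coefficients is Euler's limit formula for the Gamma function.\<close>

lemma binomial_coeff_rGamma:
  assumes "n > 0"
  shows "binomial_coeff p (Suc n) = rGamma_series p n * exp (p * of_real (ln (real n))) / of_nat (Suc n)"
  using assms by (simp add: binomial_coeff_def rGamma_series_def divide_simps del: of_nat_Suc pochhammer_Suc)

lemma binomial_coeff_product_asymptotics:
  fixes p q w :: complex
  assumes w: "w = p + q - 1" "Re w > 0"
  shows "(\<lambda>n. binomial_coeff p n * binomial_coeff q n / binomial_coeff w n)
    \<longlonglongrightarrow> rGamma p * rGamma q / rGamma w"
proof -
  have w0: "rGamma w \<noteq> 0"
  proof -
    have "w \<notin> \<int>\<^sub>\<le>\<^sub>0" using w(2) by (auto elim!: nonpos_Ints_cases')
    then show ?thesis by (simp add: rGamma_eq_zero_iff)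
  qed
  have "(\<lambda>n. rGamma_series p n * rGamma_series q n / rGamma_series w n * (of_nat n / of_nat (Suc n)))
      \<longlonglongrightarrow> rGamma p * rGamma q / rGamma w * 1"
    using w0 by (intro tendsto_intros LIMSEQ_n_over_Suc_n)
  moreover have "eventually (\<lambda>n. rGamma_series p n * rGamma_series q n / rGamma_series w n * (of_nat n / of_nat (Suc n))
      = binomial_coeff p (Suc n) * binomial_coeff q (Suc n) / binomial_coeff w (Suc n)) sequentially"
    using eventually_gt_at_top[of 0]
  proof eventually_elim
    case (elim n)
    have e: "exp (p * of_real (ln (real n))) * exp (q * of_real (ln (real n))) = exp (w * of_real (ln (real n))) * of_nat n"
    proof -
      have "exp (p * of_real (ln (real n))) * exp (q * of_real (ln (real n)))
          = exp (w * of_real (ln (real n)) + of_real (ln (real n)))"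
        by (simp add: exp_add[symmetric] w(1) algebra_simps)
      also have "\<dots> = exp (w * of_real (ln (real n))) * exp (of_real (ln (real n)))" by (rule exp_add)
      also have "exp (complex_of_real (ln (real n))) = of_nat n"
        using elim by (simp add: exp_of_real)
      finally show ?thesis .
    qed
    have "binomial_coeff p (Suc n) * binomial_coeff q (Suc n) / binomial_coeff w (Suc n)
      = rGamma_series p n * rGamma_series q n / rGamma_series w n *
        ((exp (p * of_real (ln (real n))) * exp (q * of_real (ln (real n)))) / exp (w * of_real (ln (real n)))
          / of_nat (Suc n))"
      using elim by (simp add: binomial_coeff_rGamma divide_simps del: of_nat_Suc)
    also have "\<dots> = rGamma_series p n * rGamma_series q n / rGamma_series w n * (of_nat n / of_nat (Suc n))"
      by (simp add: e del: of_nat_Suc)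
    finally show ?case by simp
  qed
  ultimately have "(\<lambda>n. binomial_coeff p (Suc n) * binomial_coeff q (Suc n) / binomial_coeff w (Suc n))
      \<longlonglongrightarrow> rGamma p * rGamma q / rGamma w"
    by (simp add: tendsto_cong)
  then show ?thesis by (rule LIMSEQ_imp_Suc)
qed

lemma norm_binomial_coeff_le:
  fixes w :: complex
  assumes "Re w > 0"
  obtains K where "K > 0" "\<And>n. cmod (binomial_coeff w n) \<le> K * (pochhammer (Re w) n / fact n)"
proof -
  have pos: "pochhammer (Re w) n > 0" for n using assms by (simp add: pochhammer_pos)
  have rG: "rGamma (Re w) \<noteq> 0"
  proof -
    have "Re w \<notin> \<int>\<^sub>\<le>\<^sub>0" using assms by (auto elim!: nonpos_Ints_cases')
    then show ?thesis by (simp add: rGamma_eq_zero_iff)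
  qed
  have "(\<lambda>n. cmod (rGamma_series w n) / rGamma_series (Re w) n) \<longlonglongrightarrow> cmod (rGamma w) / rGamma (Re w)"
    using rG by (intro tendsto_intros)
  moreover have "eventually (\<lambda>n. cmod (rGamma_series w n) / rGamma_series (Re w) n
      = cmod (binomial_coeff w (Suc n)) / (pochhammer (Re w) (Suc n) / fact (Suc n))) sequentially"
    using eventually_gt_at_top[of 0]
  proof eventually_elim
    case (elim n)
    have "cmod (exp (w * of_real (ln (real n)))) = exp (Re w * ln (real n))" by simp
    then show ?case
      using pos[of "Suc n"]
      by (simp add: rGamma_series_def binomial_coeff_def norm_divide norm_mult divide_simps del: pochhammer_Suc fact_Suc)
  qed
  ultimately have "(\<lambda>n. cmod (binomial_coeff w (Suc n)) / (pochhammer (Re w) (Suc n) / fact (Suc n)))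
      \<longlonglongrightarrow> cmod (rGamma w) / rGamma (Re w)"
    by (rule Lim_transform_eventually)
  then have "(\<lambda>n. cmod (binomial_coeff w n) / (pochhammer (Re w) n / fact n)) \<longlonglongrightarrow> cmod (rGamma w) / rGamma (Re w)"
    by (rule LIMSEQ_imp_Suc)
  then have "Bseq (\<lambda>n. cmod (binomial_coeff w n) / (pochhammer (Re w) n / fact n))"
    using convergent_imp_Bseq convergentI by blast
  then obtain K where K: "K > 0" "\<And>n. norm (cmod (binomial_coeff w n) / (pochhammer (Re w) n / fact n)) \<le> K"
    by (auto elim: BseqE)
  show thesis
  proof (rule that[OF K(1)])
    fix n
    have "cmod (binomial_coeff w n) / (pochhammer (Re w) n / fact n) \<le> K" using K(2)[of n] pos[of n] by simp
    then show "cmod (binomial_coeff w n) \<le> K * (pochhammer (Re w) n / fact n)"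
      using pos[of n] by (simp add: pos_divide_le_eq pos_le_divide_eq)
  qed
qed

text \<open>An Abelian theorem: the leading part of the coefficients sums exactly by the binomial series, and
  coefficients that are small against it contribute \<open>\<epsilon> (1 - x) powr (- Re w)\<close> up to finitely many
  terms, which are negligible as \<open>Re w > 0\<close>.\<close>

lemma abel_limit:
  fixes p q w :: complex
  assumes w: "w = p + q - 1" "Re w > 0"
  shows "((\<lambda>x. of_real (1 - x) powr w * (\<Sum>n. binomial_coeff p n * binomial_coeff q n * of_real x ^ n))
     \<longlongrightarrow> rGamma p * rGamma q / rGamma w) (at_left (1::real))"
proof -
  define L where "L = rGamma p * rGamma q / rGamma w"
  define d where "d n = binomial_coeff p n * binomial_coeff q n - L * binomial_coeff w n" for n
  obtain K where K: "K > 0" "\<And>n. cmod (binomial_coeff w n) \<le> K * (pochhammer (Re w) n / fact n)"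
    using norm_binomial_coeff_le[OF w(2)] by blast
  have bw: "binomial_coeff w n \<noteq> 0" for n
  proof -
    have "w \<noteq> - of_nat k" for k using w(2) by auto
    then show ?thesis by (auto simp: binomial_coeff_def pochhammer_eq_0_iff)
  qed
  have pos: "pochhammer (Re w) n > 0" for n using w(2) by (simp add: pochhammer_pos)
  have bin_real: "(\<lambda>n. pochhammer (Re w) n / fact n * x ^ n) sums ((1 - x) powr (- Re w))"
    if "\<bar>x\<bar> < 1" for x
  proof -
    have "(\<lambda>k. binomial_coeff (of_real (Re w)) k * of_real x ^ k) sums ((1 - of_real x) powr (- of_real (Re w)))"
      using that by (intro binomial_series) simp
    also have "(\<lambda>k. binomial_coeff (of_real (Re w)) k * of_real x ^ k)
        = (\<lambda>k. of_real (pochhammer (Re w) k / fact k * x ^ k))"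
      by (simp add: binomial_coeff_def pochhammer_of_real)
    also have "(1 - complex_of_real x) powr (- of_real (Re w)) = of_real ((1 - x) powr (- Re w))"
      using that powr_of_real[of "1 - x" "- Re w"] by simp
    finally show ?thesis by (simp only: sums_of_real_iff)
  qed
  have sdpq: "summable (\<lambda>n. cmod (binomial_coeff p n * binomial_coeff q n * of_real x ^ n))"
    if "0 < x" "x < 1" for x
  proof -
    have sq: "cmod (of_real (sqrt x)) < 1" using that by simp
    have "summable (\<lambda>n. cmod (binomial_coeff p n * of_real (sqrt x) ^ n) * cmod (binomial_coeff q n * of_real (sqrt x) ^ n))"
    proof (rule summable_comparison_test_ev)
      have "(\<lambda>n. cmod (binomial_coeff q n * of_real (sqrt x) ^ n)) \<longlonglongrightarrow> 0"
        by (rule summable_LIMSEQ_zero[OF summable_norm_binomial[OF sq]])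
      then have "eventually (\<lambda>n. cmod (binomial_coeff q n * of_real (sqrt x) ^ n) < 1) sequentially"
        by (rule order_tendstoD) simp
      then show "eventually (\<lambda>n. norm (cmod (binomial_coeff p n * of_real (sqrt x) ^ n) * cmod (binomial_coeff q n * of_real (sqrt x) ^ n))
          \<le> cmod (binomial_coeff p n * of_real (sqrt x) ^ n)) sequentially"
      proof eventually_elim
        case (elim n)
        show ?case
          using mult_left_mono[OF less_imp_le[OF elim], of "cmod (binomial_coeff p n * of_real (sqrt x) ^ n)"]
          by simp
      qed
    qed (rule summable_norm_binomial[OF sq])
    moreover have "cmod (binomial_coeff p n * of_real (sqrt x) ^ n) * cmod (binomial_coeff q n * of_real (sqrt x) ^ n)
        = cmod (binomial_coeff p n * binomial_coeff q n * of_real x ^ n)" for n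
    proof -
      have "sqrt x ^ n * sqrt x ^ n = x ^ n" using that by (simp add: power_mult_distrib[symmetric])
      then show ?thesis using that by (simp add: norm_mult norm_power mult.assoc mult.left_commute)
    qed
    ultimately show ?thesis by simp
  qed
  have sd: "summable (\<lambda>n. cmod (d n) * x ^ n)" if "0 < x" "x < 1" for x
  proof (rule summable_comparison_test')
    show "summable (\<lambda>n. cmod (binomial_coeff p n * binomial_coeff q n * of_real x ^ n)
        + cmod L * cmod (binomial_coeff w n * of_real x ^ n))"
      using that by (intro summable_add summable_mult sdpq summable_norm_binomial) auto
    show "norm (cmod (d n) * x ^ n) \<le> cmod (binomial_coeff p n * binomial_coeff q n * of_real x ^ n)
        + cmod L * cmod (binomial_coeff w n * of_real x ^ n)" for n
    proof -
      have "cmod (d n) \<le> cmod (binomial_coeff p n * binomial_coeff q n) + cmod L * cmod (binomial_coeff w n)"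
        unfolding d_def by (metis norm_mult norm_triangle_ineq4)
      from mult_right_mono[OF this, of "x ^ n"] show ?thesis
        using that by (simp add: norm_mult norm_power distrib_right mult.assoc)
    qed
  qed
  have split: "of_real (1 - x) powr w * (\<Sum>n. binomial_coeff p n * binomial_coeff q n * of_real x ^ n)
      = L + of_real (1 - x) powr w * (\<Sum>n. d n * of_real x ^ n)" if x: "0 < x" "x < 1" for x
  proof -
    have h1: "(\<Sum>n. d n * of_real x ^ n) = (\<Sum>n. binomial_coeff p n * binomial_coeff q n * of_real x ^ n)
        - L * (\<Sum>n. binomial_coeff w n * of_real x ^ n)"
    proof -
      have "(\<lambda>n. d n * of_real x ^ n) = (\<lambda>n. binomial_coeff p n * binomial_coeff q n * of_real x ^ n
          - L * (binomial_coeff w n * of_real x ^ n))" by (simp add: d_def algebra_simps)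
      moreover have "summable (\<lambda>n. binomial_coeff p n * binomial_coeff q n * of_real x ^ n)"
        by (rule summable_norm_cancel[OF sdpq[OF x]])
      moreover have "summable (\<lambda>n. binomial_coeff w n * of_real x ^ n)"
        by (rule summable_norm_cancel[OF summable_norm_binomial]) (use x in simp)
      ultimately show ?thesis by (simp add: suminf_diff[symmetric] suminf_mult)
    qed
    have h2: "(\<Sum>n. binomial_coeff w n * of_real x ^ n) = (1 - of_real x) powr (- w)"
      using binomial_series[of "of_real x" w] x by (simp add: sums_iff)
    have h3: "of_real (1 - x) powr w * (1 - complex_of_real x) powr (- w) = 1"
      using x powr_add[of "1 - complex_of_real x" w "- w"] by (simp add: powr_minus)
    have alg: "A * T = L + A * D" if "A * B = 1" "D = T - L * B" for A B D T :: complex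
      using that by (simp add: right_diff_distrib mult.left_commute[of A L])
    show ?thesis by (rule alg[OF h3]) (simp only: h1 h2)
  qed
  have "((\<lambda>x. of_real (1 - x) powr w * (\<Sum>n. d n * of_real x ^ n)) \<longlongrightarrow> 0) (at_left (1::real))"
  proof (rule tendstoI)
    fix e :: real assume e: "e > 0"
    have "(\<lambda>n. binomial_coeff p n * binomial_coeff q n / binomial_coeff w n - L) \<longlonglongrightarrow> L - L"
      using tendsto_diff[OF binomial_coeff_product_asymptotics[OF w] tendsto_const] unfolding L_def .
    then have "eventually (\<lambda>n. cmod (binomial_coeff p n * binomial_coeff q n / binomial_coeff w n - L) < e / (2 * K)) sequentially"
      using tendstoD[of _ "0::complex" sequentially "e / (2 * K)"] e K by (simp add: dist_norm)
    then obtain N where N: "\<And>n. n \<ge> N \<Longrightarrow> cmod (binomial_coeff p n * binomial_coeff q n / binomial_coeff w n - L) < e / (2 * K)"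
      by (auto simp: eventually_sequentially)
    have dn: "cmod (d n) \<le> e / 2 * (pochhammer (Re w) n / fact n)" if "n \<ge> N" for n
    proof -
      have "d n = (binomial_coeff p n * binomial_coeff q n / binomial_coeff w n - L) * binomial_coeff w n"
        using bw[of n] by (simp add: d_def field_simps)
      then have "cmod (d n) = cmod (binomial_coeff p n * binomial_coeff q n / binomial_coeff w n - L)
          * cmod (binomial_coeff w n)" by (simp only: norm_mult)
      also have "\<dots> \<le> e / (2 * K) * (K * (pochhammer (Re w) n / fact n))"
        using e K(1) by (intro mult_mono less_imp_le[OF N[OF that]] K(2)) auto
      also have "\<dots> = e / 2 * (pochhammer (Re w) n / fact n)"
        using K(1) by simp
      finally show ?thesis .
    qed
    define S where "S = (\<Sum>n<N. cmod (d n))"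
    have bound: "cmod (of_real (1 - x) powr w * (\<Sum>n. d n * of_real x ^ n)) \<le> (1 - x) powr Re w * S + e / 2"
      if x: "0 < x" "x < 1" for x
    proof -
      have "cmod (\<Sum>n. d n * of_real x ^ n) \<le> (\<Sum>n. cmod (d n) * x ^ n)"
        using summable_norm[of "\<lambda>n. d n * of_real x ^ n"] sd[OF x] x by (simp add: norm_mult norm_power)
      also have "\<dots> = (\<Sum>n. cmod (d (n + N)) * x ^ (n + N)) + (\<Sum>n<N. cmod (d n) * x ^ n)"
        by (rule suminf_split_initial_segment[OF sd[OF x]])
      also have "(\<Sum>n<N. cmod (d n) * x ^ n) \<le> S"
        unfolding S_def using x by (intro sum_mono) (auto simp: mult_left_le power_le_one)
      also have "(\<Sum>n. cmod (d (n + N)) * x ^ (n + N)) \<le> (\<Sum>n. e / 2 * (pochhammer (Re w) (n + N) / fact (n + N) * x ^ (n + N)))"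
      proof (rule suminf_le)
        show "summable (\<lambda>n. cmod (d (n + N)) * x ^ (n + N))"
          using sd[OF x] summable_iff_shift[of "\<lambda>n. cmod (d n) * x ^ n" N] by simp
        show "summable (\<lambda>n. e / 2 * (pochhammer (Re w) (n + N) / fact (n + N) * x ^ (n + N)))"
          using bin_real[of x] x summable_iff_shift[of "\<lambda>n. pochhammer (Re w) n / fact n * x ^ n" N]
          by (intro summable_mult) (auto simp: sums_iff)
        show "cmod (d (n + N)) * x ^ (n + N) \<le> e / 2 * (pochhammer (Re w) (n + N) / fact (n + N) * x ^ (n + N))" for n
          using mult_right_mono[OF dn[of "n + N"], of "x ^ (n + N)"] x by (simp add: mult.assoc)
      qed
      also have "\<dots> = e / 2 * (\<Sum>n. pochhammer (Re w) (n + N) / fact (n + N) * x ^ (n + N))"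
        using bin_real[of x] x summable_iff_shift[of "\<lambda>n. pochhammer (Re w) n / fact n * x ^ n" N]
        by (intro suminf_mult) (auto simp: sums_iff)
      also have "(\<Sum>n. pochhammer (Re w) (n + N) / fact (n + N) * x ^ (n + N)) \<le> (1 - x) powr (- Re w)"
      proof -
        have s: "summable (\<lambda>n. pochhammer (Re w) n / fact n * x ^ n)" 
          "(\<Sum>n. pochhammer (Re w) n / fact n * x ^ n) = (1 - x) powr (- Re w)"
          using bin_real[of x] x by (auto simp: sums_iff)
        have "0 \<le> (\<Sum>n<N. pochhammer (Re w) n / fact n * x ^ n)"
          using x less_imp_le[OF pos] by (intro sum_nonneg) auto
        then show ?thesis using suminf_split_initial_segment[OF s(1), of N] s(2) by simp
      qed
      finally have "cmod (\<Sum>n. d n * of_real x ^ n) \<le> e / 2 * (1 - x) powr (- Re w) + S"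
        using e by simp
      then have "(1 - x) powr Re w * cmod (\<Sum>n. d n * of_real x ^ n)
          \<le> (1 - x) powr Re w * (e / 2 * (1 - x) powr (- Re w) + S)"
        by (intro mult_left_mono) auto
      also have "\<dots> = (1 - x) powr Re w * S + e / 2"
        using x by (simp add: algebra_simps powr_minus)
      finally show ?thesis
        using x norm_powr_real_powr[of "of_real (1 - x)" w] by (simp add: norm_mult)
    qed
    have "((\<lambda>x. (1 - x) powr Re w * S + e / 2) \<longlongrightarrow> (1 - 1) powr Re w * S + e / 2) (at_left (1::real))"
      using w(2) eventually_at_left_real[of 0 "1::real", OF zero_less_one]
      by (intro tendsto_intros tendsto_powr2) (auto elim: eventually_mono)
    then have "((\<lambda>x. (1 - x) powr Re w * S + e / 2) \<longlongrightarrow> e / 2) (at_left (1::real))"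
      using w(2) by simp
    then have "eventually (\<lambda>x. (1 - x) powr Re w * S + e / 2 < e) (at_left (1::real))"
      by (rule order_tendstoD) (use e in simp)
    moreover have "eventually (\<lambda>x. x \<in> {0<..<1}) (at_left (1::real))"
      by (rule eventually_at_left_real) simp
    ultimately show "eventually (\<lambda>x. dist (of_real (1 - x) powr w * (\<Sum>n. d n * of_real x ^ n)) 0 < e) (at_left 1)"
    proof eventually_elim
      case (elim x)
      then show ?case using bound[of x] by simp
    qed
  qed
  then have "((\<lambda>x. L + of_real (1 - x) powr w * (\<Sum>n. d n * of_real x ^ n)) \<longlongrightarrow> L + 0) (at_left (1::real))"
    by (intro tendsto_intros)
  moreover have "eventually (\<lambda>x::real. L + of_real (1 - x) powr w * (\<Sum>n. d n * of_real x ^ n)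
      = of_real (1 - x) powr w * (\<Sum>n. binomial_coeff p n * binomial_coeff q n * of_real x ^ n)) (at_left 1)"
    using eventually_at_left_real[of 0 "1::real", OF zero_less_one]
    by eventually_elim (simp only: split greaterThanLessThan_iff)
  ultimately show ?thesis
    unfolding L_def[symmetric] using Lim_transform_eventually[of _ "L + 0"] by simp
qed

lemma circle_integral_sums:
  fixes f :: "nat \<Rightarrow> real \<Rightarrow> complex"
  assumes m: "\<And>i. f i \<in> borel_measurable borel" and le: "\<And>i s. cmod (f i s) \<le> c i" and c: "summable c"
  shows "(\<lambda>i. LINT s:{0..2 * pi}|lborel. f i s) sums (LINT s:{0..2 * pi}|lborel. (\<Sum>i. f i s))"
proof -
  let ?g = "\<lambda>i s. indicator {0..2 * pi} s *\<^sub>R f i s"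
  have c0: "0 \<le> c i" for i using le[of i 0] norm_ge_zero order_trans by blast
  have int: "integrable lborel (\<lambda>s. indicator {0..2 * pi} s *\<^sub>R c i)" for i
    by (intro integrable_scaleR_left integrable_real_indicator) auto
  have gi: "integrable lborel (?g i)" for i
  proof (rule Bochner_Integration.integrable_bound[OF int[of i]])
    show "AE s in lborel. norm (?g i s) \<le> norm (indicator {0..2 * pi} s *\<^sub>R c i)"
      using le c0 by (auto simp: indicator_def)
  qed (use m in measurable)
  have "(\<lambda>i. LINT s|lborel. ?g i s) sums (LINT s|lborel. (\<Sum>i. ?g i s))"
  proof (rule sums_integral[OF gi])
    show "AE s in lborel. summable (\<lambda>i. norm (?g i s))"
    proof (intro AE_I2)
      fix s
      show "summable (\<lambda>i. norm (?g i s))"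
        by (rule summable_comparison_test'[OF c, of 0]) (use le c0 in \<open>auto simp: indicator_def\<close>)
    qed
    show "summable (\<lambda>i. LINT s|lborel. norm (?g i s))"
    proof (rule summable_comparison_test'[OF summable_mult[OF c, of "2 * pi"], of 0])
      fix i
      have "(LINT s|lborel. norm (?g i s)) \<le> (LINT s|lborel. indicator {0..2 * pi} s *\<^sub>R c i)"
        using le by (intro integral_mono integrable_norm gi int) (auto simp: indicator_def)
      also have "\<dots> = 2 * pi * c i" by simp
      finally show "norm (LINT s|lborel. norm (?g i s)) \<le> 2 * pi * c i" by simp
    qed
  qed
  moreover have "(\<Sum>i. ?g i s) = indicator {0..2 * pi} s *\<^sub>R (\<Sum>i. f i s)" for s
    by (auto simp: indicator_def)
  ultimately show ?thesis by (simp add: set_lebesgue_integral_def)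
qed

lemma circle_integral_cis:
  "(LINT s:{0..2 * pi}|lborel. cis (of_int m * s)) = (if m = 0 then 2 * pi else 0)"
proof (cases "m = 0")
  case True
  then show ?thesis by (simp add: set_lebesgue_integral_def scaleR_conv_of_real)
next
  case False
  let ?F = "\<lambda>s. cis (of_int m * s) / (\<i> * of_int m)"
  have "(LINT s|lborel. indicator {0..2 * pi} s *\<^sub>R cis (of_int m * s)) = ?F (2 * pi) - ?F 0"
  proof (rule integral_FTC_Icc)
    fix s :: real
    show "(?F has_vector_derivative cis (of_int m * s)) (at s within {0..2 * pi})"
    proof -
      have "((\<lambda>z. exp (\<i> * of_int m * z) / (\<i> * of_int m)) has_field_derivative exp (\<i> * of_int m * of_real s))
          (at (of_real s))"
        using False by (auto intro!: derivative_eq_intros)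
      from has_vector_derivative_real_field[OF this, of "{0..2 * pi}"] show ?thesis
        by (simp add: cis_conv_exp mult.assoc)
    qed
  qed (auto intro!: continuous_intros simp: cis_conv_exp)
  also have "cis (of_int m * (2 * pi)) = 1"
    using cis_multiple_2pi[of "of_int m"] by (simp add: mult.commute mult.left_commute)
  then have "?F (2 * pi) - ?F 0 = 0" by simp
  finally show ?thesis using False by (simp add: set_lebesgue_integral_def)
qed

text \<open>The two factors are binomial series in \<open>z cis (- s)\<close> and in its conjugate, so by orthogonality only
  the products of coefficients with equal index survive.\<close>

lemma circle_integral_kernel:
  fixes p q z :: complex
  assumes z: "cmod z < 1"
  shows "(LINT s:{0..2 * pi}|lborel. (1 - z * cnj (cis s)) powr (- p) * (1 - cnj z * cis s) powr (- q))
    = 2 * pi * (\<Sum>k. binomial_coeff p k * binomial_coeff q k * of_real ((cmod z)\<^sup>2) ^ k)"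
proof -
  define P where "P j s = binomial_coeff p j * (z * cnj (cis s)) ^ j" for j s
  define Q where "Q k s = binomial_coeff q k * (cnj z * cis s) ^ k" for k s
  define G where "G s = (\<Sum>k. Q k s)" for s
  have cz: "cmod (cnj z) < 1" using z by simp
  have nP: "cmod (P j s) = cmod (binomial_coeff p j * z ^ j)" for j s
    by (simp add: P_def norm_mult norm_power)
  have nQ: "cmod (Q k s) = cmod (binomial_coeff q k * cnj z ^ k)" for k s
    by (simp add: Q_def norm_mult norm_power)
  have sP: "summable (\<lambda>j. cmod (binomial_coeff p j * z ^ j))" by (rule summable_norm_binomial[OF z])
  have sQ: "summable (\<lambda>k. cmod (binomial_coeff q k * cnj z ^ k))" by (rule summable_norm_binomial[OF cz])
  have mcis [measurable]: "cis \<in> borel_measurable borel"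
    by (intro borel_measurable_continuous_onI) (auto intro!: continuous_intros simp: cis_conv_exp[abs_def])
  have mcnj: "(\<lambda>s. cnj (cis s)) \<in> borel_measurable borel"
    by (intro borel_measurable_continuous_onI) (auto intro!: continuous_intros simp: cis_conv_exp[abs_def])
  have mP [measurable]: "P j \<in> borel_measurable borel" for j unfolding P_def using mcnj by measurable
  have mQ [measurable]: "Q k \<in> borel_measurable borel" for k unfolding Q_def by measurable
  have mG [measurable]: "G \<in> borel_measurable borel" unfolding G_def by measurable
  have Gs: "(\<lambda>k. Q k s) sums G s" for s
    unfolding G_def using sQ nQ by (intro summable_sums summable_norm_cancel[of "\<lambda>k. Q k s"]) simp
  have G_eq: "G s = (1 - cnj z * cis s) powr (- q)" for s
    using binomial_series[of "cnj z * cis s" q] Gs[of s] z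
    by (simp add: Q_def norm_mult sums_iff)
  have P_sums: "(\<lambda>j. P j s) sums ((1 - z * cnj (cis s)) powr (- p))" for s
    unfolding P_def using z by (intro binomial_series) (simp add: norm_mult)
  have PQ: "P j s * Q k s = (binomial_coeff p j * z ^ j * binomial_coeff q k * cnj z ^ k) * cis (of_int (int k - int j) * s)" for j k s
  proof -
    have "cnj (cis s) ^ j * cis s ^ k = cis (of_int (int k - int j) * s)"
    proof -
      have "cnj (cis s) ^ j * cis s ^ k = cis (real j * (- s)) * cis (real k * s)"
        by (simp only: cis_cnj Complex.DeMoivre)
      also have "\<dots> = cis (real j * (- s) + real k * s)" by (rule cis_mult)
      also have "real j * (- s) + real k * s = of_int (int k - int j) * s" by (simp add: algebra_simps)
      finally show ?thesis .
    qed
    then show ?thesis by (simp add: P_def Q_def power_mult_distrib ac_simps)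
  qed
  have inner: "(LINT s:{0..2 * pi}|lborel. P j s * G s)
      = 2 * pi * (binomial_coeff p j * binomial_coeff q j * of_real ((cmod z)\<^sup>2) ^ j)" for j
  proof -
    let ?c = "\<lambda>k. binomial_coeff p j * z ^ j * binomial_coeff q k * cnj z ^ k"
    have 1: "(\<lambda>k. LINT s:{0..2 * pi}|lborel. P j s * Q k s) sums (LINT s:{0..2 * pi}|lborel. (\<Sum>k. P j s * Q k s))"
      by (rule circle_integral_sums[where c="\<lambda>k. cmod (binomial_coeff p j * z ^ j) * cmod (binomial_coeff q k * cnj z ^ k)"])
        (use sQ in \<open>auto simp: norm_mult[of "P _ _"] nP nQ intro!: summable_mult\<close>)
    have 2: "(\<Sum>k. P j s * Q k s) = P j s * G s" for s
      using sums_mult[OF Gs[of s], of "P j s"] by (simp add: sums_iff)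
    have 3: "(LINT s:{0..2 * pi}|lborel. P j s * Q k s) = (if k = j then 2 * pi * ?c j else 0)" for k
      unfolding PQ using circle_integral_cis[of "int k - int j"]
      by (subst set_integral_mult_right) auto
    have "(\<lambda>k. LINT s:{0..2 * pi}|lborel. P j s * Q k s) sums (2 * pi * ?c j)"
      unfolding 3 by (rule sums_single)
    then have "(LINT s:{0..2 * pi}|lborel. P j s * G s) = 2 * pi * ?c j"
      using 1 unfolding 2 by (rule sums_unique2[symmetric])
    moreover have "z ^ j * cnj z ^ j = of_real ((cmod z)\<^sup>2) ^ j"
      by (simp only: power_mult_distrib[symmetric] complex_norm_square)
    ultimately show ?thesis by (simp add: ac_simps)
  qed
  have "(\<lambda>j. LINT s:{0..2 * pi}|lborel. P j s * G s) sums (LINT s:{0..2 * pi}|lborel. (\<Sum>j. P j s * G s))"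
  proof (rule circle_integral_sums[where c="\<lambda>j. cmod (binomial_coeff p j * z ^ j) * (\<Sum>k. cmod (binomial_coeff q k * cnj z ^ k))"])
    show "cmod (P j s * G s) \<le> cmod (binomial_coeff p j * z ^ j) * (\<Sum>k. cmod (binomial_coeff q k * cnj z ^ k))" for j s
    proof -
      have "cmod (G s) \<le> (\<Sum>k. cmod (Q k s))"
        unfolding G_def using sQ nQ by (intro summable_norm) simp
      then show ?thesis
        unfolding norm_mult[of "P j s"] nP nQ by (intro mult_left_mono) auto
    qed
  qed (use sP in \<open>auto intro: summable_mult2\<close>)
  moreover have "(\<Sum>j. P j s * G s) = (1 - z * cnj (cis s)) powr (- p) * G s" for s
    using sums_mult2[OF P_sums[of s], of "G s"] by (simp add: sums_iff)
  ultimately have *: "(\<lambda>j. 2 * pi * (binomial_coeff p j * binomial_coeff q j * of_real ((cmod z)\<^sup>2) ^ j))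
      sums (LINT s:{0..2 * pi}|lborel. (1 - z * cnj (cis s)) powr (- p) * (1 - cnj z * cis s) powr (- q))"
    by (simp only: inner) (simp only: G_eq)
  have "summable (\<lambda>j. binomial_coeff p j * binomial_coeff q j * complex_of_real ((cmod z)\<^sup>2) ^ j)"
    using sums_summable[OF *] by (rule summable_mult_D) simp
  from suminf_mult[OF this, of "2 * pi"] show ?thesis
    using sums_unique[OF *] by simp
qed

section \<open>Size and mass of the kernel\<close>

definition poisson_factor :: "complex \<Rightarrow> complex \<Rightarrow> complex \<Rightarrow> complex \<Rightarrow> complex" where
  "poisson_factor a b z \<zeta> = poisson_const a b *
     (complex_of_real (1 - (cmod z)\<^sup>2) powr (a + b + 1) /
       ((1 - z * cnj \<zeta>) powr (a + 1) * (1 - cnj z * \<zeta>) powr (b + 1)))"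

lemma poisson_kernel_prod:
  "poisson_kernel \<alpha> \<beta> z \<zeta> = (\<Prod>j\<in>UNIV. poisson_factor (\<alpha> $ j) (\<beta> $ j) (z $ j) (\<zeta> $ j))"
  by (simp add: poisson_kernel_def poisson_factor_def)

lemma Re_one_minus_pos:
  assumes "cmod z < 1" "cmod \<zeta> = 1"
  shows "0 < Re (1 - z * cnj \<zeta>)" "0 < Re (1 - cnj z * \<zeta>)"
proof -
  have "Re (z * cnj \<zeta>) < 1" "Re (cnj z * \<zeta>) < 1"
    using assms complex_Re_le_cmod[of "z * cnj \<zeta>"] complex_Re_le_cmod[of "cnj z * \<zeta>"]
    by (simp_all add: norm_mult)
  then show "0 < Re (1 - z * cnj \<zeta>)" "0 < Re (1 - cnj z * \<zeta>)" by simp_all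
qed

lemma continuous_on_poisson_factor:
  assumes z: "cmod z < 1" and g: "continuous_on S g" "\<And>x. x \<in> S \<Longrightarrow> cmod (g x) = 1"
  shows "continuous_on S (\<lambda>x. poisson_factor a b z (g x))"
proof -
  have n1: "1 - z * cnj (g x) \<noteq> 0" "1 - cnj z * g x \<noteq> 0" if "x \<in> S" for x
    using Re_one_minus_pos[OF z g(2)[OF that]] by (auto dest: arg_cong[where f=Re])
  have "continuous_on S (\<lambda>x. (1 - z * cnj (g x)) powr (a + 1))"
    using n1 Re_one_minus_pos[OF z g(2)] g(1)
    by (intro continuous_on_powr_complex continuous_intros) (auto simp: less_imp_le)
  moreover have "continuous_on S (\<lambda>x. (1 - cnj z * g x) powr (b + 1))"
    using n1 Re_one_minus_pos[OF z g(2)] g(1)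
    by (intro continuous_on_powr_complex continuous_intros) (auto simp: less_imp_le)
  ultimately show ?thesis
    unfolding poisson_factor_def using n1
    by (intro continuous_on_mult continuous_on_divide continuous_on_const) (simp_all add: powr_def)
qed

lemma continuous_on_poisson_kernel:
  assumes "\<And>j. cmod (z $ j) < 1"
  shows "continuous_on torus (poisson_kernel \<alpha> \<beta> z)"
  unfolding poisson_kernel_prod[abs_def]
  by (intro continuous_on_prod continuous_on_poisson_factor assms continuous_intros) (simp add: torus_def)

lemma compact_torus: "compact (torus :: (complex ^ 'n) set)"
proof (rule compact_eq_bounded_closed[THEN iffD2], rule conjI)
  show "bounded (torus :: (complex ^ 'n) set)"
    unfolding bounded_iff
  proof (intro exI ballI)
    fix x :: "complex ^ 'n" assume x: "x \<in> torus"
    have "norm x \<le> (\<Sum>i\<in>UNIV. cmod (x $ i))"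
      unfolding norm_vec_def by (rule L2_set_le_sum) simp
    also have "\<dots> = real CARD('n)" using x by (simp add: torus_def)
    finally show "norm x \<le> real CARD('n)" .
  qed
  show "closed (torus :: (complex ^ 'n) set)"
    unfolding torus_def by (intro closed_Collect_all closed_Collect_eq continuous_intros)
qed

lemma sets_torus: "torus \<in> sets (borel :: (complex ^ 'n) measure)"
  by (intro borel_closed compact_imp_closed compact_torus)

lemma borel_measurable_poisson_kernel:
  assumes "\<And>j. cmod (z $ j) < 1"
  shows "poisson_kernel \<alpha> \<beta> z \<in> borel_measurable torus_borel"
  unfolding torus_borel_def
  by (intro borel_measurable_continuous_on_restrict continuous_on_poisson_kernel assms)

lemma poisson_kernel_bounded:
  fixes z :: "complex ^ 'n"
  assumes "\<And>j. cmod (z $ j) < 1"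
  obtains B where "\<And>\<zeta>. \<zeta> \<in> torus \<Longrightarrow> cmod (poisson_kernel \<alpha> \<beta> z \<zeta>) \<le> B"
proof -
  have "compact (poisson_kernel \<alpha> \<beta> z ` torus)"
    by (intro compact_continuous_image compact_torus continuous_on_poisson_kernel assms)
  then show thesis
    using that compact_imp_bounded bounded_iff by (metis imageI)
qed

lemma poisson_factor_circle_integral:
  assumes z: "cmod z < 1"
  shows "(LINT s:{0..2 * pi}|lborel. poisson_factor a b z (cis s)) / (2 * pi)
    = poisson_const a b * (of_real (1 - (cmod z)\<^sup>2) powr (a + b + 1) *
      (\<Sum>n. binomial_coeff (a + 1) n * binomial_coeff (b + 1) n * of_real ((cmod z)\<^sup>2) ^ n))"
proof -
  have "poisson_factor a b z (cis s) = poisson_const a b * of_real (1 - (cmod z)\<^sup>2) powr (a + b + 1) *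
      ((1 - z * cnj (cis s)) powr (- (a + 1)) * (1 - cnj z * cis s) powr (- (b + 1)))" for s
    unfolding poisson_factor_def powr_minus by (simp add: divide_inverse)
  then have "(LINT s:{0..2 * pi}|lborel. poisson_factor a b z (cis s)) = poisson_const a b * of_real (1 - (cmod z)\<^sup>2) powr (a + b + 1) *
      (LINT s:{0..2 * pi}|lborel. (1 - z * cnj (cis s)) powr (- (a + 1)) * (1 - cnj z * cis s) powr (- (b + 1)))"
    unfolding set_lebesgue_integral_def
    by (simp only: mult_scaleR_right[symmetric] integral_mult_right_zero)
  then show ?thesis unfolding circle_integral_kernel[OF z] by simp
qed

lemma poisson_kernel_haar_integral:
  fixes z :: "complex ^ 'n"
  assumes z: "\<And>j. cmod (z $ j) < 1"
  shows "(LINT \<zeta>|torus_haar. poisson_kernel \<alpha> \<beta> z \<zeta>)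
    = (\<Prod>j\<in>UNIV. poisson_const (\<alpha> $ j) (\<beta> $ j) * (of_real (1 - (cmod (z $ j))\<^sup>2) powr (\<alpha> $ j + \<beta> $ j + 1) *
      (\<Sum>n. binomial_coeff (\<alpha> $ j + 1) n * binomial_coeff (\<beta> $ j + 1) n * of_real ((cmod (z $ j))\<^sup>2) ^ n)))"
proof -
  have "(LINT \<zeta>|torus_haar. poisson_kernel \<alpha> \<beta> z \<zeta>)
      = (\<Prod>j\<in>UNIV. (LINT s:{0..2 * pi}|lborel. poisson_factor (\<alpha> $ j) (\<beta> $ j) (z $ j) (cis s)) / (2 * pi))"
    unfolding poisson_kernel_prod
  proof (rule torus_haar_integral_prod)
    show "(\<lambda>\<zeta>. \<Prod>j\<in>UNIV. poisson_factor (\<alpha> $ j) (\<beta> $ j) (z $ j) (\<zeta> $ j)) \<in> borel_measurable torus_borel"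
      using borel_measurable_poisson_kernel[OF z] unfolding poisson_kernel_prod[abs_def] .
    have c: "continuous_on {0..2 * pi} (\<lambda>s. poisson_factor (\<alpha> $ j) (\<beta> $ j) (z $ j) (cis s))" for j
      by (intro continuous_on_poisson_factor z) (auto intro!: continuous_intros simp: cis_conv_exp)
    show "set_integrable lborel {0..2 * pi} (\<lambda>s. poisson_factor (\<alpha> $ j) (\<beta> $ j) (z $ j) (cis s))" for j
      unfolding set_integrable_def by (rule borel_integrable_compact[OF compact_Icc c])
  qed
  then show ?thesis by (simp only: poisson_factor_circle_integral[OF z])
qed

text \<open>The constant of the kernel is chosen to make its mass tend to \<open>1\<close>; the mass itself is not
  constant.\<close>

lemma kernel_mass_limit:
  assumes "Re a + Re b > -1" "\<And>k::nat. k \<ge> 1 \<Longrightarrow> a \<noteq> - of_nat k \<and> b \<noteq> - of_nat k"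
  shows "((\<lambda>x. poisson_const a b * (of_real (1 - x) powr (a + b + 1) *
      (\<Sum>n. binomial_coeff (a + 1) n * binomial_coeff (b + 1) n * of_real x ^ n))) \<longlongrightarrow> 1) (at_left (1::real))"
proof -
  have "((\<lambda>x. of_real (1 - x) powr (a + b + 1) * (\<Sum>n. binomial_coeff (a + 1) n * binomial_coeff (b + 1) n * of_real x ^ n))
     \<longlongrightarrow> rGamma (a + 1) * rGamma (b + 1) / rGamma (a + b + 1)) (at_left (1::real))"
    using assms(1) by (intro abel_limit) auto
  then have "((\<lambda>x. poisson_const a b * (of_real (1 - x) powr (a + b + 1) * (\<Sum>n. binomial_coeff (a + 1) n * binomial_coeff (b + 1) n * of_real x ^ n)))
     \<longlongrightarrow> poisson_const a b * (rGamma (a + 1) * rGamma (b + 1) / rGamma (a + b + 1))) (at_left (1::real))"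
    by (intro tendsto_intros)
  moreover have nz: "c + 1 \<notin> \<int>\<^sub>\<le>\<^sub>0" if "\<And>k::nat. k \<ge> 1 \<Longrightarrow> c \<noteq> - of_nat k" for c :: complex
  proof
    assume "c + 1 \<in> \<int>\<^sub>\<le>\<^sub>0"
    then obtain k :: nat where "c + 1 = - of_nat k" by (elim nonpos_Ints_cases')
    then have "c = - of_nat k - 1" by (metis add_diff_cancel_right')
    then have "c = - of_nat (Suc k)" by simp
    then show False using that[of "Suc k"] by simp
  qed
  have "a + b + 1 \<notin> \<int>\<^sub>\<le>\<^sub>0" using assms(1) by (auto elim!: nonpos_Ints_cases' dest!: arg_cong[where f=Re])
  then have "poisson_const a b * (rGamma (a + 1) * rGamma (b + 1) / rGamma (a + b + 1)) = 1"
    using nz[of a] nz[of b] assms(2)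
    by (simp add: poisson_const_def Gamma_def rGamma_eq_zero_iff field_simps)
  ultimately show ?thesis by simp
qed

text \<open>The two bases in the denominator are conjugate to each other.  Their arguments are bounded, so the
  imaginary parts of the exponents cost only a constant factor.\<close>

lemma norm_poisson_factor_le:
  fixes a b z \<zeta> :: complex
  assumes z: "cmod z < 1" and \<zeta>: "cmod \<zeta> = 1"
  defines "s \<equiv> Re a + Re b + 1"
  shows "cmod (poisson_factor a b z \<zeta>) \<le> cmod (poisson_const a b) * exp (pi * (\<bar>Im a\<bar> + \<bar>Im b\<bar>)) *
    ((1 - (cmod z)\<^sup>2) powr s / cmod (\<zeta> - z) powr (s + 1))"
proof -
  define w where "w = 1 - z * cnj \<zeta>"
  have cw: "1 - cnj z * \<zeta> = cnj w" by (simp add: w_def)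
  have w0: "w \<noteq> 0" using Re_one_minus_pos[OF z \<zeta>] by (auto simp: w_def dest: arg_cong[where f=Re])
  have nw: "cmod w = cmod (\<zeta> - z)"
  proof -
    have "\<zeta> * cnj \<zeta> = 1" using \<zeta> by (simp add: complex_norm_square[symmetric])
    then have "w = (\<zeta> - z) * cnj \<zeta>" by (simp add: w_def algebra_simps)
    then show ?thesis using \<zeta> by (simp add: norm_mult)
  qed
  have low: "cmod v powr Re c * exp (- (pi * \<bar>Im c\<bar>)) \<le> cmod (v powr c)" for v c :: complex
  proof -
    have "Im c * Arg v \<le> \<bar>Im c\<bar> * \<bar>Arg v\<bar>" by (metis abs_ge_self abs_mult)
    also have "\<dots> \<le> \<bar>Im c\<bar> * pi"
      using mpi_less_Arg[of v] Arg_le_pi[of v] by (intro mult_left_mono) (auto simp: abs_le_iff)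
    finally show ?thesis unfolding norm_powr_complex by (intro mult_left_mono) (auto simp: mult.commute)
  qed
  have "cmod w powr (s + 1) * exp (- (pi * (\<bar>Im a\<bar> + \<bar>Im b\<bar>)))
      = (cmod w powr Re (a + 1) * exp (- (pi * \<bar>Im (a + 1)\<bar>))) * (cmod (cnj w) powr Re (b + 1) * exp (- (pi * \<bar>Im (b + 1)\<bar>)))"
    using w0 by (simp add: s_def powr_add[symmetric] exp_add[symmetric] algebra_simps)
  also have "\<dots> \<le> cmod (w powr (a + 1)) * cmod (cnj w powr (b + 1))"
    by (intro mult_mono low) auto
  finally have den: "cmod w powr (s + 1) * exp (- (pi * (\<bar>Im a\<bar> + \<bar>Im b\<bar>))) \<le> cmod (w powr (a + 1)) * cmod (cnj w powr (b + 1))" .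
  have "(cmod z)\<^sup>2 < 1" using z by (simp add: power_less_one_iff abs_square_less_1)
  then have num: "cmod (complex_of_real (1 - (cmod z)\<^sup>2) powr (a + b + 1)) = (1 - (cmod z)\<^sup>2) powr s"
    by (subst norm_powr_real_powr) (auto simp: s_def)
  have "cmod (poisson_factor a b z \<zeta>) = cmod (poisson_const a b) * ((1 - (cmod z)\<^sup>2) powr s / (cmod (w powr (a + 1)) * cmod (cnj w powr (b + 1))))"
    unfolding poisson_factor_def cw w_def[symmetric] by (simp only: norm_mult norm_divide num)
  also have "\<dots> \<le> cmod (poisson_const a b) * ((1 - (cmod z)\<^sup>2) powr s / (cmod w powr (s + 1) * exp (- (pi * (\<bar>Im a\<bar> + \<bar>Im b\<bar>)))))"
    using w0 by (intro mult_left_mono divide_left_mono den mult_pos_pos) auto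
  also have "\<dots> = cmod (poisson_const a b) * exp (pi * (\<bar>Im a\<bar> + \<bar>Im b\<bar>)) *
    ((1 - (cmod z)\<^sup>2) powr s / cmod (\<zeta> - z) powr (s + 1))"
    unfolding nw by (simp only: exp_minus divide_inverse inverse_mult_distrib inverse_inverse_eq ac_simps)
  finally show ?thesis .
qed

text \<open>In the Stolz region \<open>|\<zeta> - z|\<close> is comparable to the larger one of \<open>h\<close> and \<open>|\<zeta> - \<eta>|\<close>, where \<open>h\<close> is
  comparable to the distance of \<open>z\<close> to the circle.  Taking for \<open>2 ^ k h\<close> the dyadic size of \<open>|\<zeta> - \<eta>|\<close> gives
  the mean value factor \<open>1 / (2 ^ k h)\<close> and the decay \<open>2 powr (- t k)\<close> on top of it.  The exponent \<open>t\<close> may be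
  lowered so that it can be chosen equal for all coordinates.\<close>

lemma poisson_factor_dyadic_bound:
  fixes a b :: complex and A B t :: real
  assumes t: "0 < t" "t \<le> Re a + Re b + 1" and A: "0 \<le> A" and B: "1 \<le> B"
  obtains K where "K > 0"
    "\<And>z \<eta> \<zeta> h. \<lbrakk>cmod \<zeta> = 1; h > 0; h / B \<le> 1 - cmod z; 1 - cmod z \<le> B * h;
        cmod (z - \<eta>) \<le> (1 + A) * (1 - cmod z)\<rbrakk> \<Longrightarrow>
      \<exists>k. cmod (\<zeta> - \<eta>) \<le> 2 ^ k * h \<and> cmod (poisson_factor a b z \<zeta>) \<le> K * ((2 powr (- t)) ^ k / (2 ^ k * h))"
proof -
  define s where "s = Re a + Re b + 1"
  define M where "M = cmod (poisson_const a b) * exp (pi * (\<bar>Im a\<bar> + \<bar>Im b\<bar>))"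
  \<comment> \<open>\<open>B\<close> serves the case \<open>k = 0\<close>, where \<open>D \<ge> h / B\<close>; \<open>4 + 2 A\<close> serves \<open>k > 0\<close>, where \<open>2 ^ (k - 1) h < |\<zeta> - \<eta>| \<le> (2 + A) D\<close>.\<close>
  define R where "R = B + 4 + 2 * A"
  define K where "K = (M + 1) * 2 powr s * B powr t * R powr (t + 1)"
  have M0: "0 \<le> M" by (simp add: M_def)
  have R0: "R > 0" using A B by (simp add: R_def)
  have s: "t \<le> s" "0 < s" using t by (auto simp: s_def)
  show thesis
  proof (rule that)
    show "K > 0" using M0 B R0 by (simp add: K_def add_nonneg_pos)
    fix z \<eta> \<zeta> :: complex and h :: real
    assume \<zeta>: "cmod \<zeta> = 1" and h: "h > 0" and y: "h / B \<le> 1 - cmod z" "1 - cmod z \<le> B * h"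
      and z\<eta>: "cmod (z - \<eta>) \<le> (1 + A) * (1 - cmod z)"
    define y where "y = 1 - cmod z"
    define D where "D = cmod (\<zeta> - z)"
    have y0: "y > 0" using y(1) h B by (simp add: y_def) (smt (verit) divide_pos_pos)
    have yD: "y \<le> D" using norm_triangle_ineq2[of \<zeta> z] \<zeta> by (simp add: y_def D_def)
    have D0: "D > 0" using y0 yD by simp
    have "cmod (\<zeta> - \<eta>) \<le> D + cmod (z - \<eta>)"
      using norm_triangle_ineq[of "\<zeta> - z" "z - \<eta>"] by (simp add: D_def)
    also have "\<dots> \<le> D + (1 + A) * D"
      using z\<eta> yD A by (intro add_left_mono order_trans[OF z\<eta>] mult_left_mono) (auto simp: y_def)
    finally have \<zeta>\<eta>: "cmod (\<zeta> - \<eta>) \<le> (2 + A) * D" by (simp add: algebra_simps)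
    define k where "k = (LEAST k. cmod (\<zeta> - \<eta>) \<le> 2 ^ k * h)"
    have "\<exists>k. cmod (\<zeta> - \<eta>) \<le> 2 ^ k * h"
    proof -
      obtain k where "cmod (\<zeta> - \<eta>) / h < 2 ^ k" using real_arch_pow[of 2 "cmod (\<zeta> - \<eta>) / h"] by auto
      then show ?thesis using h by (intro exI[of _ k]) (simp add: divide_less_eq)
    qed
    then have k: "cmod (\<zeta> - \<eta>) \<le> 2 ^ k * h" unfolding k_def by (rule LeastI_ex)
    have Dk: "2 ^ k * h / R \<le> D"
    proof (cases k)
      case 0
      have "h / R \<le> h / B" using h B A by (intro divide_left_mono) (auto simp: R_def)
      then show ?thesis using 0 y(1) yD by (simp add: y_def)
    next
      case (Suc i)
      then have "\<not> cmod (\<zeta> - \<eta>) \<le> 2 ^ i * h" unfolding k_def by (metis lessI not_less_Least)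
      then have "2 * (2 ^ i * h) \<le> 2 * ((2 + A) * D)" using \<zeta>\<eta> by linarith
      then have "2 ^ k * h \<le> (4 + 2 * A) * D" using Suc by (simp add: algebra_simps)
      also have "\<dots> \<le> R * D" using B D0 by (intro mult_right_mono) (auto simp: R_def)
      finally show ?thesis using R0 by (simp add: divide_le_eq mult.commute)
    qed
    have z1: "cmod z < 1" using y0 by (simp add: y_def)
    have "1 - (cmod z)\<^sup>2 = (1 + cmod z) * y" by (simp add: y_def power2_eq_square algebra_simps)
    also have "\<dots> \<le> 2 * y" using z1 y0 by (intro mult_right_mono) auto
    finally have y2: "1 - (cmod z)\<^sup>2 \<le> 2 * y" .
    have "(cmod z)\<^sup>2 \<le> 1" using z1 by (simp add: power_le_one)
    then have "(1 - (cmod z)\<^sup>2) powr s \<le> (2 * y) powr s" using y2 s by (intro powr_mono2) auto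
    also have "\<dots> = 2 powr s * y powr s" using y0 by (simp add: powr_mult)
    finally have ys: "(1 - (cmod z)\<^sup>2) powr s \<le> 2 powr s * y powr s" .
    have "y powr s / D powr (s + 1) = (y / D) powr s / D"
      using y0 D0 by (simp add: powr_divide powr_add)
    also have "\<dots> \<le> (y / D) powr t / D"
      using y0 D0 yD s by (intro divide_right_mono powr_mono') auto
    also have "\<dots> = y powr t / D powr (t + 1)"
      using y0 D0 by (simp add: powr_divide powr_add)
    also have "\<dots> \<le> (B * h) powr t / (2 ^ k * h / R) powr (t + 1)"
      using y(2) y0 D0 Dk R0 h t by (intro frac_le powr_mono2) (auto simp: y_def)
    also have "\<dots> = B powr t * R powr (t + 1) * (h powr t / (2 ^ k * h) powr (t + 1))"
      using B h R0 by (simp add: powr_mult powr_divide)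
    also have "h powr t / (2 ^ k * h) powr (t + 1) = (2 powr (- t)) ^ k / (2 ^ k * h)"
    proof -
      have "(2 powr (- t)) ^ k = (2 ^ k) powr (- t)"
        by (simp add: powr_realpow[symmetric] powr_powr mult.commute)
      then show ?thesis
        using h by (simp add: powr_mult powr_add powr_minus field_simps)
    qed
    finally have main: "y powr s / D powr (s + 1) \<le> B powr t * R powr (t + 1) * ((2 powr (- t)) ^ k / (2 ^ k * h))" .
    have "cmod (poisson_factor a b z \<zeta>) \<le> M * ((1 - (cmod z)\<^sup>2) powr s / D powr (s + 1))"
      using norm_poisson_factor_le[OF z1 \<zeta>, of a b] by (simp add: M_def s_def D_def)
    also have "\<dots> \<le> (M + 1) * (2 powr s * y powr s / D powr (s + 1))"
      using ys M0 by (intro mult_mono divide_right_mono) auto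
    also have "\<dots> = (M + 1) * 2 powr s * (y powr s / D powr (s + 1))" by simp
    also have "\<dots> \<le> (M + 1) * 2 powr s * (B powr t * R powr (t + 1) * ((2 powr (- t)) ^ k / (2 ^ k * h)))"
      using main M0 by (intro mult_left_mono) auto
    also have "\<dots> = K * ((2 powr (- t)) ^ k / (2 ^ k * h))" by (simp add: K_def)
    finally show "\<exists>k. cmod (\<zeta> - \<eta>) \<le> 2 ^ k * h \<and> cmod (poisson_factor a b z \<zeta>) \<le> K * ((2 powr (- t)) ^ k / (2 ^ k * h))"
      using k by blast
  qed
qed

section \<open>Dyadic boxes of fixed shape\<close>

lemma summable_prod_geometric:
  fixes q :: real
  assumes "0 < q" "q < 1"
  shows "(\<integral>\<^sup>+k. ennreal (\<Prod>j\<in>(UNIV::'n::finite set). q ^ k j) \<partial>count_space UNIV) < \<infinity>"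
proof -
  have g: "(\<lambda>i. norm (q ^ i)) summable_on (UNIV :: nat set)"
    using assms by (intro norm_summable_imp_summable_on) (simp add: norm_power summable_geometric)
  \<comment> \<open>A family that is not summable has the infinite sum \<open>0\<close>; so a positive value proves summability.\<close>
  have s1: "infsum (\<lambda>i. q ^ i) (UNIV :: nat set) > 0" 
  proof -
    have "infsum (\<lambda>i. q ^ i) {0::nat} \<le> infsum (\<lambda>i. q ^ i) (UNIV :: nat set)"
      using g assms by (intro infsum_mono_neutral) (auto intro: abs_summable_summable)
    then show ?thesis by simp
  qed
  let ?w = "\<lambda>k. \<Prod>j\<in>(UNIV::'n set). q ^ k j"
  have "infsum ?w (PiE UNIV (\<lambda>_. UNIV)) = (\<Prod>j\<in>(UNIV::'n set). infsum (\<lambda>i. q ^ i) (UNIV :: nat set))"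
    using infsum_prod_PiE_abs[of "UNIV::'n set" "\<lambda>_ i. q ^ i" "\<lambda>_. UNIV"] g by simp
  moreover have "PiE UNIV (\<lambda>_. UNIV) = (UNIV :: ('n \<Rightarrow> nat) set)" by auto
  ultimately have "infsum ?w UNIV > 0" using s1 by (simp add: prod_pos)
  then have "?w summable_on UNIV" using infsum_not_exists[of ?w UNIV] by linarith
  then have "(\<lambda>k. norm (?w k)) summable_on UNIV" by (subst summable_on_iff_abs_summable_on_real[symmetric])
  then have "integrable (count_space UNIV) ?w"
    using abs_summable_equivalent[of ?w UNIV] by (simp add: Infinite_Set_Sum.abs_summable_on_def)
  then show ?thesis
    using assms by (subst nn_integral_eq_integral) (auto intro!: AE_I2 prod_nonneg)
qed

definition scale :: "('n \<Rightarrow> nat) \<Rightarrow> complex ^ 'n \<Rightarrow> complex ^ 'n" where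
  "scale k x = (\<chi> j. x $ j /\<^sub>R 2 ^ k j)"

definition box_volume :: "('n::finite \<Rightarrow> nat) \<Rightarrow> real \<Rightarrow> real" where
  "box_volume k h = (\<Prod>j\<in>UNIV. 2 ^ k j * h)"

text \<open>Measures on the torus are moved to the ambient space, where regularity and Vitali's covering lemma
  are available.\<close>

definition torus_ext :: "(complex ^ 'n) measure \<Rightarrow> (complex ^ 'n) measure" where
  "torus_ext N = distr N borel (\<lambda>x. x)"

lemma box_volume_eq: "box_volume k h = (\<Prod>j\<in>UNIV. 2 ^ k j) * h ^ CARD('n)" for k :: "'n::finite \<Rightarrow> nat"
  by (simp add: box_volume_def prod.distrib)

lemma box_volume_pos: "h > 0 \<Longrightarrow> box_volume k h > 0"
  by (simp add: box_volume_def prod_pos)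

lemma torus_inclusion_measurable: "(\<lambda>x. x) \<in> torus_borel \<rightarrow>\<^sub>M borel"
  unfolding torus_borel_def by (intro measurable_restrict_space1) simp

lemma scale_nth: "scale k x $ j = x $ j /\<^sub>R 2 ^ k j"
  by (simp add: scale_def)

lemma continuous_scale: "continuous_on UNIV (scale k)"
  unfolding scale_def by (intro continuous_intros)

lemma norm_scale_diff_nth: "cmod ((scale k y - scale k x) $ j) = cmod (y $ j - x $ j) / 2 ^ k j"
  by (simp add: scale_nth divide_inverse mult.commute flip: scaleR_right_diff_distrib)

lemma phi_ball_scale_component:
  assumes "y \<in> phi_ball (scale k) x h"
  shows "cmod (y $ j - x $ j) \<le> 2 ^ k j * h"
proof -
  have "cmod ((scale k y - scale k x) $ j) \<le> h"
    by (rule order_trans[OF Finite_Cartesian_Product.norm_nth_le])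
      (use assms in \<open>simp add: phi_ball_def dist_norm norm_minus_commute\<close>)
  then show ?thesis unfolding norm_scale_diff_nth by (simp add: divide_le_eq mult.commute)
qed

lemma box_subset_phi_ball_scale:
  fixes x y :: "complex ^ 'n"
  assumes "\<And>j. cmod (y $ j - x $ j) \<le> 2 ^ k j * h"
  shows "y \<in> phi_ball (scale k) x (real CARD('n) * h)"
proof -
  have "norm (scale k y - scale k x) \<le> (\<Sum>j\<in>UNIV. cmod ((scale k y - scale k x) $ j))"
    unfolding norm_vec_def by (rule L2_set_le_sum) simp
  also have "\<dots> \<le> (\<Sum>j\<in>(UNIV :: 'n set). h)"
  proof (rule sum_mono)
    fix j
    show "cmod ((scale k y - scale k x) $ j) \<le> h"
      unfolding norm_scale_diff_nth using assms[of j] by (simp add: divide_le_eq mult.commute)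
  qed
  finally show ?thesis by (simp add: phi_ball_def dist_norm norm_minus_commute)
qed

text \<open>The preimages of balls under \<open>scale k\<close> are ellipsoids with axes proportional to \<open>2 ^ k j\<close>.  The factor
  \<open>30 = 6 * 5\<close> combines the bound for the Haar measure of boxes with Vitali's enlargement and is the same
  for all shapes.\<close>

lemma ball_differentiation_scale:
  fixes k :: "'n::finite \<Rightarrow> nat"
  shows "ball_differentiation (scale k) (box_volume k) (torus_ext torus_haar) (30 ^ CARD('n))"
proof (rule ball_differentiation.intro)
  show "continuous_on UNIV (scale k)" by (rule continuous_scale)
  show "inj (scale k)" by (auto simp: inj_def vec_eq_iff scale_nth)
  show "finite_measure (torus_ext torus_haar :: (complex ^ 'n) measure)"
    unfolding torus_ext_def
    using prob_space_torus_haar torus_inclusion_measurable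
    by (intro finite_measure.finite_measure_distr prob_space.finite_measure) (simp_all cong: measurable_cong_sets)
  show "sets (torus_ext torus_haar :: (complex ^ 'n) measure) = sets borel" by (simp add: torus_ext_def)
  show "0 < box_volume k h" if "0 < h" for h using that by (rule box_volume_pos)
  show "continuous_on {0<..} (box_volume k)"
    unfolding box_volume_eq[abs_def] by (intro continuous_intros)
  show "filterlim (box_volume k) at_top at_top"
  proof -
    have "filterlim (\<lambda>h::real. h ^ CARD('n)) at_top at_top"
      by (intro filterlim_pow_at_top filterlim_ident) simp
    then show ?thesis
      unfolding box_volume_eq[abs_def]
      by (intro filterlim_tendsto_pos_mult_at_top[OF tendsto_const]) (auto intro: prod_pos)
  qed
  show "(0::real) < 30 ^ CARD('n)" by simp
  fix x :: "complex ^ 'n" and h :: real assume h: "0 < h"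
  interpret prob_space "torus_haar :: (complex ^ 'n) measure" by (rule prob_space_torus_haar)
  let ?B = "phi_ball (scale k) x (5 * h)"
  let ?R = "{\<zeta>::complex ^ 'n. \<forall>j. cmod (\<zeta> $ j - x $ j) \<le> 2 ^ k j * (5 * h)}"
  have "closed ?R" by (intro closed_Collect_all closed_Collect_le continuous_intros)
  then have R: "torus \<inter> ?R \<in> sets torus_haar"
    using sets_torus by (auto simp: torus_borel_def sets_restrict_space intro: borel_closed)
  have "measure (torus_ext torus_haar) ?B = measure torus_haar (?B \<inter> torus)"
    unfolding torus_ext_def
    using sets_phi_ball[OF continuous_scale] torus_inclusion_measurable
    by (subst measure_distr) (simp_all cong: measurable_cong_sets)
  also have "\<dots> \<le> measure torus_haar (torus \<inter> ?R)"
    using phi_ball_scale_component by (intro finite_measure_mono R) blast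
  also have "\<dots> \<le> (\<Prod>j\<in>UNIV. 6 * (2 ^ k j * (5 * h)))"
    by (rule haar_box_le) (use h in simp)
  also have "\<dots> = (\<Prod>j\<in>(UNIV :: 'n set). 30 * (2 ^ k j * h))" by (intro prod.cong) auto
  also have "\<dots> = 30 ^ CARD('n) * box_volume k h"
    unfolding box_volume_def by (subst prod.distrib) simp
  finally show "measure (torus_ext torus_haar) ?B \<le> 30 ^ CARD('n) * box_volume k h" .
qed

definition shape_weight :: "real \<Rightarrow> ('n::finite \<Rightarrow> nat) \<Rightarrow> real" where
  "shape_weight q k = (\<Prod>j\<in>UNIV. q ^ k j)"

text \<open>The weak type bounds for the different shapes have the same constant, so they can be summed
  against the geometric weights: outside a set of measure \<open>O(1/N)\<close> all maximal functions are bounded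
  at once by \<open>N\<close> over the weight.\<close>

lemma maximal_bound_all_shapes:
  fixes \<nu> :: "(complex ^ 'n) measure"
  assumes \<nu>: "finite_measure \<nu>" "sets \<nu> = sets borel" and q: "0 < q" "q < 1"
  shows "AE x in (torus_ext torus_haar). \<exists>L>0. \<forall>k. \<forall>h>0.
    measure \<nu> (phi_ball (scale k) x h) \<le> L / shape_weight q k * box_volume k h"
proof -
  have wpos: "shape_weight q k > 0" for k :: "'n \<Rightarrow> nat" using q by (simp add: shape_weight_def prod_pos)
  define S where "S = (\<integral>\<^sup>+k. ennreal (shape_weight q k) \<partial>count_space (UNIV :: ('n \<Rightarrow> nat) set))"
  have S: "S < \<infinity>" unfolding S_def shape_weight_def by (rule summable_prod_geometric[OF q])
  define U where "U N = (\<Union>k::'n \<Rightarrow> nat. maximal_exceeds (scale k) (box_volume k) \<nu> (real (Suc N) / shape_weight q k))" for N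
  define C where "C = 30 ^ CARD('n) * measure \<nu> UNIV"
  have C0: "0 \<le> C" by (simp add: C_def)
  have op: "open (maximal_exceeds (scale k) (box_volume k) \<nu> c)" for k :: "'n \<Rightarrow> nat" and c
    by (rule ball_differentiation.open_maximal_exceeds[OF ball_differentiation_scale \<nu>])
  have Us: "U N \<in> sets borel" for N unfolding U_def by (intro borel_open open_UN ballI op)
  have mU: "emeasure (torus_ext torus_haar) (U N) \<le> ennreal (C / real (Suc N)) * S" for N
  proof -
    have "emeasure (torus_ext torus_haar) (U N) \<le> (\<integral>\<^sup>+k. emeasure (torus_ext torus_haar)
        (maximal_exceeds (scale k) (box_volume k) \<nu> (real (Suc N) / shape_weight q k)) \<partial>count_space UNIV)"
      unfolding U_def by (rule emeasure_UN_le_count_space) (auto simp: torus_ext_def intro: borel_open op)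
    also have "\<dots> \<le> (\<integral>\<^sup>+k. ennreal (C / real (Suc N)) * ennreal (shape_weight q k) \<partial>count_space (UNIV :: ('n \<Rightarrow> nat) set))"
    proof (intro nn_integral_mono)
      fix k :: "'n \<Rightarrow> nat"
      have "emeasure (torus_ext torus_haar) (maximal_exceeds (scale k) (box_volume k) \<nu> (real (Suc N) / shape_weight q k))
          \<le> ennreal (30 ^ CARD('n) * measure \<nu> UNIV / (real (Suc N) / shape_weight q k))"
        by (rule ball_differentiation.weak_type_bound[OF ball_differentiation_scale \<nu>]) (use wpos in simp)
      also have "30 ^ CARD('n) * measure \<nu> UNIV / (real (Suc N) / shape_weight q k) = C / real (Suc N) * shape_weight q k"
        by (simp add: C_def)
      finally show "emeasure (torus_ext torus_haar) (maximal_exceeds (scale k) (box_volume k) \<nu> (real (Suc N) / shape_weight q k))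
          \<le> ennreal (C / real (Suc N)) * ennreal (shape_weight q k)"
        using C0 wpos[of k] by (simp add: ennreal_mult[symmetric] less_imp_le)
    qed
    also have "\<dots> = ennreal (C / real (Suc N)) * S" unfolding S_def by (rule nn_integral_cmult) simp
    finally show ?thesis .
  qed
  have "emeasure (torus_ext torus_haar) (\<Inter>N. U N) = 0"
  proof -
    have "emeasure (torus_ext torus_haar) (\<Inter>N. U N) \<le> ennreal (C / real (Suc N)) * S" for N
      using Us by (intro order_trans[OF emeasure_mono mU]) (auto simp: torus_ext_def)
    moreover obtain r where r: "r \<ge> 0" "S = ennreal r" using S by (cases S) auto
    ultimately have "emeasure (torus_ext torus_haar) (\<Inter>N. U N) \<le> ennreal (C * r * (1 / real (Suc N)))" for N
      using C0 by (simp add: ennreal_mult[symmetric])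
    moreover have "(\<lambda>N. ennreal (C * r * (1 / real (Suc N)))) \<longlonglongrightarrow> ennreal (C * r * 0)"
      by (intro tendsto_ennrealI tendsto_mult tendsto_const LIMSEQ_Suc[OF lim_1_over_n])
    ultimately have "emeasure (torus_ext torus_haar) (\<Inter>N. U N) \<le> ennreal (C * r * 0)" by (intro LIMSEQ_le_const) auto
    then show ?thesis by simp
  qed
  then have "AE x in (torus_ext torus_haar). x \<notin> (\<Inter>N. U N)"
    using Us by (intro AE_not_in null_setsI) (auto simp: torus_ext_def)
  then show ?thesis
  proof (rule AE_mp, intro AE_I2 impI)
    fix x assume "x \<notin> (\<Inter>N. U N)"
    then obtain N where N: "x \<notin> U N" by blast
    have "measure \<nu> (phi_ball (scale k) x h) \<le> real (Suc N) / shape_weight q k * box_volume k h" if "h > 0" for k h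
      using N that unfolding U_def maximal_exceeds_def UN_iff mem_Collect_eq by (meson UNIV_I not_less)
    then show "\<exists>L>0. \<forall>k. \<forall>h>0. measure \<nu> (phi_ball (scale k) x h) \<le> L / shape_weight q k * box_volume k h"
      by (intro exI[of _ "real (Suc N)"]) auto
  qed
qed

section \<open>Convergence at points of vanishing density\<close>

lemma sets_torus_ext [simp]: "sets (torus_ext N) = sets borel"
  by (simp add: torus_ext_def)

lemma torus_inclusion_measurable':
  assumes "sets N = sets torus_borel"
  shows "(\<lambda>x. x) \<in> N \<rightarrow>\<^sub>M borel"
  using torus_inclusion_measurable measurable_cong_sets[OF assms refl] by blast

lemma emeasure_torus_ext:
  assumes "sets N = sets torus_borel" "B \<in> sets borel"
  shows "emeasure (torus_ext N) B = emeasure N (B \<inter> torus)"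
proof -
  have "space N = torus" using sets_eq_imp_space_eq[OF assms(1)] by simp
  then show ?thesis
    unfolding torus_ext_def using assms(2)
    by (subst emeasure_distr[OF torus_inclusion_measurable'[OF assms(1)]]) auto
qed

lemma finite_measure_torus_ext:
  assumes "finite_measure N" "sets N = sets torus_borel"
  shows "finite_measure (torus_ext N)"
  unfolding torus_ext_def
  by (rule finite_measure.finite_measure_distr[OF assms(1) torus_inclusion_measurable'[OF assms(2)]])

text \<open>Density zero for each shape separately, together with a domination that makes the sum over all
  shapes tend to zero as well.\<close>

definition vanishing_density :: "real \<Rightarrow> (complex ^ 'n::finite) measure \<Rightarrow> complex ^ 'n \<Rightarrow> bool" where
  "vanishing_density q \<nu> \<eta> \<longleftrightarrow>
     (\<forall>k. ((\<lambda>h. measure \<nu> (phi_ball (scale k) \<eta> h) / box_volume k h) \<longlongrightarrow> 0) (at_right 0)) \<and>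
     (\<exists>L>0. \<forall>k. \<forall>h>0. measure \<nu> (phi_ball (scale k) \<eta> h) \<le> L / shape_weight q k * box_volume k h)"

lemma stolz_props:
  assumes "z \<in> stolz A \<eta>"
  shows "cmod z < 1" "cmod \<eta> = 1" "cmod (z - \<eta>) \<le> (1 + A) * (1 - cmod z)"
proof -
  obtain r \<theta> \<phi> where z: "z = of_real r * cis (\<phi> - \<theta>)" "\<eta> = cis \<phi>" "0 \<le> r" "r < 1" "\<bar>\<theta>\<bar> \<le> A * (1 - r)"
    using assms by (auto simp: stolz_def)
  then have nz: "cmod z = r" by (simp add: norm_mult)
  show "cmod z < 1" "cmod \<eta> = 1" using z nz by auto
  have "z - \<eta> = of_real (r - 1) * cis (\<phi> - \<theta>) + (cis (\<phi> - \<theta>) - cis \<phi>)"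
    by (simp add: z algebra_simps)
  then have "cmod (z - \<eta>) \<le> cmod (of_real (r - 1) * cis (\<phi> - \<theta>)) + cmod (cis (\<phi> - \<theta>) - cis \<phi>)"
    using norm_triangle_ineq by metis
  also have "cmod (of_real (r - 1) * cis (\<phi> - \<theta>)) = 1 - r"
    using z(4) unfolding norm_mult norm_of_real norm_cis by simp
  also have "cmod (cis (\<phi> - \<theta>) - cis \<phi>) \<le> \<bar>\<theta>\<bar>"
    unfolding dist_cis using abs_sin_x_le_abs_x[of "- \<theta> / 2"] by simp
  finally show "cmod (z - \<eta>) \<le> (1 + A) * (1 - cmod z)"
    using z(5) by (simp add: nz algebra_simps)
qed

lemma restricted_stolz_props:
  fixes z \<eta> :: "complex ^ 'n"
  assumes "z \<in> restricted_stolz A B \<eta>"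
  shows "cmod (z $ j) < 1" "cmod (\<eta> $ j) = 1" "cmod (z $ j - \<eta> $ j) \<le> (1 + A) * (1 - cmod (z $ j))"
    "1 - cmod (z $ j) \<le> B * (1 - cmod (z $ k))"
proof -
  have st: "z $ j \<in> stolz A (\<eta> $ j)" for j using assms by (auto simp: restricted_stolz_def)
  show "cmod (z $ j) < 1" "cmod (\<eta> $ j) = 1" "cmod (z $ j - \<eta> $ j) \<le> (1 + A) * (1 - cmod (z $ j))"
    using stolz_props[OF st] by auto
  have "(case (j, k) of (j, k) \<Rightarrow> (1 - cmod (z $ j)) / (1 - cmod (z $ k)))
      \<le> (MAX (j, k)\<in>UNIV. (1 - cmod (z $ j)) / (1 - cmod (z $ k)))"
    by (rule Max_ge) auto
  also have "\<dots> \<le> B" using assms by (auto simp: restricted_stolz_def)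
  finally show "1 - cmod (z $ j) \<le> B * (1 - cmod (z $ k))"
    using stolz_props(1)[OF st, of k] by (simp add: divide_le_eq)
qed

text \<open>In the restricted region the coordinates are at comparable distances from the circle, so one
  \<open>h = 1 - |z $ i|\<close> serves all of them and the box around \<open>\<eta>\<close> is an \<open>h\<close>-dilate of one of the fixed shapes.\<close>

lemma poisson_kernel_dyadic_bound:
  fixes \<alpha> \<beta> :: "complex ^ 'n"
  assumes t: "0 < t" "\<And>j. t \<le> Re (\<alpha> $ j) + Re (\<beta> $ j) + 1" and A: "0 < A" and B: "1 \<le> B"
  obtains K where "K > 0"
    "\<And>z \<eta> \<zeta> i. z \<in> restricted_stolz A B \<eta> \<Longrightarrow> \<zeta> \<in> torus \<Longrightarrow>
      \<exists>k. \<zeta> \<in> phi_ball (scale k) \<eta> (real CARD('n) * (1 - cmod (z $ i))) \<and>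
        cmod (poisson_kernel \<alpha> \<beta> z \<zeta>) \<le> K * (shape_weight (2 powr (- t)) k / box_volume k (1 - cmod (z $ i)))"
proof -
  have "\<exists>K>0. \<forall>z \<eta> \<zeta> h. cmod \<zeta> = 1 \<longrightarrow> h > 0 \<longrightarrow> h / B \<le> 1 - cmod z \<longrightarrow> 1 - cmod z \<le> B * h \<longrightarrow>
        cmod (z - \<eta>) \<le> (1 + A) * (1 - cmod z) \<longrightarrow>
      (\<exists>k. cmod (\<zeta> - \<eta>) \<le> 2 ^ k * h \<and> cmod (poisson_factor (\<alpha> $ j) (\<beta> $ j) z \<zeta>) \<le> K * ((2 powr (- t)) ^ k / (2 ^ k * h)))" for j
    by (rule poisson_factor_dyadic_bound[OF t(1) t(2)[of j] less_imp_le[OF A] B]) blast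
  then obtain K where K: "\<And>j. K j > 0"
    "\<And>j z \<eta> \<zeta> h. \<lbrakk>cmod \<zeta> = 1; h > 0; h / B \<le> 1 - cmod z; 1 - cmod z \<le> B * h;
        cmod (z - \<eta>) \<le> (1 + A) * (1 - cmod z)\<rbrakk> \<Longrightarrow>
      \<exists>k. cmod (\<zeta> - \<eta>) \<le> 2 ^ k * h \<and> cmod (poisson_factor (\<alpha> $ j) (\<beta> $ j) z \<zeta>) \<le> K j * ((2 powr (- t)) ^ k / (2 ^ k * h))"
    by metis
  show thesis
  proof (rule that)
    show "(\<Prod>j\<in>UNIV. K j) > 0" using K(1) by (intro prod_pos) auto
    fix z \<eta> \<zeta> :: "complex ^ 'n" and i
    assume z: "z \<in> restricted_stolz A B \<eta>" and \<zeta>: "\<zeta> \<in> torus"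
    define h where "h = 1 - cmod (z $ i)"
    have h: "h > 0" using restricted_stolz_props(1)[OF z] by (simp add: h_def)
    have "\<exists>k. cmod (\<zeta> $ j - \<eta> $ j) \<le> 2 ^ k * h \<and>
        cmod (poisson_factor (\<alpha> $ j) (\<beta> $ j) (z $ j) (\<zeta> $ j)) \<le> K j * ((2 powr (- t)) ^ k / (2 ^ k * h))" for j
    proof (rule K(2)[OF _ h])
      show "cmod (\<zeta> $ j) = 1" using \<zeta> by (simp add: torus_def)
      show "h / B \<le> 1 - cmod (z $ j)"
        using restricted_stolz_props(4)[OF z, of i j] B by (simp add: h_def divide_le_eq mult.commute)
      show "1 - cmod (z $ j) \<le> B * h"
        using restricted_stolz_props(4)[OF z, of j i] by (simp add: h_def)
      show "cmod (z $ j - \<eta> $ j) \<le> (1 + A) * (1 - cmod (z $ j))"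
        by (rule restricted_stolz_props(3)[OF z])
    qed
    then obtain k where k: "\<And>j. cmod (\<zeta> $ j - \<eta> $ j) \<le> 2 ^ k j * h"
      "\<And>j. cmod (poisson_factor (\<alpha> $ j) (\<beta> $ j) (z $ j) (\<zeta> $ j)) \<le> K j * ((2 powr (- t)) ^ k j / (2 ^ k j * h))"
      by metis
    have "cmod (poisson_kernel \<alpha> \<beta> z \<zeta>) \<le> (\<Prod>j\<in>UNIV. K j * ((2 powr (- t)) ^ k j / (2 ^ k j * h)))"
      unfolding poisson_kernel_prod prod_norm[symmetric] by (intro prod_mono conjI k(2)) auto
    also have "\<dots> = (\<Prod>j\<in>UNIV. K j) * (shape_weight (2 powr (- t)) k / box_volume k h)"
      by (simp add: prod.distrib prod_dividef shape_weight_def box_volume_def)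
    finally show "\<exists>k. \<zeta> \<in> phi_ball (scale k) \<eta> (real CARD('n) * (1 - cmod (z $ i))) \<and>
        cmod (poisson_kernel \<alpha> \<beta> z \<zeta>) \<le> (\<Prod>j\<in>UNIV. K j) * (shape_weight (2 powr (- t)) k / box_volume k (1 - cmod (z $ i)))"
      using box_subset_phi_ball_scale[OF k(1)] unfolding h_def by blast
  qed
qed

text \<open>The integral is at most a sum over the shapes \<open>k\<close> of mean values over dilates of one shape, weighted by
  \<open>q ^ (2 |k|)\<close>.  The domination of the mean values costs one factor \<open>q ^ |k|\<close>, the other one makes the series
  converge, and dominated convergence applies.\<close>

lemma kernel_integral_tendsto_0:
  fixes \<alpha> \<beta> \<eta> :: "complex ^ 'n"
  assumes \<nu>: "finite_measure \<nu>" "sets \<nu> = sets torus_borel"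
    and t: "0 < t" "\<And>j. t \<le> Re (\<alpha> $ j) + Re (\<beta> $ j) + 1" and A: "0 < A" and B: "1 \<le> B"
    and vd: "vanishing_density (2 powr (- t / 2)) (torus_ext \<nu>) \<eta>"
  shows "((\<lambda>z. \<integral>\<^sup>+\<zeta>. ennreal (cmod (poisson_kernel \<alpha> \<beta> z \<zeta>)) \<partial>\<nu>) \<longlongrightarrow> 0)
    (at \<eta> within restricted_stolz A B \<eta>)"
  unfolding tendsto_at_iff_sequentially
proof (intro allI impI)
  define q :: real where "q = 2 powr (- t / 2)"
  have q: "0 < q" "q < 1" using t(1) powr_less_one[of 2 "- t / 2"] by (simp_all add: q_def)
  have qq: "2 powr (- t) = q * q" by (simp add: q_def powr_add[symmetric])
  have wpos: "shape_weight q k > 0" for k :: "'n \<Rightarrow> nat" using q by (simp add: shape_weight_def prod_pos)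
  have w2: "shape_weight (2 powr (- t)) k = shape_weight q k * shape_weight q k" for k :: "'n \<Rightarrow> nat"
    unfolding qq shape_weight_def by (simp add: power_mult_distrib prod.distrib)
  obtain K where K: "K > 0"
    "\<And>z \<eta> \<zeta> i. z \<in> restricted_stolz A B \<eta> \<Longrightarrow> \<zeta> \<in> torus \<Longrightarrow>
      \<exists>k. \<zeta> \<in> phi_ball (scale k) \<eta> (real CARD('n) * (1 - cmod (z $ i))) \<and>
        cmod (poisson_kernel \<alpha> \<beta> z \<zeta>) \<le> K * (shape_weight (2 powr (- t)) k / box_volume k (1 - cmod (z $ i)))"
    using poisson_kernel_dyadic_bound[OF t A B] by blast
  obtain L where L: "L > 0" "\<And>k h. h > 0 \<Longrightarrow>
      measure (torus_ext \<nu>) (phi_ball (scale k) \<eta> h) \<le> L / shape_weight q k * box_volume k h"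
    using vd unfolding vanishing_density_def q_def by blast
  have lim: "((\<lambda>h. measure (torus_ext \<nu>) (phi_ball (scale k) \<eta> h) / box_volume k h) \<longlongrightarrow> 0) (at_right 0)" for k
    using vd unfolding vanishing_density_def by blast
  interpret n: finite_measure \<nu> by (rule \<nu>(1))
  interpret e: finite_measure "torus_ext \<nu>" by (rule finite_measure_torus_ext[OF \<nu>])
  define N where "N = real CARD('n)"
  have N: "N > 0" by (simp add: N_def)
  define C where "C = K * N ^ CARD('n)"
  have C: "C > 0" using K(1) N by (simp add: C_def)
  have bvN: "box_volume k (N * h) = N ^ CARD('n) * box_volume k h" for k :: "'n \<Rightarrow> nat" and h
    by (simp add: box_volume_eq power_mult_distrib)
  fix X assume X: "\<forall>i. X i \<in> restricted_stolz A B \<eta> - {\<eta>}" "X \<longlonglongrightarrow> \<eta>"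
  have XS: "X i \<in> restricted_stolz A B \<eta>" for i using X(1) by blast
  define i0 :: 'n where "i0 = undefined"
  define h where "h i = 1 - cmod (X i $ i0)" for i
  have h: "h i > 0" for i using restricted_stolz_props(1)[OF XS] by (simp add: h_def)
  have "h \<longlonglongrightarrow> 1 - cmod (\<eta> $ i0)"
    unfolding h_def by (intro tendsto_intros X(2))
  then have "h \<longlonglongrightarrow> 0" using restricted_stolz_props(2)[OF XS[of 0], of i0] by simp
  then have "(\<lambda>i. N * h i) \<longlonglongrightarrow> 0" by (rule tendsto_mult_right_zero)
  then have hr: "filterlim (\<lambda>i. N * h i) (at_right 0) sequentially"
    using N h by (intro tendsto_imp_filterlim_at_right) auto
  define u where "u i k = ennreal (C * shape_weight (2 powr (- t)) k *
      (measure (torus_ext \<nu>) (phi_ball (scale k) \<eta> (N * h i)) / box_volume k (N * h i)))" for i k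
  have phb: "phi_ball (scale k) \<eta> r \<in> sets borel" for k r by (rule sets_phi_ball[OF continuous_scale])
  have le: "(\<integral>\<^sup>+\<zeta>. ennreal (cmod (poisson_kernel \<alpha> \<beta> (X i) \<zeta>)) \<partial>\<nu>) \<le> (\<integral>\<^sup>+k. u i k \<partial>count_space UNIV)" for i
  proof -
    let ?c = "\<lambda>k. ennreal (K * (shape_weight (2 powr (- t)) k / box_volume k (h i)))"
    let ?I = "\<lambda>k. phi_ball (scale k) \<eta> (N * h i) \<inter> torus"
    have spn: "space \<nu> = torus" using sets_eq_imp_space_eq[OF \<nu>(2)] by simp
    have Im: "?I k \<in> sets \<nu>" for k
      using phb[of k] by (auto simp: \<nu>(2) torus_borel_def sets_restrict_space)
    have "(\<integral>\<^sup>+\<zeta>. ennreal (cmod (poisson_kernel \<alpha> \<beta> (X i) \<zeta>)) \<partial>\<nu>)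
        \<le> (\<integral>\<^sup>+\<zeta>. \<integral>\<^sup>+k. ?c k * indicator (?I k) \<zeta> \<partial>count_space UNIV \<partial>\<nu>)"
    proof (rule nn_integral_mono)
      fix \<zeta> assume "\<zeta> \<in> space \<nu>"
      then have \<zeta>: "\<zeta> \<in> torus" by (simp add: spn)
      obtain k where k: "\<zeta> \<in> phi_ball (scale k) \<eta> (N * h i)"
        "cmod (poisson_kernel \<alpha> \<beta> (X i) \<zeta>) \<le> K * (shape_weight (2 powr (- t)) k / box_volume k (h i))"
        using K(2)[OF XS \<zeta>, of i i0] unfolding h_def N_def by blast
      have "ennreal (cmod (poisson_kernel \<alpha> \<beta> (X i) \<zeta>)) \<le> ?c k * indicator (?I k) \<zeta>"
        using k \<zeta> by (simp add: ennreal_leI)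
      also have "\<dots> \<le> (\<integral>\<^sup>+k. ?c k * indicator (?I k) \<zeta> \<partial>count_space UNIV)"
        by (rule nn_integral_ge_point) simp
      finally show "ennreal (cmod (poisson_kernel \<alpha> \<beta> (X i) \<zeta>)) \<le> (\<integral>\<^sup>+k. ?c k * indicator (?I k) \<zeta> \<partial>count_space UNIV)" .
    qed
    also have "\<dots> = (\<integral>\<^sup>+k. \<integral>\<^sup>+\<zeta>. ?c k * indicator (?I k) \<zeta> \<partial>\<nu> \<partial>count_space UNIV)"
      using Im by (intro nn_integral_count_space_nn_integral) auto
    also have "\<dots> = (\<integral>\<^sup>+k. u i k \<partial>count_space UNIV)"
    proof (intro nn_integral_cong)
      fix k :: "'n \<Rightarrow> nat"
      have "(\<integral>\<^sup>+\<zeta>. ?c k * indicator (?I k) \<zeta> \<partial>\<nu>) = ?c k * emeasure \<nu> (?I k)"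
        using Im by (rule nn_integral_cmult_indicator)
      also have "emeasure \<nu> (?I k) = ennreal (measure (torus_ext \<nu>) (phi_ball (scale k) \<eta> (N * h i)))"
        using emeasure_torus_ext[OF \<nu>(2) phb] by (simp add: e.emeasure_eq_measure[symmetric])
      also have "?c k * \<dots> = u i k"
        using K(1) wpos[of k] box_volume_pos[OF h[of i], of k] N
        by (simp add: u_def ennreal_mult[symmetric] w2 bvN C_def field_simps)
      finally show "(\<integral>\<^sup>+\<zeta>. ?c k * indicator (?I k) \<zeta> \<partial>\<nu>) = u i k" .
    qed
    finally show ?thesis .
  qed
  have "(\<lambda>i. \<integral>\<^sup>+k. u i k \<partial>count_space UNIV) \<longlonglongrightarrow> (\<integral>\<^sup>+k. 0 \<partial>count_space (UNIV :: ('n \<Rightarrow> nat) set))"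
  proof (rule nn_integral_dominated_convergence[where w="\<lambda>k. ennreal (C * L) * ennreal (shape_weight q k)"])
    show "AE k in count_space UNIV. u j k \<le> ennreal (C * L) * ennreal (shape_weight q k)" for j
    proof (intro AE_I2)
      fix k :: "'n \<Rightarrow> nat"
      have bp: "box_volume k (N * h j) > 0" using N h by (intro box_volume_pos) simp
      have "measure (torus_ext \<nu>) (phi_ball (scale k) \<eta> (N * h j)) / box_volume k (N * h j) \<le> L / shape_weight q k"
        using L(2)[of "N * h j" k] bp N h[of j] by (simp add: pos_divide_le_eq)
      then have "C * shape_weight (2 powr (- t)) k * (measure (torus_ext \<nu>) (phi_ball (scale k) \<eta> (N * h j)) / box_volume k (N * h j))
          \<le> C * shape_weight (2 powr (- t)) k * (L / shape_weight q k)"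
        using C wpos[of k] by (intro mult_left_mono) (simp_all add: w2)
      also have "\<dots> = C * L * shape_weight q k" using wpos[of k] by (simp add: w2)
      finally show "u j k \<le> ennreal (C * L) * ennreal (shape_weight q k)"
        unfolding u_def using C L(1) wpos[of k] by (simp add: ennreal_mult[symmetric] ennreal_leI)
    qed
    show "(\<integral>\<^sup>+k. ennreal (C * L) * ennreal (shape_weight q k) \<partial>count_space (UNIV :: ('n \<Rightarrow> nat) set)) < \<infinity>"
      using summable_prod_geometric[OF q, where 'n='n] unfolding shape_weight_def
      by (simp add: nn_integral_cmult ennreal_mult_less_top)
    show "AE k in count_space UNIV. (\<lambda>i. u i k) \<longlonglongrightarrow> 0"
    proof (intro AE_I2)
      fix k :: "'n \<Rightarrow> nat"
      have "(\<lambda>i. C * shape_weight (2 powr (- t)) k *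
          (measure (torus_ext \<nu>) (phi_ball (scale k) \<eta> (N * h i)) / box_volume k (N * h i)))
          \<longlonglongrightarrow> C * shape_weight (2 powr (- t)) k * 0"
        using filterlim_compose[OF lim[of k] hr] by (intro tendsto_mult tendsto_const) 
      then show "(\<lambda>i. u i k) \<longlonglongrightarrow> 0"
        unfolding u_def by (intro tendsto_ennrealI[of _ 0, simplified]) simp
    qed
  qed auto
  then have lim0: "(\<lambda>i. \<integral>\<^sup>+k. u i k \<partial>count_space UNIV) \<longlonglongrightarrow> 0" by simp
  show "((\<lambda>z. \<integral>\<^sup>+\<zeta>. ennreal (cmod (poisson_kernel \<alpha> \<beta> z \<zeta>)) \<partial>\<nu>) \<circ> X) \<longlonglongrightarrow> 0"
    by (rule tendsto_sandwich[OF _ _ tendsto_const lim0]) (auto simp: le)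
qed

lemma poisson_kernel_mass_limit:
  fixes \<alpha> \<beta> \<eta> :: "complex ^ 'n"
  assumes "\<And>j. Re (\<alpha> $ j) + Re (\<beta> $ j) > -1"
    and "\<And>j (k::nat). k \<ge> 1 \<Longrightarrow> \<alpha> $ j \<noteq> - of_nat k \<and> \<beta> $ j \<noteq> - of_nat k"
  shows "((\<lambda>z. LINT \<zeta>|torus_haar. poisson_kernel \<alpha> \<beta> z \<zeta>) \<longlongrightarrow> 1) (at \<eta> within restricted_stolz A B \<eta>)"
proof (cases "\<eta> \<in> torus")
  case True
  let ?F = "at \<eta> within restricted_stolz A B \<eta>"
  have inS: "eventually (\<lambda>z. z \<in> restricted_stolz A B \<eta>) ?F" by (simp add: eventually_at_filter)
  let ?m = "\<lambda>j x. poisson_const (\<alpha> $ j) (\<beta> $ j) * (of_real (1 - x) powr (\<alpha> $ j + \<beta> $ j + 1) *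
      (\<Sum>n. binomial_coeff (\<alpha> $ j + 1) n * binomial_coeff (\<beta> $ j + 1) n * of_real x ^ n))"
  have "((\<lambda>z. ?m j ((cmod (z $ j))\<^sup>2)) \<longlongrightarrow> 1) ?F" for j
  proof (rule filterlim_compose[OF kernel_mass_limit[OF assms]])
    have "((\<lambda>z. (cmod (z $ j))\<^sup>2) \<longlongrightarrow> (cmod (\<eta> $ j))\<^sup>2) ?F" by (intro tendsto_intros)
    then have "((\<lambda>z. (cmod (z $ j))\<^sup>2) \<longlongrightarrow> 1) ?F" using True by (simp add: torus_def)
    moreover have "eventually (\<lambda>z. (cmod (z $ j))\<^sup>2 < 1) ?F"
      using inS by eventually_elim (use restricted_stolz_props(1) in \<open>auto simp: power_less_one_iff abs_square_less_1\<close>)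
    ultimately show "filterlim (\<lambda>z. (cmod (z $ j))\<^sup>2) (at_left 1) ?F"
      by (rule tendsto_imp_filterlim_at_left)
  qed
  then have "((\<lambda>z. \<Prod>j\<in>UNIV. ?m j ((cmod (z $ j))\<^sup>2)) \<longlongrightarrow> (\<Prod>j\<in>(UNIV :: 'n set). 1)) ?F"
    by (rule tendsto_prod)
  moreover have "eventually (\<lambda>z. (\<Prod>j\<in>UNIV. ?m j ((cmod (z $ j))\<^sup>2)) = (LINT \<zeta>|torus_haar. poisson_kernel \<alpha> \<beta> z \<zeta>)) ?F"
    using inS by eventually_elim (rule poisson_kernel_haar_integral[symmetric], rule restricted_stolz_props(1))
  ultimately show ?thesis using Lim_transform_eventually by fastforce
next
  case False
  have "restricted_stolz A B \<eta> = {}"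
    using False restricted_stolz_props(2) by (fastforce simp: torus_def)
  then show ?thesis by simp
qed

lemma finite_measure_density_norm:
  fixes g :: "'a \<Rightarrow> complex"
  assumes g: "integrable M g"
  shows "finite_measure (density M (\<lambda>x. ennreal (cmod (g x))))"
proof (intro finite_measureI)
  have "(\<lambda>x. ennreal (cmod (g x))) \<in> borel_measurable M"
    using borel_measurable_integrable[OF g] by measurable
  then have "emeasure (density M (\<lambda>x. ennreal (cmod (g x)))) (space M) = (\<integral>\<^sup>+x. ennreal (cmod (g x)) \<partial>M)"
    by (subst emeasure_density) (auto intro!: nn_integral_cong)
  also have "\<dots> = ennreal (LINT x|M. cmod (g x))"
    by (rule nn_integral_eq_integral) (use g in auto)
  finally show "emeasure (density M (\<lambda>x. ennreal (cmod (g x)))) (space (density M (\<lambda>x. ennreal (cmod (g x))))) \<noteq> \<infinity>"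
    by simp
qed

lemma norm_integral_le_nn_integral:
  fixes g :: "'a \<Rightarrow> complex"
  shows "ennreal (cmod (integral\<^sup>L M g)) \<le> (\<integral>\<^sup>+x. ennreal (cmod (g x)) \<partial>M)"
  by (cases "integrable M g") (simp_all add: integral_norm_bound_ennreal not_integrable_integral_eq)

lemma tendsto_0_of_ennreal_bound:
  fixes g :: "'a \<Rightarrow> complex"
  assumes "((\<lambda>z. h z) \<longlongrightarrow> (0::ennreal)) F" "eventually (\<lambda>z. ennreal (cmod (g z)) \<le> h z) F"
  shows "(g \<longlongrightarrow> 0) F"
proof -
  have "((\<lambda>z. ennreal (cmod (g z))) \<longlongrightarrow> ennreal 0) F"
    using tendsto_sandwich[OF _ assms(2) tendsto_const, of 0] assms(1) by simp
  then have "((\<lambda>z. cmod (g z)) \<longlongrightarrow> 0) F" by (rule tendsto_ennrealD) auto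
  then show ?thesis by (rule tendsto_norm_zero_cancel)
qed

text \<open>Split off the value \<open>c\<close> of the density: the rest of the measure consists of \<open>(f - c) dm\<close> and the
  singular part, both of vanishing density at \<open>\<eta>\<close>, and \<open>c dm\<close> contributes \<open>c\<close> in the limit.\<close>

lemma poisson_integral_RNT_lim:
  fixes \<alpha> \<beta> \<eta> :: "complex ^ 'n"
  assumes ab: "\<And>j. Re (\<alpha> $ j) + Re (\<beta> $ j) > -1"
    "\<And>j (k::nat). k \<ge> 1 \<Longrightarrow> \<alpha> $ j \<noteq> - of_nat k \<and> \<beta> $ j \<noteq> - of_nat k"
    and \<mu>: "complex_measure torus_borel \<mu>" and ld: "lebesgue_decomposition torus_haar \<mu> f \<sigma>"
    and t: "0 < t" "\<And>j. t \<le> Re (\<alpha> $ j) + Re (\<beta> $ j) + 1"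
    and vf: "vanishing_density (2 powr (- t / 2)) (torus_ext (density torus_haar (\<lambda>\<zeta>. ennreal (cmod (f \<zeta> - c))))) \<eta>"
    and v\<sigma>: "\<And>i. i < 4 \<Longrightarrow> vanishing_density (2 powr (- t / 2)) (torus_ext (jordan_part torus_haar \<sigma> i)) \<eta>"
  shows "RNT_lim (poisson_integral \<alpha> \<beta> \<mu>) \<eta> c"
  unfolding RNT_lim_def
proof (intro allI impI)
  fix A B :: real assume A: "A > 0" and B: "B \<ge> 1"
  interpret prob_space "torus_haar :: (complex ^ 'n) measure" by (rule prob_space_torus_haar)
  let ?F = "at \<eta> within restricted_stolz A B \<eta>"
  let ?P = "poisson_kernel \<alpha> \<beta>"
  have inS: "eventually (\<lambda>z. z \<in> restricted_stolz A B \<eta>) ?F" by (simp add: eventually_at_filter)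
  have f: "integrable torus_haar f" and \<sigma>: "complex_measure torus_haar \<sigma>"
    using ld by (auto simp: lebesgue_decomposition_def)
  note fm = borel_measurable_integrable[OF f]
  have fc: "integrable torus_haar (\<lambda>\<zeta>. f \<zeta> - c)" using f by simp
  have gm: "(\<lambda>\<zeta>. ennreal (cmod (f \<zeta> - c))) \<in> borel_measurable torus_haar"
    using borel_measurable_integrable[OF fc] by measurable
  have mb: "borel_measurable (torus_haar :: (complex ^ 'n) measure) = (borel_measurable torus_borel :: (_ \<Rightarrow> complex) set)"
    by (rule measurable_cong_sets) auto
  let ?D = "density torus_haar (\<lambda>\<zeta>. ennreal (cmod (f \<zeta> - c)))"
  have fD: "finite_measure ?D"
    by (rule finite_measure_density_norm[OF fc])
  have 1: "((\<lambda>z. LINT \<zeta>|torus_haar. ?P z \<zeta> * (f \<zeta> - c)) \<longlongrightarrow> 0) ?F"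
  proof (rule tendsto_0_of_ennreal_bound)
    show "((\<lambda>z. \<integral>\<^sup>+\<zeta>. ennreal (cmod (?P z \<zeta>)) \<partial>?D) \<longlongrightarrow> 0) ?F"
      by (rule kernel_integral_tendsto_0[OF fD _ t A B vf]) simp
    show "eventually (\<lambda>z. ennreal (cmod (LINT \<zeta>|torus_haar. ?P z \<zeta> * (f \<zeta> - c)))
        \<le> (\<integral>\<^sup>+\<zeta>. ennreal (cmod (?P z \<zeta>)) \<partial>?D)) ?F"
      using inS
    proof eventually_elim
      case (elim z)
      have Pm: "?P z \<in> borel_measurable torus_haar"
        unfolding mb by (rule borel_measurable_poisson_kernel) (rule restricted_stolz_props(1)[OF elim])
      have "(\<integral>\<^sup>+\<zeta>. ennreal (cmod (?P z \<zeta>)) \<partial>?D)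
          = (\<integral>\<^sup>+\<zeta>. ennreal (cmod (f \<zeta> - c)) * ennreal (cmod (?P z \<zeta>)) \<partial>torus_haar)"
        by (rule nn_integral_density[OF gm]) (use Pm in measurable)
      also have "\<dots> = (\<integral>\<^sup>+\<zeta>. ennreal (cmod (?P z \<zeta> * (f \<zeta> - c))) \<partial>torus_haar)"
        by (simp add: norm_mult ennreal_mult[symmetric] mult.commute)
      finally show ?case using norm_integral_le_nn_integral by metis
    qed
  qed
  have 2: "((\<lambda>z. integral\<^sup>L (jordan_part torus_haar \<sigma> i) (?P z)) \<longlongrightarrow> 0) ?F" if "i < 4" for i
  proof (rule tendsto_0_of_ennreal_bound)
    show "((\<lambda>z. \<integral>\<^sup>+\<zeta>. ennreal (cmod (?P z \<zeta>)) \<partial>jordan_part torus_haar \<sigma> i) \<longlongrightarrow> 0) ?F"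
      by (rule kernel_integral_tendsto_0[OF finite_measure_jordan_part[OF \<sigma>] _ t A B v\<sigma>[OF that]]) simp
  qed (intro always_eventually allI norm_integral_le_nn_integral)
  have "((\<lambda>z. c * (LINT \<zeta>|torus_haar. ?P z \<zeta>) + (LINT \<zeta>|torus_haar. ?P z \<zeta> * (f \<zeta> - c))
        + (\<Sum>i<4. jordan_coeff i * integral\<^sup>L (jordan_part torus_haar \<sigma> i) (?P z)))
      \<longlongrightarrow> c * 1 + 0 + (\<Sum>i<4. jordan_coeff i * 0)) ?F"
    by (intro tendsto_add tendsto_mult tendsto_const tendsto_sum 1 2 poisson_kernel_mass_limit ab) auto
  moreover have "eventually (\<lambda>z. c * (LINT \<zeta>|torus_haar. ?P z \<zeta>) + (LINT \<zeta>|torus_haar. ?P z \<zeta> * (f \<zeta> - c))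
        + (\<Sum>i<4. jordan_coeff i * integral\<^sup>L (jordan_part torus_haar \<sigma> i) (?P z)) = poisson_integral \<alpha> \<beta> \<mu> z) ?F"
    using inS
  proof eventually_elim
    case (elim z)
    note zd = restricted_stolz_props(1)[OF elim]
    obtain M where M: "\<And>\<zeta>. \<zeta> \<in> torus \<Longrightarrow> cmod (?P z \<zeta>) \<le> M" using poisson_kernel_bounded[OF zd] by blast
    have Pm: "?P z \<in> borel_measurable torus_haar"
      unfolding mb by (rule borel_measurable_poisson_kernel) (rule zd)
    have Pi: "integrable torus_haar (?P z)"
      by (rule integrable_const_bound[where B=M]) (use M Pm in auto)
    have Pfi: "integrable torus_haar (\<lambda>\<zeta>. ?P z \<zeta> * (f \<zeta> - c))"
    proof (rule Bochner_Integration.integrable_bound[OF integrable_mult_right[OF integrable_norm[OF fc], of M]])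
      show "AE \<zeta> in torus_haar. norm (?P z \<zeta> * (f \<zeta> - c)) \<le> norm (M * norm (f \<zeta> - c))"
        using M by (intro AE_I2) (auto simp: norm_mult abs_mult intro!: mult_right_mono order_trans[OF M abs_ge_self])
    qed (use Pm fm in measurable)
    have "(LINT \<zeta>|torus_haar. ?P z \<zeta> * f \<zeta>) = (LINT \<zeta>|torus_haar. c * ?P z \<zeta> + ?P z \<zeta> * (f \<zeta> - c))"
      by (intro Bochner_Integration.integral_cong refl) (simp add: algebra_simps)
    also have "\<dots> = c * (LINT \<zeta>|torus_haar. ?P z \<zeta>) + (LINT \<zeta>|torus_haar. ?P z \<zeta> * (f \<zeta> - c))"
      using Pi Pfi by simp
    finally have "(LINT \<zeta>|torus_haar. ?P z \<zeta> * f \<zeta>)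
        = c * (LINT \<zeta>|torus_haar. ?P z \<zeta>) + (LINT \<zeta>|torus_haar. ?P z \<zeta> * (f \<zeta> - c))" .
    moreover have "poisson_integral \<alpha> \<beta> \<mu> z = (LINT \<zeta>|torus_haar. ?P z \<zeta> * f \<zeta>)
        + (\<Sum>i<4. jordan_coeff i * integral\<^sup>L (jordan_part torus_haar \<sigma> i) (?P z))"
      unfolding poisson_integral_def
      by (rule complex_measure_integral_lebesgue_decomposition[OF \<mu> _ ld Pm, of M]) (use M in auto)
    ultimately show ?case by simp
  qed
  ultimately show "(poisson_integral \<alpha> \<beta> \<mu> \<longlongrightarrow> c) ?F"
    using Lim_transform_eventually by fastforce
qed

lemma AE_torus_haar_of_ext:
  "AE x in torus_ext torus_haar. P x \<Longrightarrow> AE x in torus_haar. P x"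
  unfolding torus_ext_def by (rule AE_distrD[OF torus_inclusion_measurable']) auto

lemma vanishing_density_singular:
  fixes \<nu> :: "(complex ^ 'n) measure"
  assumes \<nu>: "finite_measure \<nu>" "sets \<nu> = sets torus_borel"
    and N: "N \<in> null_sets torus_haar" "emeasure \<nu> (torus - N) = 0" and q: "0 < q" "q < 1"
  shows "AE \<eta> in torus_haar. vanishing_density q (torus_ext \<nu>) \<eta>"
proof -
  note \<nu>' = finite_measure_torus_ext[OF \<nu>] sets_torus_ext
  have Nb: "N \<in> sets borel"
    using N(1) sets_torus by (auto simp: null_sets_def torus_borel_def sets_restrict_space)
  have "emeasure (torus_ext \<nu>) (- N) = 0"
    using N(2) Nb by (subst emeasure_torus_ext[OF \<nu>(2)]) (auto simp: Diff_eq Int_commute)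
  then have "AE x in torus_ext torus_haar. x \<in> - N \<longrightarrow>
      ((\<lambda>h. measure (torus_ext \<nu>) (phi_ball (scale k) x h) / box_volume k h) \<longlongrightarrow> 0) (at_right 0)" for k
    using Nb by (intro ball_differentiation.density_zero_off_support[OF ball_differentiation_scale \<nu>']) auto
  then have "AE x in torus_ext torus_haar. \<forall>k. x \<in> - N \<longrightarrow>
      ((\<lambda>h. measure (torus_ext \<nu>) (phi_ball (scale k) x h) / box_volume k h) \<longlongrightarrow> 0) (at_right 0)"
    by (subst AE_all_countable) auto
  from AE_torus_haar_of_ext[OF this] AE_torus_haar_of_ext[OF maximal_bound_all_shapes[OF \<nu>' q]] AE_not_in[OF N(1)]
  show ?thesis
    by eventually_elim (auto simp: vanishing_density_def)
qed

text \<open>The measure depends on \<open>\<eta>\<close> here.  For the domination it is compared with \<open>|f| dm + |f \<eta>| dm\<close>, whose first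
  part is fixed and whose second part is bounded by the volumes of the boxes.\<close>

lemma vanishing_density_lebesgue:
  fixes f :: "complex ^ 'n \<Rightarrow> complex"
  assumes f: "integrable torus_haar f" and q: "0 < q" "q < 1"
  shows "AE \<eta> in torus_haar. vanishing_density q (torus_ext (density torus_haar (\<lambda>\<zeta>. ennreal (cmod (f \<zeta> - f \<eta>))))) \<eta>"
proof -
  interpret prob_space "torus_haar :: (complex ^ 'n) measure" by (rule prob_space_torus_haar)
  let ?H = "torus_ext torus_haar :: (complex ^ 'n) measure"
  let ?D = "\<lambda>c. density torus_haar (\<lambda>\<zeta>. ennreal (cmod (f \<zeta> - c)))"
  have incl: "(\<lambda>x. x) \<in> torus_haar \<rightarrow>\<^sub>M (borel :: (complex ^ 'n) measure)"
    by (rule torus_inclusion_measurable') simp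
  define g where "g x = indicator torus x *\<^sub>R f x" for x
  have fm: "f \<in> borel_measurable (restrict_space borel torus)"
    using borel_measurable_integrable[OF f] measurable_cong_sets[OF sets_torus_haar refl] unfolding torus_borel_def by blast
  then have gm: "g \<in> borel_measurable borel"
    unfolding g_def using sets_torus by (subst (asm) borel_measurable_restrict_space_iff) auto
  have gf: "g x = f x" if "x \<in> torus" for x using that by (simp add: g_def)
  have gi: "integrable ?H g"
    unfolding torus_ext_def
    by (subst integrable_distr_eq[OF incl gm]) (use f gf Bochner_Integration.integrable_cong[of torus_haar torus_haar g f] in simp)
  have De: "torus_ext (?D c) = density ?H (\<lambda>y. ennreal (cmod (g y - c)))" for c
  proof -
    have m: "(\<lambda>y. ennreal (cmod (g y - c))) \<in> borel_measurable borel" using gm by measurable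
    have "density torus_haar (\<lambda>\<zeta>. ennreal (cmod (g \<zeta> - c))) = ?D c"
      by (intro density_cong AE_I2) (use measurable_compose[OF incl m] borel_measurable_integrable[OF f] gf in \<open>auto\<close>)
    then show ?thesis
      unfolding torus_ext_def using density_distr[OF m incl] by simp
  qed
  have fD: "finite_measure (?D c)" for c
    using f by (intro finite_measure_density_norm) simp
  have fE: "finite_measure (torus_ext (?D c))" for c by (rule finite_measure_torus_ext[OF fD]) simp
  have "AE x in ?H. ((\<lambda>h. measure (density ?H (\<lambda>y. ennreal (cmod (g y - g x)))) (phi_ball (scale k) x h) / box_volume k h)
           \<longlongrightarrow> 0) (at_right 0)" for k
    by (rule ball_differentiation.lebesgue_point_density[OF ball_differentiation_scale gi])
  then have "AE x in ?H. \<forall>k. ((\<lambda>h. measure (density ?H (\<lambda>y. ennreal (cmod (g y - g x)))) (phi_ball (scale k) x h) / box_volume k h)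
           \<longlongrightarrow> 0) (at_right 0)"
    by (subst AE_all_countable) auto
  from AE_torus_haar_of_ext[OF this]
    AE_torus_haar_of_ext[OF maximal_bound_all_shapes[OF fE[of 0] sets_torus_ext q]] AE_space
  show ?thesis
  proof eventually_elim
    case (elim \<eta>)
    then have \<eta>: "\<eta> \<in> torus" by simp
    obtain L where L: "L > 0" "\<And>k h. h > 0 \<Longrightarrow>
        measure (torus_ext (?D 0)) (phi_ball (scale k) \<eta> h) \<le> L / shape_weight q k * box_volume k h"
      using elim(2) by blast
    let ?c = "cmod (f \<eta>)"
    have "measure (torus_ext (?D (f \<eta>))) (phi_ball (scale k) \<eta> h)
        \<le> (L + ?c * 30 ^ CARD('n)) / shape_weight q k * box_volume k h" if h: "h > 0" for k h
    proof -
      let ?B = "phi_ball (scale k) \<eta> h"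
      have Bb: "?B \<in> sets borel" by (rule sets_phi_ball[OF continuous_scale])
      then have B: "?B \<inter> torus \<in> sets torus_haar" by (auto simp: torus_borel_def sets_restrict_space)
      interpret d: finite_measure "torus_ext (?D (f \<eta>))" by (rule fE)
      interpret d0: finite_measure "torus_ext (?D 0)" by (rule fE)
      interpret H: finite_measure ?H by (rule finite_measure_torus_ext) (unfold_locales, simp)
      have fm': "f \<in> borel_measurable torus_haar" using f by simp
      have "emeasure (torus_ext (?D (f \<eta>))) ?B = (\<integral>\<^sup>+\<zeta>. ennreal (cmod (f \<zeta> - f \<eta>)) * indicator (?B \<inter> torus) \<zeta> \<partial>torus_haar)"
        using fm' B by (subst emeasure_torus_ext[OF _ Bb]) (auto simp: emeasure_density)
      also have "\<dots> \<le> (\<integral>\<^sup>+\<zeta>. ennreal (cmod (f \<zeta> - 0)) * indicator (?B \<inter> torus) \<zeta> + ennreal ?c * indicator (?B \<inter> torus) \<zeta> \<partial>torus_haar)"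
        by (intro nn_integral_mono)
          (auto simp: indicator_def ennreal_plus[symmetric] simp del: ennreal_plus intro!: ennreal_leI norm_triangle_ineq4)
      also have "\<dots> = (\<integral>\<^sup>+\<zeta>. ennreal (cmod (f \<zeta> - 0)) * indicator (?B \<inter> torus) \<zeta> \<partial>torus_haar) + (\<integral>\<^sup>+\<zeta>. ennreal ?c * indicator (?B \<inter> torus) \<zeta> \<partial>torus_haar)"
        using fm' borel_measurable_indicator[OF B]
        by (intro nn_integral_add borel_measurable_times_ennreal) auto
      also have "(\<integral>\<^sup>+\<zeta>. ennreal (cmod (f \<zeta> - 0)) * indicator (?B \<inter> torus) \<zeta> \<partial>torus_haar) = emeasure (torus_ext (?D 0)) ?B"
        using fm' B by (subst emeasure_torus_ext[OF _ Bb]) (auto simp: emeasure_density)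
      also have "(\<integral>\<^sup>+\<zeta>. ennreal ?c * indicator (?B \<inter> torus) \<zeta> \<partial>torus_haar) = ennreal ?c * emeasure ?H ?B"
        using B by (subst emeasure_torus_ext[OF _ Bb]) (auto simp: nn_integral_cmult_indicator)
      finally have "measure (torus_ext (?D (f \<eta>))) ?B \<le> measure (torus_ext (?D 0)) ?B + ?c * measure ?H ?B"
        by (simp add: d.emeasure_eq_measure d0.emeasure_eq_measure[unfolded diff_0_right] H.emeasure_eq_measure ennreal_mult[symmetric]
            ennreal_plus[symmetric] del: ennreal_plus)
      also have "\<dots> \<le> L / shape_weight q k * box_volume k h + ?c * (30 ^ CARD('n) / shape_weight q k * box_volume k h)"
      proof (intro add_mono L(2)[OF h] mult_left_mono)
        have "measure ?H ?B \<le> measure ?H (phi_ball (scale k) \<eta> (5 * h))"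
          using h by (intro H.finite_measure_mono phi_ball_mono) (auto intro: sets_phi_ball[OF continuous_scale])
        also have "\<dots> \<le> 30 ^ CARD('n) * box_volume k h"
          by (rule ball_differentiation.volume_bound[OF ball_differentiation_scale h])
        also have "\<dots> \<le> 30 ^ CARD('n) / shape_weight q k * box_volume k h"
        proof (intro mult_right_mono)
          have "0 < shape_weight q k" "shape_weight q k \<le> 1"
            using q unfolding shape_weight_def by (auto intro!: prod_pos prod_le_1 power_le_one)
          then show "(30::real) ^ CARD('n) \<le> 30 ^ CARD('n) / shape_weight q k"
            by (simp add: le_divide_eq)
        qed (use box_volume_pos[OF h, of k] in simp)
        finally show "measure ?H ?B \<le> 30 ^ CARD('n) / shape_weight q k * box_volume k h" .
      qed simp
      finally show ?thesis by (simp add: algebra_simps add_divide_distrib)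
    qed
    moreover have "L + ?c * 30 ^ CARD('n) > 0" using L(1) by (intro add_pos_nonneg) auto
    moreover have "((\<lambda>h. measure (torus_ext (?D (f \<eta>))) (phi_ball (scale k) \<eta> h) / box_volume k h) \<longlongrightarrow> 0) (at_right 0)" for k
      using elim(1) unfolding De[of "f \<eta>"] gf[OF \<eta>] by blast
    ultimately show ?case unfolding vanishing_density_def by blast
  qed
qed

theorem corollary4p11:
  fixes \<alpha> \<beta> :: "complex ^ 'n"
    and \<mu> \<sigma> :: "(complex ^ 'n) set \<Rightarrow> complex"
    and f :: "complex ^ 'n \<Rightarrow> complex"
  assumes "\<And>j. Re (\<alpha> $ j) + Re (\<beta> $ j) > -1"
    and "\<And>j (k::nat). k \<ge> 1 \<Longrightarrow> \<alpha> $ j \<noteq> - of_nat k \<and> \<beta> $ j \<noteq> - of_nat k"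
    and "complex_measure torus_borel \<mu>"
    and "lebesgue_decomposition torus_haar \<mu> f \<sigma>"
  shows "AE \<zeta> in torus_haar. RNT_lim (poisson_integral \<alpha> \<beta> \<mu>) \<zeta> (f \<zeta>)"
proof -
  \<comment> \<open>The smallest decay exponent, so that one geometric weight serves all factors of the kernel.\<close>
  define t where "t = (MIN j. Re (\<alpha> $ j) + Re (\<beta> $ j) + 1)"
  have t0: "0 < t"
  proof -
    have "0 < Re (\<alpha> $ j) + Re (\<beta> $ j) + 1" for j using assms(1)[of j] by linarith
    then show ?thesis unfolding t_def by (subst Min_gr_iff) auto
  qed
  have t1: "t \<le> Re (\<alpha> $ j) + Re (\<beta> $ j) + 1" for j unfolding t_def by (rule Min_le) auto
  have q: "0 < (2::real) powr (- t / 2)" "(2::real) powr (- t / 2) < 1"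
    using t0 powr_less_one[of 2 "- t / 2"] by simp_all
  have f: "integrable torus_haar f" and \<sigma>: "complex_measure torus_haar \<sigma>" and sing: "singular_wrt \<sigma> torus_haar"
    using assms(4) by (auto simp: lebesgue_decomposition_def)
  obtain N where N: "N \<in> null_sets torus_haar" "\<And>A. A \<in> sets torus_haar \<Longrightarrow> A \<inter> N = {} \<Longrightarrow> \<sigma> A = 0"
    using sing unfolding singular_wrt_def by blast
  have "AE \<eta> in torus_haar. vanishing_density (2 powr (- t / 2)) (torus_ext (jordan_part torus_haar \<sigma> i)) \<eta>" for i
  proof (rule vanishing_density_singular[OF finite_measure_jordan_part[OF \<sigma>] _ N(1) _ q])
    have "torus - N \<in> sets torus_haar"
      using N(1) sets.top[of torus_haar] by (auto simp: null_sets_def)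
    then show "emeasure (jordan_part torus_haar \<sigma> i) (torus - N) = 0"
      using N(2) by (intro jordan_part_null[OF \<sigma>]) auto
  qed simp
  then have "AE \<eta> in torus_haar. \<forall>i. vanishing_density (2 powr (- t / 2)) (torus_ext (jordan_part torus_haar \<sigma> i)) \<eta>"
    by (subst AE_all_countable) auto
  with vanishing_density_lebesgue[OF f q] show ?thesis
    by eventually_elim (rule poisson_integral_RNT_lim[OF assms t0 t1], auto)
qed

end
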